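(* Let $G$ be a compact group, $\mathscr X$ a homogeneous space of $G$, $x_0\in\mathscr X$ a fixed point and $K$ its isotropy group. Let $T=(T_x)_{x\in\mathscr X}$ be an a.s. square integrable, isotropic, centered, real Gaussian random field on $\mathscr X$. Then there exists a real left-$K$-invariant function $f\in L^2(\mathscr X)$ such that $T$ and $T^f$ have the same law, where $T^f_x:=S(L_g f)$ for any $g\in G$ with $gx_0=x$.
   Context: $G$ is a compact topological group acting continuously and transitively on $\mathscr X$ by $(g,x)\mapsto gx$; $K=\{g\in G: gx_0=x_0\}$, so $\mathscr X\cong G/K$. $\mathscr X$ carries the $G$-invariant probability measure $dx$ (image of the normalized Haar measure of $G$ under $g\mapsto gx_0$), and $L^2(\mathscr X)=L^2(\mathscr X,dx)$ (complex valued). A random field on $\mathscr X$ is a measurable map $(\omega,x)\mapsto T_x(\omega)$ on $\Omega\times\mathscr X$; it is a.s. square integrable if $\int_{\mathscr X}|T_x|^2dx<\infty$ a.s. For $h\in L^2(\mathscr X)$ put $T(h)=\int_{\mathscr X}T_x\overline{h(x)}\,dx$. $T$ is centered real Gaussian if it is real valued and $T(h)$ is a centered Gaussian random variable for every real $h\in L^2(\mathscr X)$. With $L_gh(x)=h(g^{-1}x)$, $T$ is isotropic if for every $m\ge1$, $h_1,\dots,h_m\in L^2(\mathscr X)$ and $g\in G$ the vectors $(T(h_1),\dots,T(h_m))$ and $(T(L_gh_1),\dots,T(L_gh_m))$ have the same law. Two such fields $T,T'$ have the same law if $(T(h_1),\dots,T(h_m))$ and $(T'(h_1),\dots,T'(h_m))$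 have the same law for all $m$ and all $h_1,\dots,h_m\in L^2(\mathscr X)$. $f$ is left-$K$-invariant if $f(kx)=f(x)$ for $k\in K$. White noise: let $(e_n)_n$ be an orthonormal basis of the space of real square integrable functions on $\mathscr X$ and $(X_n)_n$ i.i.d. standard real Gaussian variables; $S(\sum_k\alpha_ke_k):=\sum_k\alpha_kX_k$, extended to complex functions by $S(f_1+if_2)=S(f_1)+iS(f_2)$. For left-$K$-invariant $f$ the variable $S(L_gf)$ depends only on $x=gx_0$, so $T^f$ is well defined (a jointly measurable version is understood). *)

theory Defs
  imports "HOL-Probability.Probability"
begin

(* Groups are written additively because the library's class of topological groups is
   topological_group_add; group_add is not assumed commutative. Thus g + h is the product
   gh, 0 the identity and - g the inverse of g. *)

definition continuous_action ::
  "('g::topological_group_add \<Rightarrow> 'x::topological_space \<Rightarrow> 'x) \<Rightarrow> bool" where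
  "continuous_action act \<longleftrightarrow>
     continuous_on UNIV (\<lambda>(g, x). act g x) \<and>
     (\<forall>x. act 0 x = x) \<and>
     (\<forall>g h x. act (g + h) x = act g (act h x))"

definition transitive_action :: "('g \<Rightarrow> 'x \<Rightarrow> 'x) \<Rightarrow> bool" where
  "transitive_action act \<longleftrightarrow> (\<forall>x y. \<exists>g. act g x = y)"

definition isotropy_group :: "('g \<Rightarrow> 'x \<Rightarrow> 'x) \<Rightarrow> 'x \<Rightarrow> 'g set" where
  "isotropy_group act x0 = {g. act g x0 = x0}"

(* Inner regularity is automatic for second countable groups; for a general compact
   Hausdorff group it is part of the definition of Haar measure. *)
definition normalized_haar :: "'g::topological_group_add measure \<Rightarrow> bool" where
  "normalized_haar \<nu> \<longleftrightarrow>
     prob_space \<nu> \<and> sets \<nu> = sets borel \<and>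
     (\<forall>g. distr \<nu> \<nu> (\<lambda>h. g + h) = \<nu>) \<and>
     (\<forall>A\<in>sets \<nu>. emeasure \<nu> A = (SUP C\<in>{C. C \<subseteq> A \<and> compact C \<and> C \<in> sets \<nu>}. emeasure \<nu> C))"

definition invariant_measure ::
  "'g measure \<Rightarrow> ('g \<Rightarrow> 'x::topological_space \<Rightarrow> 'x) \<Rightarrow> 'x \<Rightarrow> 'x measure" where
  "invariant_measure \<nu> act x0 = distr \<nu> borel (\<lambda>g. act g x0)"

definition translate :: "('g::group_add \<Rightarrow> 'x \<Rightarrow> 'x) \<Rightarrow> 'g \<Rightarrow> ('x \<Rightarrow> 'b) \<Rightarrow> 'x \<Rightarrow> 'b" where
  "translate act g h = (\<lambda>x. h (act (- g) x))"

definition left_invariant :: "('g \<Rightarrow> 'x \<Rightarrow> 'x) \<Rightarrow> 'g set \<Rightarrow> ('x \<Rightarrow> 'b) \<Rightarrow> bool" where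
  "left_invariant act K f \<longleftrightarrow> (\<forall>k\<in>K. \<forall>x. f (act k x) = f x)"

definition square_integrable ::
  "'x measure \<Rightarrow> ('x \<Rightarrow> 'b::{real_normed_vector, second_countable_topology}) \<Rightarrow> bool" where
  "square_integrable \<mu> f \<longleftrightarrow> f \<in> borel_measurable \<mu> \<and> integrable \<mu> (\<lambda>x. (norm (f x))\<^sup>2)"

(* Unordered summation of a family of functions in mean square; the nonnegative integral
   is used so that no integrability needs to be known beforehand. *)
definition L2_has_sum ::
  "'x measure \<Rightarrow> 'i set \<Rightarrow> ('i \<Rightarrow> 'x \<Rightarrow> 'b::real_normed_vector) \<Rightarrow> ('x \<Rightarrow> 'b) \<Rightarrow> bool" where
  "L2_has_sum \<mu> I u f \<longleftrightarrow>
     ((\<lambda>F. \<integral>\<^sup>+ x. ennreal ((norm (f x - (\<Sum>i\<in>F. u i x)))\<^sup>2) \<partial>\<mu>) \<longlongrightarrow> 0) (finite_subsets_at_top I)"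

definition random_field :: "'a measure \<Rightarrow> 'x measure \<Rightarrow> ('x \<Rightarrow> 'a \<Rightarrow> complex) \<Rightarrow> bool" where
  "random_field M \<mu> T \<longleftrightarrow> (\<lambda>(\<omega>, x). T x \<omega>) \<in> borel_measurable (M \<Otimes>\<^sub>M \<mu>)"

definition as_square_integrable :: "'a measure \<Rightarrow> 'x measure \<Rightarrow> ('x \<Rightarrow> 'a \<Rightarrow> complex) \<Rightarrow> bool" where
  "as_square_integrable M \<mu> T \<longleftrightarrow> (AE \<omega> in M. square_integrable \<mu> (\<lambda>x. T x \<omega>))"

definition field_pairing ::
  "'x measure \<Rightarrow> ('x \<Rightarrow> 'a \<Rightarrow> complex) \<Rightarrow> ('x \<Rightarrow> complex) \<Rightarrow> 'a \<Rightarrow> complex" where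
  "field_pairing \<mu> T h = (\<lambda>\<omega>. \<integral>x. T x \<omega> * cnj (h x) \<partial>\<mu>)"

(* The degenerate law concentrated at 0 counts as Gaussian. *)
definition centered_gaussian :: "'a measure \<Rightarrow> ('a \<Rightarrow> real) \<Rightarrow> bool" where
  "centered_gaussian M Y \<longleftrightarrow>
     Y \<in> borel_measurable M \<and>
     ((AE \<omega> in M. Y \<omega> = 0) \<or> (\<exists>\<sigma>>0. distributed M lborel Y (normal_density 0 \<sigma>)))"

(* For a real valued field and real h the pairing is real, so Re only changes the type. *)
definition centered_real_gaussian_field ::
  "'a measure \<Rightarrow> 'x measure \<Rightarrow> ('x \<Rightarrow> 'a \<Rightarrow> complex) \<Rightarrow> bool" where
  "centered_real_gaussian_field M \<mu> T \<longleftrightarrow>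
     (\<forall>\<omega>\<in>space M. \<forall>x. T x \<omega> \<in> \<real>) \<and>
     (\<forall>h. square_integrable \<mu> h \<and> (\<forall>x. h x \<in> \<real>) \<longrightarrow>
        centered_gaussian M (\<lambda>\<omega>. Re (field_pairing \<mu> T h \<omega>)))"

definition pairing_law ::
  "'a measure \<Rightarrow> 'x measure \<Rightarrow> ('x \<Rightarrow> 'a \<Rightarrow> complex) \<Rightarrow> nat \<Rightarrow> (nat \<Rightarrow> 'x \<Rightarrow> complex) \<Rightarrow>
     (nat \<Rightarrow> complex) measure" where
  "pairing_law M \<mu> T m h =
     distr M (\<Pi>\<^sub>M i\<in>{..<m}. borel) (\<lambda>\<omega>. \<lambda>i\<in>{..<m}. field_pairing \<mu> T (h i) \<omega>)"

definition isotropic ::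
  "('g::group_add \<Rightarrow> 'x \<Rightarrow> 'x) \<Rightarrow> 'a measure \<Rightarrow> 'x measure \<Rightarrow> ('x \<Rightarrow> 'a \<Rightarrow> complex) \<Rightarrow> bool" where
  "isotropic act M \<mu> T \<longleftrightarrow>
     (\<forall>m\<ge>1. \<forall>h. (\<forall>i<m. square_integrable \<mu> (h i)) \<longrightarrow>
        (\<forall>g. pairing_law M \<mu> T m h = pairing_law M \<mu> T m (\<lambda>i. translate act g (h i))))"

definition same_law ::
  "'x measure \<Rightarrow> 'a measure \<Rightarrow> ('x \<Rightarrow> 'a \<Rightarrow> complex) \<Rightarrow>
     'b measure \<Rightarrow> ('x \<Rightarrow> 'b \<Rightarrow> complex) \<Rightarrow> bool" where
  "same_law \<mu> M T N T' \<longleftrightarrow>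
     (\<forall>m\<ge>1. \<forall>h. (\<forall>i<m. square_integrable \<mu> (h i)) \<longrightarrow>
        pairing_law M \<mu> T m h = pairing_law N \<mu> T' m h)"

(* The index set I is arbitrary: finite if the space is finite-dimensional, and possibly
   uncountable if the group is not second countable. *)
definition real_orthonormal_basis ::
  "'x measure \<Rightarrow> 'i set \<Rightarrow> ('i \<Rightarrow> 'x \<Rightarrow> real) \<Rightarrow> bool" where
  "real_orthonormal_basis \<mu> I e \<longleftrightarrow>
     (\<forall>i\<in>I. square_integrable \<mu> (e i)) \<and>
     (\<forall>i\<in>I. \<forall>j\<in>I. (\<integral>x. e i x * e j x \<partial>\<mu>) = (if i = j then 1 else 0)) \<and>
     (\<forall>\<phi>. square_integrable \<mu> \<phi> \<longrightarrow>
        L2_has_sum \<mu> I (\<lambda>i x. (\<integral>y. \<phi> y * e i y \<partial>\<mu>) * e i x) \<phi>)"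

(* S is determined by e and X only up to null sets, for each argument separately. *)
definition white_noise ::
  "'w measure \<Rightarrow> 'x measure \<Rightarrow> 'i set \<Rightarrow> ('i \<Rightarrow> 'x \<Rightarrow> real) \<Rightarrow> ('i \<Rightarrow> 'w \<Rightarrow> real) \<Rightarrow>
     (('x \<Rightarrow> complex) \<Rightarrow> 'w \<Rightarrow> complex) \<Rightarrow> bool" where
  "white_noise N \<mu> I e X S \<longleftrightarrow>
     prob_space N \<and>
     real_orthonormal_basis \<mu> I e \<and>
     prob_space.indep_vars N (\<lambda>_. borel) X I \<and>
     (\<forall>i\<in>I. distributed N lborel (X i) std_normal_density) \<and>
     (\<forall>f. square_integrable \<mu> f \<longrightarrow> S f \<in> borel_measurable N) \<and>
     (\<forall>\<phi>::'x \<Rightarrow> real. square_integrable \<mu> \<phi> \<longrightarrow>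
        L2_has_sum N I (\<lambda>i \<omega>. complex_of_real ((\<integral>y. \<phi> y * e i y \<partial>\<mu>) * X i \<omega>))
          (S (\<lambda>x. complex_of_real (\<phi> x)))) \<and>
     (\<forall>f. square_integrable \<mu> f \<longrightarrow>
        (AE \<omega> in N. S f \<omega> =
           S (\<lambda>x. complex_of_real (Re (f x))) \<omega> + \<i> * S (\<lambda>x. complex_of_real (Im (f x))) \<omega>))"

(* T' is a jointly measurable version of the field T^f, where T^f at x is S(L_g f) for any
   g with g x0 = x. *)
definition noise_field_version ::
  "('g::group_add \<Rightarrow> 'x \<Rightarrow> 'x) \<Rightarrow> 'x \<Rightarrow> 'w measure \<Rightarrow> 'x measure \<Rightarrow>
     (('x \<Rightarrow> complex) \<Rightarrow> 'w \<Rightarrow> complex) \<Rightarrow> ('x \<Rightarrow> complex) \<Rightarrow> ('x \<Rightarrow> 'w \<Rightarrow> complex) \<Rightarrow> bool" where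
  "noise_field_version act x0 N \<mu> S f T' \<longleftrightarrow>
     random_field N \<mu> T' \<and>
     (\<forall>x g. act g x0 = x \<longrightarrow> (AE \<omega> in N. T' x \<omega> = S (translate act g f) \<omega>))"

end

theory Submission
  imports Defs
begin

text \<open>
  Let \<open>C h = E T(h)\<^sup>2\<close> be the covariance form of \<open>T\<close>. A Paley--Zygmund argument shows that
  \<open>E \<parallel>T\<parallel>\<^sup>2\<close> is finite, so \<open>C\<close> has a kernel; averaging it over the group,
  \<open>r x y = \<integral> E [T (g x) T (g y)] dg\<close>, makes it invariant at every point, with constant diagonal.
  If \<open>R\<close> is the operator with kernel \<open>r\<close>, scaled to \<open>0 \<le> R \<le> 1\<close>, and \<open>b i\<close> are the Taylor
  coefficients of \<open>(1 - s) powr (-1/2)\<close>, then the functions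
  \<open>\<Sum>i<n. b i (1 - R)^i (r x0)\<close> form a Cauchy sequence in mean square: their norms are
  controlled by the moments \<open>\<langle>(1 - R)^k (r x0), r x0\<rangle> \<ge> 0\<close>, whose sum is at most \<open>r x0 x0\<close>.
  The limit \<open>f\<close> is invariant under the isotropy group, and convolution with \<open>f\<close> acts as a square
  root of \<open>R\<close>. Hence \<open>T\<^sup>f(h) = S(h * f)\<close> is a centered Gaussian variable with variance
  \<open>\<parallel>h * f\<parallel>\<^sup>2 = C h\<close>, and the laws agree by the theorem of Cramer and Wold.

  The group need not be second countable, so the action need not be measurable for the product
  of the Borel sigma-algebras. It is measurable into the Baire sigma-algebra, and every square
  integrable function agrees almost everywhere with a Baire measurable one.
\<close>

section \<open>Square integrable functions\<close>

text \<open>With s = 1 - R the series is that of R^(-1/2), an operator that is unbounded when R has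
  arbitrarily small spectrum. It is applied only to \<open>r x\<close>, formally R d for a unit mass
  d at \<open>x\<close>, so the limit is formally R^(1/2) d, a row of the kernel of the square root.
  The sum of the moments is formally <R^(-1) R d, R d> = <R d, d>, which explains the bound
  \<open>r x0 x0\<close>. The square of the series is the geometric series, so squared norms of
  partial sums become plain sums of moments. Null sets shape the proof: f must be invariant at every
  point, and L_g f may depend on g x0 only. Hence kernels and operators act on functions rather than
  classes, and the limit is a pointwise \<open>lim\<close> along one subsequence that serves all
  \<open>x\<close>. A second obstacle is that an orthonormal basis may be uncountable. Parseval's
  identity then cannot be summed inside an expectation, so every argument with a basis goes through
  finite subsets and mean-square limits.\<close>

lemma square_integrable_real:
  fixes f :: "'x \<Rightarrow> real"
  shows "square_integrable M f \<longleftrightarrow> f \<in> borel_measurable M \<and> integrable M (\<lambda>x. (f x)\<^sup>2)"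
  by (simp add: square_integrable_def)

lemma square_integrable_measurable [dest]:
  "square_integrable M f \<Longrightarrow> f \<in> borel_measurable M"
  by (simp add: square_integrable_def)

lemma square_integrable_mult_integrable:
  fixes f g :: "'x \<Rightarrow> real"
  assumes "square_integrable M f" "square_integrable M g"
  shows "integrable M (\<lambda>x. f x * g x)"
proof (rule Bochner_Integration.integrable_bound)
  show "integrable M (\<lambda>x. (f x)\<^sup>2 + (g x)\<^sup>2)"
    using assms by (auto simp: square_integrable_real)
  show "(\<lambda>x. f x * g x) \<in> borel_measurable M"
    using assms by (auto simp: square_integrable_real)
  show "AE x in M. norm (f x * g x) \<le> norm ((f x)\<^sup>2 + (g x)\<^sup>2)"
  proof (rule AE_I2)
    fix x
    have "0 \<le> (\<bar>f x\<bar> - \<bar>g x\<bar>)\<^sup>2 + \<bar>f x\<bar> * \<bar>g x\<bar>" by simp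
    then have "\<bar>f x\<bar> * \<bar>g x\<bar> \<le> (f x)\<^sup>2 + (g x)\<^sup>2" by (simp add: power2_diff)
    then show "norm (f x * g x) \<le> norm ((f x)\<^sup>2 + (g x)\<^sup>2)" by (simp add: abs_mult)
  qed
qed

lemma square_integrable_zero [simp]: "square_integrable M (\<lambda>x. 0 :: real)"
  by (simp add: square_integrable_real)

lemma square_integrable_cmult:
  fixes f :: "'x \<Rightarrow> real"
  shows "square_integrable M f \<Longrightarrow> square_integrable M (\<lambda>x. c * f x)"
  by (auto simp: square_integrable_real power_mult_distrib)

lemma square_integrable_add:
  fixes f g :: "'x \<Rightarrow> real"
  assumes "square_integrable M f" "square_integrable M g"
  shows "square_integrable M (\<lambda>x. f x + g x)"
  using assms square_integrable_mult_integrable[OF assms]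
  by (auto simp: square_integrable_real power2_sum mult.assoc)

lemma square_integrable_diff:
  fixes f g :: "'x \<Rightarrow> real"
  assumes "square_integrable M f" "square_integrable M g"
  shows "square_integrable M (\<lambda>x. f x - g x)"
  using square_integrable_add[OF assms(1) square_integrable_cmult[OF assms(2), of "-1"]] by simp

lemma square_integrable_sum:
  fixes f :: "'i \<Rightarrow> 'x \<Rightarrow> real"
  assumes "\<And>i. i \<in> A \<Longrightarrow> square_integrable M (f i)"
  shows "square_integrable M (\<lambda>x. \<Sum>i\<in>A. f i x)"
  using assms by (induction A rule: infinite_finite_induct) (auto intro: square_integrable_add)

lemma (in finite_measure) square_integrable_bounded:
  fixes f :: "'a \<Rightarrow> real"
  assumes "f \<in> borel_measurable M" "\<And>x. x \<in> space M \<Longrightarrow> \<bar>f x\<bar> \<le> B"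
  shows "square_integrable M f"
  unfolding square_integrable_real
proof (intro conjI assms(1) integrable_const_bound[where B = "B\<^sup>2"] AE_I2)
  fix x assume "x \<in> space M"
  with assms(2) have "\<bar>f x\<bar>\<^sup>2 \<le> B\<^sup>2" by (intro power_mono) auto
  then show "norm ((f x)\<^sup>2) \<le> B\<^sup>2" by simp
qed (use assms in measurable)

lemma (in finite_measure) square_integrable_indicator:
  "A \<in> sets M \<Longrightarrow> square_integrable M (indicator A :: 'a \<Rightarrow> real)"
  by (rule square_integrable_bounded[where B = 1]) (auto simp: indicator_def)

lemma (in finite_measure) square_integrable_integrable:
  fixes f :: "'a \<Rightarrow> real"
  assumes "square_integrable M f"
  shows "integrable M f"
  using square_integrable_mult_integrable[OF assms square_integrable_bounded[of "\<lambda>_. 1" 1]]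
  by simp

text \<open>The quadratic polynomial t -> ||f + t g||^2 is nonnegative; its value at the minimiser
  -b/a is the claim. If a = 0 the polynomial is affine, which forces b = 0.\<close>

lemma square_integrable_cauchy_schwarz:
  fixes f g :: "'x \<Rightarrow> real"
  assumes f: "square_integrable M f" and g: "square_integrable M g"
  shows "(\<integral>x. f x * g x \<partial>M)\<^sup>2 \<le> (\<integral>x. (f x)\<^sup>2 \<partial>M) * (\<integral>x. (g x)\<^sup>2 \<partial>M)"
proof -
  define a where "a = (\<integral>x. (g x)\<^sup>2 \<partial>M)"
  define b where "b = (\<integral>x. f x * g x \<partial>M)"
  define c where "c = (\<integral>x. (f x)\<^sup>2 \<partial>M)"
  have int: "integrable M (\<lambda>x. (f x)\<^sup>2)" "integrable M (\<lambda>x. (g x)\<^sup>2)" "integrable M (\<lambda>x. f x * g x)"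
    using f g square_integrable_mult_integrable[OF f g] by (auto simp: square_integrable_real)
  have q: "0 \<le> c + 2 * t * b + t\<^sup>2 * a" for t
  proof -
    have "0 \<le> (\<integral>x. (f x + t * g x)\<^sup>2 \<partial>M)" by simp
    also have "\<dots> = (\<integral>x. (f x)\<^sup>2 + 2 * t * (f x * g x) + t\<^sup>2 * (g x)\<^sup>2 \<partial>M)"
      by (simp add: power2_sum power_mult_distrib algebra_simps)
    also have "\<dots> = c + 2 * t * b + t\<^sup>2 * a"
      using int by (simp add: a_def b_def c_def)
    finally show ?thesis .
  qed
  have "a \<ge> 0" by (simp add: a_def)
  have "b\<^sup>2 \<le> c * a"
  proof (cases "a = 0")
    case True
    have "b = 0"
    proof (rule ccontr)
      assume "b \<noteq> 0"
      \<comment> \<open>At this t the affine function c + 2 t b takes the value -1.\<close>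
      then show False using q[of "- (c + 1) / (2 * b)"] True by (simp add: field_simps)
    qed
    then show ?thesis using True by simp
  next
    case False
    with \<open>a \<ge> 0\<close> have "a > 0" by simp
    have "0 \<le> c + 2 * (- b / a) * b + (- b / a)\<^sup>2 * a" by (rule q)
    also have "\<dots> = c - b\<^sup>2 / a" using False by (simp add: power2_eq_square field_simps)
    finally have "b\<^sup>2 / a \<le> c" by simp
    then show ?thesis using \<open>a > 0\<close> by (simp add: pos_divide_le_eq)
  qed
  then show ?thesis by (simp add: a_def b_def c_def)
qed

lemma square_integrable_if_nn_integral:
  fixes f :: "'x \<Rightarrow> real"
  assumes "f \<in> borel_measurable M" "(\<integral>\<^sup>+x. ennreal ((f x)\<^sup>2) \<partial>M) \<le> ennreal c" "c \<ge> 0"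
  shows "square_integrable M f" "(\<integral>x. (f x)\<^sup>2 \<partial>M) \<le> c"
proof -
  have "(\<integral>\<^sup>+x. ennreal ((f x)\<^sup>2) \<partial>M) < \<infinity>"
    using assms(2) by (rule le_less_trans) simp
  then show sq: "square_integrable M f"
    unfolding square_integrable_real using assms(1) by (auto intro!: integrableI_nonneg)
  have "ennreal (\<integral>x. (f x)\<^sup>2 \<partial>M) \<le> ennreal c"
    using sq assms by (subst nn_integral_eq_integral[symmetric]) (auto simp: square_integrable_real)
  then show "(\<integral>x. (f x)\<^sup>2 \<partial>M) \<le> c" using assms by simp
qed

lemma nn_integral_square_integrable:
  fixes f :: "'x \<Rightarrow> real"
  assumes "square_integrable M f"
  shows "(\<integral>\<^sup>+x. ennreal ((f x)\<^sup>2) \<partial>M) = ennreal (\<integral>x. (f x)\<^sup>2 \<partial>M)"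
  using assms by (intro nn_integral_eq_integral) (auto simp: square_integrable_real)

text \<open>By monotone convergence the sum of the series has a finite integral, hence is finite
  almost everywhere.\<close>

lemma AE_summable_if_integral_summable:
  fixes d :: "nat \<Rightarrow> 'x \<Rightarrow> real"
  assumes int: "\<And>n. integrable M (d n)" and nn: "\<And>n x. 0 \<le> d n x"
    and le: "\<And>n. (\<integral>x. d n x \<partial>M) \<le> c n" and c: "summable c"
  shows "AE x in M. summable (\<lambda>n. d n x)"
proof -
  have c0: "0 \<le> c n" for n by (rule order_trans[OF _ le[of n]]) (simp add: nn)
  have meas: "d n \<in> borel_measurable M" for n using int[of n] by simp
  have "(\<integral>\<^sup>+x. (\<Sum>n. ennreal (d n x)) \<partial>M) = (\<Sum>n. \<integral>\<^sup>+x. ennreal (d n x) \<partial>M)"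
    using meas by (intro nn_integral_suminf) auto
  also have "\<dots> \<le> (\<Sum>n. ennreal (c n))"
    using le nn int by (intro suminf_le) (auto simp: nn_integral_eq_integral ennreal_leI)
  also have "\<dots> = ennreal (suminf c)" using c c0 by (intro suminf_ennreal2) auto
  finally have "(\<integral>\<^sup>+x. (\<Sum>n. ennreal (d n x)) \<partial>M) \<noteq> \<infinity>"
    using neq_top_trans[of "ennreal (suminf c)"] by auto
  then have "AE x in M. (\<Sum>n. ennreal (d n x)) \<noteq> \<infinity>"
    using meas by (intro nn_integral_PInf_AE) auto
  then show ?thesis
    by eventually_elim (use nn in \<open>auto intro!: summable_suminf_not_top\<close>)
qed

lemma AE_tendsto_if_L2_summable:
  fixes u :: "nat \<Rightarrow> 'x \<Rightarrow> real"
  assumes "\<And>n. square_integrable M (\<lambda>x. u n x - v x)"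
    and "\<And>n. (\<integral>x. (u n x - v x)\<^sup>2 \<partial>M) \<le> c n" "summable c"
  shows "AE x in M. (\<lambda>n. u n x) \<longlonglongrightarrow> v x"
proof -
  have "AE x in M. summable (\<lambda>n. (u n x - v x)\<^sup>2)"
    using assms by (intro AE_summable_if_integral_summable) (auto simp: square_integrable_real)
  then show ?thesis
  proof eventually_elim
    case (elim x)
    have "(\<lambda>n. (u n x - v x)\<^sup>2) \<longlonglongrightarrow> 0" using elim by (rule summable_LIMSEQ_zero)
    from tendsto_real_sqrt[OF this] have "(\<lambda>n. \<bar>u n x - v x\<bar>) \<longlonglongrightarrow> 0" by simp
    then have "(\<lambda>n. u n x - v x) \<longlonglongrightarrow> 0" by (rule tendsto_rabs_zero_cancel)
    then show ?case by (simp add: LIM_zero_iff)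
  qed
qed

text \<open>The rate 1/4 for squared distances makes the increments summable in mean, so the
  sequence converges almost everywhere. The limit is the pointwise \<open>lim\<close> and not a
  chosen representative: symmetries and joint measurability of the approximants then pass to it at
  every point.\<close>

lemma L2_fast_cauchy_limit:
  fixes f :: "nat \<Rightarrow> 'x \<Rightarrow> real"
  assumes "prob_space M"
    and sq: "\<And>n. square_integrable M (f n)"
    and cau: "\<And>n m. n \<le> m \<Longrightarrow> (\<integral>x. (f m x - f n x)\<^sup>2 \<partial>M) \<le> (1/4)^n"
  defines "F \<equiv> \<lambda>x. lim (\<lambda>n. f n x)"
  shows "square_integrable M F" "\<And>n. (\<integral>x. (F x - f n x)\<^sup>2 \<partial>M) \<le> (1/4)^n"
proof -
  interpret prob_space M by fact
  have meas[measurable]: "f n \<in> borel_measurable M" for n using sq by blast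
  have F[measurable]: "F \<in> borel_measurable M"
    unfolding F_def by (rule borel_measurable_lim_metric) simp
  have d: "square_integrable M (\<lambda>x. \<bar>f (Suc n) x - f n x\<bar>)" for n
    using square_integrable_diff[OF sq[of "Suc n"] sq[of n]] by (simp add: square_integrable_real)
  have le: "(\<integral>x. \<bar>f (Suc n) x - f n x\<bar> \<partial>M) \<le> (1/2)^n" for n
  proof -
    have "(\<integral>x. \<bar>f (Suc n) x - f n x\<bar> * 1 \<partial>M)\<^sup>2 \<le>
        (\<integral>x. \<bar>f (Suc n) x - f n x\<bar>\<^sup>2 \<partial>M) * (\<integral>x. 1\<^sup>2 \<partial>M)"
      by (rule square_integrable_cauchy_schwarz[OF d]) (simp add: square_integrable_real)
    also have "\<dots> \<le> (1/4)^n" using cau[of n "Suc n"] by (simp add: prob_space)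
    also have "\<dots> = ((1/2)^n)\<^sup>2" by (simp add: power2_eq_square flip: power_mult_distrib)
    finally have "(\<integral>x. \<bar>f (Suc n) x - f n x\<bar> \<partial>M)\<^sup>2 \<le> ((1/2)^n)\<^sup>2"
      by (simp only: mult_1_right)
    then show ?thesis by (rule power2_le_imp_le) simp
  qed
  have "AE x in M. summable (\<lambda>n. \<bar>f (Suc n) x - f n x\<bar>)"
    using d le by (intro AE_summable_if_integral_summable[where c = "\<lambda>n. (1/2)^n"])
      (auto intro: square_integrable_integrable)
  then have lim: "AE x in M. (\<lambda>n. f n x) \<longlonglongrightarrow> F x"
  proof eventually_elim
    case (elim x)
    then have "summable (\<lambda>n. f (Suc n) x - f n x)" by (rule summable_rabs_cancel)
    then have "convergent (\<lambda>n. f n x - f 0 x)"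
      by (simp only: summable_iff_convergent sum_lessThan_telescope[of "\<lambda>n. f n x"])
    then have "convergent (\<lambda>n. (f n x - f 0 x) + f 0 x)" by (intro convergent_add convergent_const)
    then show ?case by (simp add: F_def convergent_LIMSEQ_iff)
  qed
  \<comment> \<open>Fatou's lemma in m, with n fixed, transfers the Cauchy rate to the
    limit.\<close>
  have nn: "(\<integral>\<^sup>+x. ennreal ((F x - f n x)\<^sup>2) \<partial>M) \<le> ennreal ((1/4)^n)" for n
  proof -
    have "(\<integral>\<^sup>+x. ennreal ((F x - f n x)\<^sup>2) \<partial>M) = (\<integral>\<^sup>+x. liminf (\<lambda>m. ennreal ((f m x - f n x)\<^sup>2)) \<partial>M)"
    proof (intro nn_integral_cong_AE, use lim in eventually_elim)
      case (elim x)
      have "(\<lambda>m. ennreal ((f m x - f n x)\<^sup>2)) \<longlonglongrightarrow> ennreal ((F x - f n x)\<^sup>2)"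
        by (intro tendsto_intros elim)
      from lim_imp_Liminf[OF _ this] show ?case by simp
    qed
    also have "\<dots> \<le> liminf (\<lambda>m. \<integral>\<^sup>+x. ennreal ((f m x - f n x)\<^sup>2) \<partial>M)"
      by (intro nn_integral_liminf) auto
    also have "\<dots> \<le> ennreal ((1/4)^n)"
    proof (rule Liminf_le)
      show "\<forall>\<^sub>F m in sequentially. (\<integral>\<^sup>+x. ennreal ((f m x - f n x)\<^sup>2) \<partial>M) \<le> ennreal ((1/4)^n)"
        using eventually_ge_at_top[of n]
      proof eventually_elim
        case (elim m)
        show ?case using cau[OF elim]
          by (simp add: nn_integral_square_integrable[OF square_integrable_diff[OF sq sq]] ennreal_leI)
      qed
    qed simp
    finally show ?thesis .
  qed
  note F_diff = square_integrable_if_nn_integral[OF _ nn, of n for n]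
  show "(\<integral>x. (F x - f n x)\<^sup>2 \<partial>M) \<le> (1/4)^n" for n by (rule F_diff(2)) auto
  have "square_integrable M (\<lambda>x. (F x - f 0 x) + f 0 x)"
    by (intro square_integrable_add sq F_diff(1)) auto
  then show "square_integrable M F" by simp
qed

lemma square_integrable_tendsto_dominated:
  fixes u :: "nat \<Rightarrow> 'x \<Rightarrow> real"
  assumes "square_integrable M v" "\<And>n. u n \<in> borel_measurable M"
    and "\<And>n x. x \<in> space M \<Longrightarrow> \<bar>u n x\<bar> \<le> \<bar>v x\<bar>"
    and "\<And>x. x \<in> space M \<Longrightarrow> (\<lambda>n. u n x) \<longlonglongrightarrow> v x"
  shows "\<And>n. square_integrable M (u n)" "(\<lambda>n. \<integral>x. (u n x - v x)\<^sup>2 \<partial>M) \<longlonglongrightarrow> 0"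
proof -
  have le: "(u n x)\<^sup>2 \<le> (v x)\<^sup>2" if "x \<in> space M" for n x
    using assms(3)[OF that] by (simp add: abs_le_square_iff)
  have v: "integrable M (\<lambda>x. (v x)\<^sup>2)" "v \<in> borel_measurable M"
    using assms(1) by (auto simp: square_integrable_real)
  show "square_integrable M (u n)" for n
    unfolding square_integrable_real
    by (intro conjI assms(2) Bochner_Integration.integrable_bound[OF v(1)] AE_I2)
       (use le assms(2) in \<open>auto simp: borel_measurable_power\<close>)
  have "(\<lambda>n. \<integral>x. (u n x - v x)\<^sup>2 \<partial>M) \<longlonglongrightarrow> (\<integral>x. 0 \<partial>M)"
  proof (rule integral_dominated_convergence[where w = "\<lambda>x. 4 * (v x)\<^sup>2"])
    show "AE x in M. (\<lambda>n. (u n x - v x)\<^sup>2) \<longlonglongrightarrow> 0"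
    proof (rule AE_I2)
      fix x assume "x \<in> space M"
      then have "(\<lambda>n. (u n x - v x)\<^sup>2) \<longlonglongrightarrow> (v x - v x)\<^sup>2" by (intro tendsto_intros assms(4))
      then show "(\<lambda>n. (u n x - v x)\<^sup>2) \<longlonglongrightarrow> 0" by simp
    qed
    show "AE x in M. norm ((u n x - v x)\<^sup>2) \<le> 4 * (v x)\<^sup>2" for n
    proof (rule AE_I2)
      fix x assume x: "x \<in> space M"
      have "0 \<le> (u n x + v x)\<^sup>2" by simp
      then have "(u n x - v x)\<^sup>2 \<le> 2 * (u n x)\<^sup>2 + 2 * (v x)\<^sup>2" by (simp add: power2_sum power2_diff)
      then show "norm ((u n x - v x)\<^sup>2) \<le> 4 * (v x)\<^sup>2" using le[OF x, of n] by simp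
    qed
  qed (use v assms(2) in auto)
  then show "(\<lambda>n. \<integral>x. (u n x - v x)\<^sup>2 \<partial>M) \<longlonglongrightarrow> 0" by simp
qed

text \<open>Dynkin's theorem leads from the generator \<open>E\<close> to all measurable sets,
  monotone approximation to nonnegative functions, and the splitting into positive and negative
  parts to all of them. Every limit involved is dominated, hence a mean-square limit, so
  \<open>lim\<close> is the only closure property required. The rule yields both density statements
  and Baire versions on products.\<close>

lemma (in finite_measure) square_integrable_induct [consumes 2, case_names space basic cmult add lim]:
  fixes F :: "'a \<Rightarrow> real"
  assumes F: "square_integrable M F"
    and gen: "Int_stable E" "E \<subseteq> Pow (space M)" "sets M = sigma_sets (space M) E"
    and space: "Q (indicator (space M))"
    and basic: "\<And>A. A \<in> E \<Longrightarrow> Q (indicator A)"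
    and cmult: "\<And>u c. square_integrable M u \<Longrightarrow> Q u \<Longrightarrow> Q (\<lambda>x. c * u x)"
    and add: "\<And>u v. square_integrable M u \<Longrightarrow> square_integrable M v \<Longrightarrow> Q u \<Longrightarrow> Q v
      \<Longrightarrow> Q (\<lambda>x. u x + v x)"
    and lim: "\<And>u v. (\<And>n. square_integrable M (u n)) \<Longrightarrow> (\<And>n. Q (u n)) \<Longrightarrow>
      square_integrable M v \<Longrightarrow> (\<lambda>n. \<integral>x. (u n x - v x)\<^sup>2 \<partial>M) \<longlonglongrightarrow> 0 \<Longrightarrow> Q v"
  shows "Q F"
proof -
  have diff: "Q (\<lambda>x. u x - v x)"
    if "square_integrable M u" "square_integrable M v" "Q u" "Q v" for u v
    using add[OF that(1) square_integrable_cmult[OF that(2)] that(3) cmult[OF that(2,4)], of "-1"]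
    by simp
  have zero: "Q (\<lambda>x. 0)"
    using cmult[OF _ space, of 0] by (simp add: square_integrable_indicator)
  have set: "Q (indicator A)" if "A \<in> sets M" for A
    using gen(1,2) that[unfolded gen(3)]
  proof (induction A rule: sigma_sets_induct_disjoint)
    case (basic A) then show ?case by (rule assms(6))
  next
    case empty show ?case using zero by (simp add: indicator_def)
  next
    case (compl A)
    then have A: "A \<in> sets M" by (simp add: gen(3))
    have "(indicator (space M - A) :: 'a \<Rightarrow> real) = (\<lambda>x. indicator (space M) x - indicator A x)"
      using sets.sets_into_space[OF A] by (auto simp: indicator_def fun_eq_iff)
    then show ?case
      using A by (auto intro!: diff space compl square_integrable_indicator)
  next
    case (union A)
    then have A: "A i \<in> sets M" for i by (auto simp: gen(3))
    define u where "u n x = (\<Sum>i<n. indicator (A i) x :: real)" for n x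
    have ind: "u n = indicator (\<Union>i<n. A i)" for n
      unfolding u_def fun_eq_iff
      by (intro allI indicator_UN_disjoint[symmetric] disjoint_family_on_mono[OF subset_UNIV union(1)]) simp
    have Qu: "Q (u n)" for n
    proof (induction n)
      case 0 show ?case using zero by (simp add: u_def[abs_def])
    next
      case (Suc n)
      have "Q (\<lambda>x. u n x + indicator (A n) x)"
        by (intro add Suc union) (use A in \<open>auto simp: ind intro!: square_integrable_indicator\<close>)
      then show ?case by (simp add: u_def[abs_def])
    qed
    have sqU: "square_integrable M (indicator (\<Union>i. A i) :: 'a \<Rightarrow> real)"
      using A by (intro square_integrable_indicator) auto
    have um: "u n \<in> borel_measurable M" for n using A by (simp add: ind)
    have dom: "\<bar>u n x\<bar> \<le> \<bar>indicator (\<Union>i. A i) x\<bar>" for n x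
      by (auto simp: ind indicator_def)
    have conv: "(\<lambda>n. u n x) \<longlonglongrightarrow> indicator (\<Union>i. A i) x" for x
      unfolding ind by (rule LIMSEQ_indicator_UN)
    show ?case
      by (rule lim[of u]) (use square_integrable_tendsto_dominated[OF sqU um dom conv] Qu sqU in auto)
  qed
  have nonneg: "square_integrable M u \<longrightarrow> Q u"
    if "u \<in> borel_measurable M" "\<And>x. 0 \<le> u x" for u :: "'a \<Rightarrow> real"
    using that
  proof (induction u rule: borel_measurable_induct_real)
    case (set A) then show ?case using \<open>A \<in> sets M \<Longrightarrow> Q (indicator A)\<close> by blast
  next
    case (mult u c)
    show ?case
    \<comment> \<open>For \<open>c = 0\<close> square integrability of the product says nothing
      about \<open>u\<close>.\<close>
    proof (cases "c = 0")
      case True then show ?thesis using zero by simp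
    next
      case False
      show ?thesis
      proof
        assume "square_integrable M (\<lambda>x. c * u x)"
        from square_integrable_cmult[OF this, of "1 / c"] False have "square_integrable M u" by simp
        with mult show "Q (\<lambda>x. c * u x)" by (auto intro: cmult)
      qed
    qed
  next
    case (add u v)
    show ?case
    proof
      assume s: "square_integrable M (\<lambda>x. v x + u x)"
      then have int: "integrable M (\<lambda>x. (v x + u x)\<^sup>2)" by (simp add: square_integrable_real)
      \<comment> \<open>Both functions are nonnegative, so each is dominated by the sum.\<close>
      have "square_integrable M u" "square_integrable M v"
        unfolding square_integrable_real
        using add
        by (auto intro!: Bochner_Integration.integrable_bound[OF int] AE_I2 power_mono)
      with add show "Q (\<lambda>x. v x + u x)" by (auto intro: assms(8))
    qed
  next
    case (seq U)
    show ?case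
    proof
      assume s: "square_integrable M u"
      have le: "U n x \<le> u x" if "x \<in> space M" for n x
        using seq.hyps(3) seq.hyps(4)[OF that]
        by (intro incseq_le) (auto simp: incseq_def le_fun_def)
      have dom: "\<bar>U n x\<bar> \<le> \<bar>u x\<bar>" if "x \<in> space M" for n x
        using le[OF that, of n] seq.hyps(2)[of n x] by simp
      note c = square_integrable_tendsto_dominated[OF s seq.hyps(1) dom seq.hyps(4)]
      show "Q u" by (rule lim[of U]) (use c seq.IH s in auto)
    qed
  qed
  have Fm: "F \<in> borel_measurable M" "integrable M (\<lambda>x. (F x)\<^sup>2)"
    using F by (auto simp: square_integrable_real)
  have p: "square_integrable M (\<lambda>x. max 0 (F x))" "square_integrable M (\<lambda>x. max 0 (- F x))"
    unfolding square_integrable_real using Fm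
    by (auto intro!: Bochner_Integration.integrable_bound[OF Fm(2)] AE_I2 simp: max_def)
  have "Q (\<lambda>x. max 0 (F x) - max 0 (- F x))"
    using p Fm by (intro diff p nonneg[rule_format]) auto
  moreover have "(\<lambda>x. max 0 (F x) - max 0 (- F x)) = F" by (auto simp: max_def)
  ultimately show ?thesis by simp
qed

lemma square_add_le: "(a + b)\<^sup>2 \<le> 2 * a\<^sup>2 + 2 * (b::real)\<^sup>2"
proof -
  have "0 \<le> (a - b)\<^sup>2" by simp
  then show ?thesis by (simp add: power2_sum power2_diff)
qed

lemma L2_add_le:
  fixes u v :: "'x \<Rightarrow> real"
  assumes "square_integrable M u" "square_integrable M v"
  shows "(\<integral>x. (u x + v x)\<^sup>2 \<partial>M) \<le> 2 * (\<integral>x. (u x)\<^sup>2 \<partial>M) + 2 * (\<integral>x. (v x)\<^sup>2 \<partial>M)"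
proof -
  have "(\<integral>x. (u x + v x)\<^sup>2 \<partial>M) \<le> (\<integral>x. 2 * (u x)\<^sup>2 + 2 * (v x)\<^sup>2 \<partial>M)"
    using assms square_integrable_add[OF assms]
    by (intro integral_mono square_add_le) (auto simp: square_integrable_real)
  also have "\<dots> = 2 * (\<integral>x. (u x)\<^sup>2 \<partial>M) + 2 * (\<integral>x. (v x)\<^sup>2 \<partial>M)"
    using assms by (simp add: square_integrable_real)
  finally show ?thesis .
qed

text \<open>The mean-square closure of a linear class is closed under the operations of
  \<open>square_integrable_induct\<close>, so only generating sets need to be approximated.\<close>

lemma (in finite_measure) square_integrable_dense:
  fixes F :: "'a \<Rightarrow> real"
  assumes F: "square_integrable M F"
    and gen: "Int_stable E" "E \<subseteq> Pow (space M)" "sets M = sigma_sets (space M) E"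
    and sq: "\<And>s. s \<in> \<S> \<Longrightarrow> square_integrable M s"
    and cmult: "\<And>s c. s \<in> \<S> \<Longrightarrow> (\<lambda>x. c * s x) \<in> \<S>"
    and add: "\<And>s t. s \<in> \<S> \<Longrightarrow> t \<in> \<S> \<Longrightarrow> (\<lambda>x. s x + t x) \<in> \<S>"
    and space: "\<And>e. 0 < e \<Longrightarrow> \<exists>s\<in>\<S>. (\<integral>x. (indicator (space M) x - s x)\<^sup>2 \<partial>M) \<le> e"
    and basic: "\<And>A e. A \<in> E \<Longrightarrow> 0 < e \<Longrightarrow> \<exists>s\<in>\<S>. (\<integral>x. (indicator A x - s x)\<^sup>2 \<partial>M) \<le> e"
    and e: "0 < e"
  shows "\<exists>s\<in>\<S>. (\<integral>x. (F x - s x)\<^sup>2 \<partial>M) \<le> e"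
proof -
  let ?Q = "\<lambda>u :: 'a \<Rightarrow> real. \<forall>e>(0::real). \<exists>s\<in>\<S>. (\<integral>x. (u x - s x)\<^sup>2 \<partial>M) \<le> e"
  have "?Q F"
  proof (rule square_integrable_induct[where Q = ?Q, OF F gen])
    show "?Q (indicator (space M))" using space by blast
    show "?Q (indicator A)" if "A \<in> E" for A using basic[OF that] by blast
  next
    fix u :: "'a \<Rightarrow> real" and c assume u: "square_integrable M u" "?Q u"
    show "?Q (\<lambda>x. c * u x)"
    proof (intro allI impI)
      fix e :: real assume e: "0 < e"
      \<comment> \<open>Dividing the error by c^2 + 1 instead of c^2 covers c = 0.\<close>
      have p: "0 < c\<^sup>2 + 1" by (simp add: add_nonneg_pos)
      with e have "0 < e / (c\<^sup>2 + 1)" by simp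
      with u(2) obtain s where s: "s \<in> \<S>" "(\<integral>x. (u x - s x)\<^sup>2 \<partial>M) \<le> e / (c\<^sup>2 + 1)" by blast
      have "(c * u x - c * s x)\<^sup>2 = c\<^sup>2 * (u x - s x)\<^sup>2" for x
        by (simp add: power2_eq_square algebra_simps)
      then have "(\<integral>x. (c * u x - c * s x)\<^sup>2 \<partial>M) = c\<^sup>2 * (\<integral>x. (u x - s x)\<^sup>2 \<partial>M)" by simp
      also have "\<dots> \<le> c\<^sup>2 * (e / (c\<^sup>2 + 1))" using s(2) by (intro mult_left_mono) auto
      also have "\<dots> = (c\<^sup>2 * e) / (c\<^sup>2 + 1)" by simp
      also have "\<dots> \<le> e" unfolding pos_divide_le_eq[OF p] using e by (simp add: distrib_left)
      finally show "\<exists>s\<in>\<S>. (\<integral>x. (c * u x - s x)\<^sup>2 \<partial>M) \<le> e"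
        by (rule bexI[OF _ cmult[OF s(1)]])
    qed
  next
    fix u v :: "'a \<Rightarrow> real" assume uv: "square_integrable M u" "square_integrable M v" "?Q u" "?Q v"
    show "?Q (\<lambda>x. u x + v x)"
    proof (intro allI impI)
      fix e :: real assume e: "0 < e"
      \<comment> \<open>The factors 2 in \<open>L2_add_le\<close> turn two errors e/4 into
        e.\<close>
      then have "0 < e / 4" by simp
      with uv(3,4) obtain s t where s: "s \<in> \<S>" "(\<integral>x. (u x - s x)\<^sup>2 \<partial>M) \<le> e / 4"
        and t: "t \<in> \<S>" "(\<integral>x. (v x - t x)\<^sup>2 \<partial>M) \<le> e / 4" by meson
      have "(\<integral>x. ((u x + v x) - (s x + t x))\<^sup>2 \<partial>M) = (\<integral>x. ((u x - s x) + (v x - t x))\<^sup>2 \<partial>M)"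
        by (simp add: algebra_simps)
      also have "\<dots> \<le> e"
        using L2_add_le[OF square_integrable_diff[OF uv(1) sq[OF s(1)]]
            square_integrable_diff[OF uv(2) sq[OF t(1)]]] s(2) t(2) by simp
      finally show "\<exists>s\<in>\<S>. (\<integral>x. (u x + v x - s x)\<^sup>2 \<partial>M) \<le> e"
        by (rule bexI[OF _ add[OF s(1) t(1)]])
    qed
  next
    fix u :: "nat \<Rightarrow> 'a \<Rightarrow> real" and v
    assume u: "\<And>n. square_integrable M (u n)" "\<And>n. ?Q (u n)" "square_integrable M v"
      "(\<lambda>n. \<integral>x. (u n x - v x)\<^sup>2 \<partial>M) \<longlonglongrightarrow> 0"
    show "?Q v"
    proof (intro allI impI)
      fix e :: real assume e: "0 < e"
      then have e4: "0 < e / 4" by simp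
      obtain n where n: "(\<integral>x. (u n x - v x)\<^sup>2 \<partial>M) < e / 4"
        using order_tendstoD(2)[OF u(4) e4] by (auto simp: eventually_sequentially)
      obtain s where s: "s \<in> \<S>" "(\<integral>x. (u n x - s x)\<^sup>2 \<partial>M) \<le> e / 4"
        using u(2) e4 by blast
      have "(\<integral>x. (v x - s x)\<^sup>2 \<partial>M) = (\<integral>x. ((v x - u n x) + (u n x - s x))\<^sup>2 \<partial>M)" by simp
      also have "\<dots> \<le> e"
        using L2_add_le[OF square_integrable_diff[OF u(3) u(1)]
            square_integrable_diff[OF u(1) sq[OF s(1)]], of n n] s(2) n
        by (simp add: power2_commute[of "v _"])
      finally show "\<exists>s\<in>\<S>. (\<integral>x. (v x - s x)\<^sup>2 \<partial>M) \<le> e" using s(1) by blast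
    qed
  qed
  then show ?thesis using e by blast
qed

section \<open>Square roots of invariant kernels\<close>

text \<open>The filter is arbitrary because the lemma serves both sequences and the net of finite
  subsets of a basis.\<close>

lemma L2_inner_tendsto:
  fixes u v :: "'f \<Rightarrow> 'x \<Rightarrow> real"
  assumes u: "\<And>F. square_integrable M (u F)" "square_integrable M a"
    and v: "\<And>F. square_integrable M (v F)" "square_integrable M b"
    and lim: "((\<lambda>F. \<integral>x. (a x - u F x)\<^sup>2 \<partial>M) \<longlongrightarrow> 0) \<F>" "((\<lambda>F. \<integral>x. (b x - v F x)\<^sup>2 \<partial>M) \<longlongrightarrow> 0) \<F>"
  shows "((\<lambda>F. \<integral>x. u F x * v F x \<partial>M) \<longlongrightarrow> (\<integral>x. a x * b x \<partial>M)) \<F>"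
proof -
  let ?p = "\<lambda>F. \<integral>x. (a x - u F x)\<^sup>2 \<partial>M" and ?q = "\<lambda>F. \<integral>x. (b x - v F x)\<^sup>2 \<partial>M"
  let ?e = "\<lambda>F. sqrt (?p F * ?q F) + sqrt (?p F * (\<integral>x. (b x)\<^sup>2 \<partial>M)) + sqrt (?q F * (\<integral>x. (a x)\<^sup>2 \<partial>M))"
  note d = square_integrable_diff[OF u(2) u(1)] square_integrable_diff[OF v(2) v(1)]
  have le: "\<bar>(\<integral>x. u F x * v F x \<partial>M) - (\<integral>x. a x * b x \<partial>M)\<bar> \<le> ?e F" for F
  proof -
    have i: "integrable M (\<lambda>x. (a x - u F x) * (b x - v F x))" "integrable M (\<lambda>x. (a x - u F x) * b x)"
      "integrable M (\<lambda>x. (b x - v F x) * a x)" "integrable M (\<lambda>x. a x * b x)" "integrable M (\<lambda>x. u F x * v F x)"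
      by (intro square_integrable_mult_integrable d u v)+
    have "(\<integral>x. u F x * v F x \<partial>M) - (\<integral>x. a x * b x \<partial>M) = (\<integral>x. u F x * v F x - a x * b x \<partial>M)"
      using i by simp
    also have "\<dots> = (\<integral>x. (a x - u F x) * (b x - v F x) - (a x - u F x) * b x - (b x - v F x) * a x \<partial>M)"
      by (intro Bochner_Integration.integral_cong refl) (simp add: algebra_simps)
    also have "\<dots> = (\<integral>x. (a x - u F x) * (b x - v F x) \<partial>M) - (\<integral>x. (a x - u F x) * b x \<partial>M)
        - (\<integral>x. (b x - v F x) * a x \<partial>M)" using i by simp
    finally have eq: "(\<integral>x. u F x * v F x \<partial>M) - (\<integral>x. a x * b x \<partial>M) = \<dots>" .
    have "\<bar>\<integral>x. (a x - u F x) * (b x - v F x) \<partial>M\<bar> \<le> sqrt (?p F * ?q F)"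
      "\<bar>\<integral>x. (a x - u F x) * b x \<partial>M\<bar> \<le> sqrt (?p F * (\<integral>x. (b x)\<^sup>2 \<partial>M))"
      "\<bar>\<integral>x. (b x - v F x) * a x \<partial>M\<bar> \<le> sqrt (?q F * (\<integral>x. (a x)\<^sup>2 \<partial>M))"
      by (intro real_le_rsqrt; simp add: square_integrable_cauchy_schwarz d u v)+
    then show ?thesis unfolding eq by linarith
  qed
  have "(?e \<longlongrightarrow> sqrt (0 * 0) + sqrt (0 * (\<integral>x. (b x)\<^sup>2 \<partial>M)) + sqrt (0 * (\<integral>x. (a x)\<^sup>2 \<partial>M))) \<F>"
    by (intro tendsto_intros lim)
  then have "(?e \<longlongrightarrow> 0) \<F>" by simp
  then have "((\<lambda>F. (\<integral>x. u F x * v F x \<partial>M) - (\<integral>x. a x * b x \<partial>M)) \<longlongrightarrow> 0) \<F>"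
    by (rule Lim_null_comparison[rotated]) (use le in \<open>auto intro!: always_eventually\<close>)
  then show ?thesis by (simp add: LIM_zero_iff)
qed

lemma integrable_pair_bounded_product:
  fixes f :: "'x \<Rightarrow> real" and g :: "'y \<Rightarrow> real" and F :: "'x \<times> 'y \<Rightarrow> real"
  assumes "prob_space P" "prob_space Q" "integrable P f" "integrable Q g"
    and F: "F \<in> borel_measurable (P \<Otimes>\<^sub>M Q)"
    and le: "\<And>x y. x \<in> space P \<Longrightarrow> y \<in> space Q \<Longrightarrow> \<bar>F (x, y)\<bar> \<le> \<bar>f x\<bar> * \<bar>g y\<bar>"
  shows "integrable (P \<Otimes>\<^sub>M Q) F"
proof -
  interpret P: prob_space P by fact
  interpret Q: prob_space Q by fact
  interpret PQ: pair_prob_space P Q ..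
  have [measurable]: "f \<in> borel_measurable P" "g \<in> borel_measurable Q" using assms by auto
  have "integrable (P \<Otimes>\<^sub>M Q) (\<lambda>(x, y). f x * g y)"
  proof (rule PQ.Fubini_integrable)
    show "(\<lambda>(x, y). f x * g y) \<in> borel_measurable (P \<Otimes>\<^sub>M Q)" by measurable
    show "integrable P (\<lambda>x. \<integral>y. norm (case (x, y) of (x, y) \<Rightarrow> f x * g y) \<partial>Q)"
      using assms by (simp add: abs_mult)
    show "AE x in P. integrable Q (\<lambda>y. case (x, y) of (x, y) \<Rightarrow> f x * g y)"
      using assms by simp
  qed
  then show ?thesis
    by (rule Bochner_Integration.integrable_bound[OF _ F])
       (use le in \<open>auto simp: space_pair_measure abs_mult intro!: AE_I2\<close>)
qed

text \<open>The map x -> \<open>\<tau> x\<close> is a bounded family in the Hilbert space over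
  \<rho>, and its integral against \<open>h\<close>, computed pointwise in z, is its weak integral:
  the last claim determines it through inner products. The lemma is used with \<rho> = \<mu> for
  kernels, with the field moved by a random group element, and with the white noise space.\<close>

lemma L2_field_pairing:
  fixes \<tau> :: "'x \<Rightarrow> 'z \<Rightarrow> real"
  assumes "prob_space \<mu>" "prob_space \<rho>"
    and meas: "(\<lambda>(x, z). \<tau> x z) \<in> borel_measurable (\<mu> \<Otimes>\<^sub>M \<rho>)"
    and sq: "\<And>x. x \<in> space \<mu> \<Longrightarrow> square_integrable \<rho> (\<tau> x)"
    and le: "\<And>x. x \<in> space \<mu> \<Longrightarrow> (\<integral>z. (\<tau> x z)\<^sup>2 \<partial>\<rho>) \<le> B"
    and h: "square_integrable \<mu> h"
  shows "integrable (\<mu> \<Otimes>\<^sub>M \<rho>) (\<lambda>(x, z). (\<tau> x z)\<^sup>2)"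
    and "AE z in \<rho>. square_integrable \<mu> (\<lambda>x. \<tau> x z)"
    and "square_integrable \<rho> (\<lambda>z. \<integral>x. h x * \<tau> x z \<partial>\<mu>)"
    and "(\<integral>z. (\<integral>x. h x * \<tau> x z \<partial>\<mu>)\<^sup>2 \<partial>\<rho>) \<le> (\<integral>x. (h x)\<^sup>2 \<partial>\<mu>) * B"
    and "\<And>Y. square_integrable \<rho> Y \<Longrightarrow>
      (\<integral>z. (\<integral>x. h x * \<tau> x z \<partial>\<mu>) * Y z \<partial>\<rho>) = (\<integral>x. h x * (\<integral>z. \<tau> x z * Y z \<partial>\<rho>) \<partial>\<mu>)"
proof -
  interpret P: prob_space \<mu> by fact
  interpret Q: prob_space \<rho> by fact
  interpret PQ: pair_prob_space \<mu> \<rho> ..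
  note [measurable] = meas
  have hm[measurable]: "h \<in> borel_measurable \<mu>" using h by blast
  have \<tau>2m: "(\<lambda>x. \<integral>z. (\<tau> x z)\<^sup>2 \<partial>\<rho>) \<in> borel_measurable \<mu>" by measurable
  have B: "0 \<le> B"
  proof -
    obtain x where x: "x \<in> space \<mu>" using P.not_empty by blast
    have "0 \<le> (\<integral>z. (\<tau> x z)\<^sup>2 \<partial>\<rho>)" by simp
    with le[OF x] show ?thesis by linarith
  qed
  show int2: "integrable (\<mu> \<Otimes>\<^sub>M \<rho>) (\<lambda>(x, z). (\<tau> x z)\<^sup>2)"
  proof (rule PQ.Fubini_integrable)
    show "(\<lambda>(x, z). (\<tau> x z)\<^sup>2) \<in> borel_measurable (\<mu> \<Otimes>\<^sub>M \<rho>)" by measurable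
    show "integrable \<mu> (\<lambda>x. \<integral>z. norm (case (x, z) of (x, z) \<Rightarrow> (\<tau> x z)\<^sup>2) \<partial>\<rho>)"
      using le \<tau>2m by (intro P.integrable_const_bound[where B = B] AE_I2) auto
    show "AE x in \<mu>. integrable \<rho> (\<lambda>z. case (x, z) of (x, z) \<Rightarrow> (\<tau> x z)\<^sup>2)"
      using sq by (auto simp: square_integrable_real)
  qed
  show AEs: "AE z in \<rho>. square_integrable \<mu> (\<lambda>x. \<tau> x z)"
    using PQ.AE_integrable_snd[OF int2] AE_space
    by eventually_elim (auto simp: square_integrable_real)
  have Tm[measurable]: "(\<lambda>z. \<integral>x. h x * \<tau> x z \<partial>\<mu>) \<in> borel_measurable \<rho>" by measurable
  let ?b = "\<lambda>z. (\<integral>x. (h x)\<^sup>2 \<partial>\<mu>) * (\<integral>x. (\<tau> x z)\<^sup>2 \<partial>\<mu>)"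
  have bi: "integrable \<rho> ?b"
    using PQ.integrable_snd[OF int2] by simp
  have AEle: "AE z in \<rho>. (\<integral>x. h x * \<tau> x z \<partial>\<mu>)\<^sup>2 \<le> ?b z"
    using AEs by eventually_elim (rule square_integrable_cauchy_schwarz[OF h])
  have Ti: "integrable \<rho> (\<lambda>z. (\<integral>x. h x * \<tau> x z \<partial>\<mu>)\<^sup>2)"
    by (rule Bochner_Integration.integrable_bound[OF bi]) (measurable, use AEle in eventually_elim, simp)
  show "square_integrable \<rho> (\<lambda>z. \<integral>x. h x * \<tau> x z \<partial>\<mu>)"
    unfolding square_integrable_real using Tm Ti by blast
  have "(\<integral>z. (\<integral>x. h x * \<tau> x z \<partial>\<mu>)\<^sup>2 \<partial>\<rho>) \<le> (\<integral>z. ?b z \<partial>\<rho>)"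
    by (rule integral_mono_AE[OF Ti bi AEle])
  also have "\<dots> = (\<integral>x. (h x)\<^sup>2 \<partial>\<mu>) * (\<integral>x. (\<integral>z. (\<tau> x z)\<^sup>2 \<partial>\<rho>) \<partial>\<mu>)"
    using PQ.Fubini_integral[OF int2] by simp
  also have "\<dots> \<le> (\<integral>x. (h x)\<^sup>2 \<partial>\<mu>) * B"
  proof (rule mult_left_mono)
    have "(\<integral>x. (\<integral>z. (\<tau> x z)\<^sup>2 \<partial>\<rho>) \<partial>\<mu>) \<le> (\<integral>x. B \<partial>\<mu>)"
      using le \<tau>2m B by (intro integral_mono P.integrable_const_bound[where B = B] AE_I2) auto
    then show "(\<integral>x. (\<integral>z. (\<tau> x z)\<^sup>2 \<partial>\<rho>) \<partial>\<mu>) \<le> B" by (simp add: P.prob_space)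
  qed simp
  finally show "(\<integral>z. (\<integral>x. h x * \<tau> x z \<partial>\<mu>)\<^sup>2 \<partial>\<rho>) \<le> (\<integral>x. (h x)\<^sup>2 \<partial>\<mu>) * B" .
  show "(\<integral>z. (\<integral>x. h x * \<tau> x z \<partial>\<mu>) * Y z \<partial>\<rho>) = (\<integral>x. h x * (\<integral>z. \<tau> x z * Y z \<partial>\<rho>) \<partial>\<mu>)"
    if Y: "square_integrable \<rho> Y" for Y
  proof -
    have Ym[measurable]: "Y \<in> borel_measurable \<rho>" using Y by blast
    have int: "integrable (\<mu> \<Otimes>\<^sub>M \<rho>) (\<lambda>(x, z). h x * \<tau> x z * Y z)"
    proof (rule PQ.Fubini_integrable)
      show "(\<lambda>(x, z). h x * \<tau> x z * Y z) \<in> borel_measurable (\<mu> \<Otimes>\<^sub>M \<rho>)" by measurable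
      show "AE x in \<mu>. integrable \<rho> (\<lambda>z. case (x, z) of (x, z) \<Rightarrow> h x * \<tau> x z * Y z)"
        using square_integrable_mult_integrable[OF sq Y] by (auto simp: mult.assoc intro!: AE_I2)
      \<comment> \<open>Cauchy-Schwarz bounds the inner integral by this constant uniformly in
        \<open>x\<close>, so a multiple of |h| is an integrable majorant.\<close>
      let ?c = "sqrt (B * (\<integral>z. (Y z)\<^sup>2 \<partial>\<rho>))"
      have le': "(\<integral>z. \<bar>\<tau> x z\<bar> * \<bar>Y z\<bar> \<partial>\<rho>) \<le> ?c" if x: "x \<in> space \<mu>" for x
      proof (rule real_le_rsqrt)
        have "square_integrable \<rho> (\<lambda>z. \<bar>\<tau> x z\<bar>)" "square_integrable \<rho> (\<lambda>z. \<bar>Y z\<bar>)"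
          using sq[OF x] Y by (auto simp: square_integrable_real)
        from square_integrable_cauchy_schwarz[OF this]
        have "(\<integral>z. \<bar>\<tau> x z\<bar> * \<bar>Y z\<bar> \<partial>\<rho>)\<^sup>2 \<le> (\<integral>z. (\<tau> x z)\<^sup>2 \<partial>\<rho>) * (\<integral>z. (Y z)\<^sup>2 \<partial>\<rho>)" by simp
        also have "\<dots> \<le> B * (\<integral>z. (Y z)\<^sup>2 \<partial>\<rho>)" by (intro mult_right_mono le x) simp
        finally show "(\<integral>z. \<bar>\<tau> x z\<bar> * \<bar>Y z\<bar> \<partial>\<rho>)\<^sup>2 \<le> B * (\<integral>z. (Y z)\<^sup>2 \<partial>\<rho>)" .
      qed
      have hi: "integrable \<mu> (\<lambda>x. \<bar>h x\<bar> * ?c)"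
        using P.square_integrable_integrable[OF h] by simp
      have "integrable \<mu> (\<lambda>x. \<bar>h x\<bar> * (\<integral>z. \<bar>\<tau> x z\<bar> * \<bar>Y z\<bar> \<partial>\<rho>))"
      proof (rule Bochner_Integration.integrable_bound[OF hi])
        show "AE x in \<mu>. norm (\<bar>h x\<bar> * (\<integral>z. \<bar>\<tau> x z\<bar> * \<bar>Y z\<bar> \<partial>\<rho>)) \<le> norm (\<bar>h x\<bar> * ?c)"
        proof (rule AE_I2)
          fix x assume x: "x \<in> space \<mu>"
          have "0 \<le> (\<integral>z. \<bar>\<tau> x z\<bar> * \<bar>Y z\<bar> \<partial>\<rho>)" by simp
          with le'[OF x] have "\<bar>\<integral>z. \<bar>\<tau> x z\<bar> * \<bar>Y z\<bar> \<partial>\<rho>\<bar> \<le> \<bar>?c\<bar>" by linarith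
          then show "norm (\<bar>h x\<bar> * (\<integral>z. \<bar>\<tau> x z\<bar> * \<bar>Y z\<bar> \<partial>\<rho>)) \<le> norm (\<bar>h x\<bar> * ?c)"
            unfolding real_norm_def abs_mult by (intro mult_left_mono) auto
        qed
      qed measurable
      then show "integrable \<mu> (\<lambda>x. \<integral>z. norm (case (x, z) of (x, z) \<Rightarrow> h x * \<tau> x z * Y z) \<partial>\<rho>)"
        by (simp add: abs_mult mult.assoc)
    qed
    have "(\<integral>z. (\<integral>x. h x * \<tau> x z \<partial>\<mu>) * Y z \<partial>\<rho>) = (\<integral>z. (\<integral>x. h x * \<tau> x z * Y z \<partial>\<mu>) \<partial>\<rho>)" by simp
    also have "\<dots> = (\<integral>x. (\<integral>z. h x * \<tau> x z * Y z \<partial>\<rho>) \<partial>\<mu>)"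
      using PQ.Fubini_integral[OF int] by simp
    finally show ?thesis by (simp add: mult.assoc)
  qed
qed

text \<open>\<open>r_dom\<close> is the Cauchy-Schwarz inequality of the form <h, R h> with a unit
  mass at \<open>x\<close> in the second argument, where the form of the unit mass itself is r x x
  \<le> 1. A unit mass is not square integrable in general, so the inequality is an axiom of its
  own; it contains the positivity of R.\<close>

locale dominated_kernel = prob_space \<mu> for \<mu> :: "'x measure" +
  fixes r :: "'x \<Rightarrow> 'x \<Rightarrow> real"
  assumes space_UNIV: "space \<mu> = UNIV"
    and r_meas [measurable]: "(\<lambda>(x, y). r x y) \<in> borel_measurable (\<mu> \<Otimes>\<^sub>M \<mu>)"
    and r_sym: "r x y = r y x"
    and r_le: "\<bar>r x y\<bar> \<le> 1"
    and r_dom: "square_integrable \<mu> h \<Longrightarrow>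
      (\<integral>y. r x y * h y \<partial>\<mu>)\<^sup>2 \<le> (\<integral>y. h y * (\<integral>z. r y z * h z \<partial>\<mu>) \<partial>\<mu>)"
begin

sublocale PP: pair_prob_space \<mu> \<mu> ..

definition R :: "('x \<Rightarrow> real) \<Rightarrow> 'x \<Rightarrow> real" where "R u x = (\<integral>y. r x y * u y \<partial>\<mu>)"

text \<open>This is 1 - R, in whose powers the inverse square root of R is expanded. It acts on
  functions and not on classes, so identities between iterated kernels hold at every point.\<close>

definition S :: "('x \<Rightarrow> real) \<Rightarrow> 'x \<Rightarrow> real" where "S u x = u x - R u x"

definition ip :: "('x \<Rightarrow> real) \<Rightarrow> ('x \<Rightarrow> real) \<Rightarrow> real" where "ip u v = (\<integral>x. u x * v x \<partial>\<mu>)"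

lemma r_section_meas [measurable]: "r x \<in> borel_measurable \<mu>"
  using measurable_Pair2[OF r_meas, of x] by (simp add: space_UNIV)

lemma sq_r: "square_integrable \<mu> (r x)"
  by (rule square_integrable_bounded[of _ 1]) (use r_le in auto)

lemma r_mult_integrable: "integrable \<mu> u \<Longrightarrow> integrable \<mu> (\<lambda>y. r x y * u y)"
  by (rule Bochner_Integration.integrable_bound[of _ u])
     (use r_le mult_right_mono[OF r_le] in \<open>fastforce simp: abs_mult intro!: AE_I2\<close>)+

lemma R_meas [measurable]:
  assumes [measurable]: "u \<in> borel_measurable \<mu>"
  shows "R u \<in> borel_measurable \<mu>"
  unfolding R_def[abs_def] by measurable

lemma R_le: assumes "integrable \<mu> u" shows "\<bar>R u x\<bar> \<le> (\<integral>y. \<bar>u y\<bar> \<partial>\<mu>)"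
proof -
  have "\<bar>R u x\<bar> \<le> (\<integral>y. \<bar>r x y * u y\<bar> \<partial>\<mu>)" unfolding R_def by (rule integral_abs_bound)
  also have "\<dots> \<le> (\<integral>y. \<bar>u y\<bar> \<partial>\<mu>)"
    using mult_right_mono[OF r_le, of "\<bar>u y\<bar>" x y for y]
    by (intro integral_mono integrable_abs r_mult_integrable assms) (simp add: abs_mult)
  finally show ?thesis .
qed

lemma sq_R: "square_integrable \<mu> u \<Longrightarrow> square_integrable \<mu> (R u)"
  by (rule square_integrable_bounded[where B = "\<integral>y. \<bar>u y\<bar> \<partial>\<mu>"])
     (auto intro: R_le square_integrable_integrable)

lemma sq_S: "square_integrable \<mu> u \<Longrightarrow> square_integrable \<mu> (S u)"
  unfolding S_def[abs_def] by (intro square_integrable_diff sq_R)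

lemma sq_Sn: "square_integrable \<mu> u \<Longrightarrow> square_integrable \<mu> ((S ^^ i) u)"
  by (induction i) (auto intro: sq_S)

lemma ip_commute: "ip u v = ip v u" by (simp add: ip_def mult.commute)

lemma ip_diff: "square_integrable \<mu> u \<Longrightarrow> square_integrable \<mu> v \<Longrightarrow> square_integrable \<mu> w \<Longrightarrow>
    ip (\<lambda>x. u x - v x) w = ip u w - ip v w"
  by (simp add: ip_def left_diff_distrib square_integrable_mult_integrable)

lemma ip_S: "square_integrable \<mu> u \<Longrightarrow> square_integrable \<mu> v \<Longrightarrow> ip (S u) v = ip u v - ip (R u) v"
  unfolding S_def[abs_def] by (intro ip_diff sq_R)

lemma ip_sum_sum:
  assumes "\<And>i. i \<in> A \<Longrightarrow> square_integrable \<mu> (u i)" "\<And>j. j \<in> B \<Longrightarrow> square_integrable \<mu> (v j)"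
  shows "ip (\<lambda>x. \<Sum>i\<in>A. a i * u i x) (\<lambda>x. \<Sum>j\<in>B. c j * v j x) =
    (\<Sum>i\<in>A. \<Sum>j\<in>B. a i * c j * ip (u i) (v j))"
proof -
  have "ip (\<lambda>x. \<Sum>i\<in>A. a i * u i x) (\<lambda>x. \<Sum>j\<in>B. c j * v j x) =
    (\<integral>x. (\<Sum>i\<in>A. \<Sum>j\<in>B. a i * c j * (u i x * v j x)) \<partial>\<mu>)"
    unfolding ip_def sum_product by (simp add: mult_ac)
  also have "\<dots> = (\<Sum>i\<in>A. \<Sum>j\<in>B. a i * c j * ip (u i) (v j))"
    using assms by (simp add: ip_def square_integrable_mult_integrable)
  finally show ?thesis .
qed

lemma ip_R: assumes u: "square_integrable \<mu> u" and v: "square_integrable \<mu> v"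
  shows "ip (R u) v = ip u (R v)"
proof -
  have [measurable]: "u \<in> borel_measurable \<mu>" "v \<in> borel_measurable \<mu>" using u v by auto
  have int: "integrable (\<mu> \<Otimes>\<^sub>M \<mu>) (\<lambda>(x, y). v x * r x y * u y)"
  proof (rule integrable_pair_bounded_product[OF prob_space_axioms prob_space_axioms
        square_integrable_integrable[OF v] square_integrable_integrable[OF u]])
    show "\<bar>(case (x, y) of (x, y) \<Rightarrow> v x * r x y * u y)\<bar> \<le> \<bar>v x\<bar> * \<bar>u y\<bar>" for x y
      using mult_left_mono[OF r_le, of "\<bar>v x\<bar> * \<bar>u y\<bar>" x y] by (simp add: abs_mult mult_ac)
  qed measurable
  have "ip (R u) v = (\<integral>x. \<integral>y. v x * r x y * u y \<partial>\<mu> \<partial>\<mu>)"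
    by (simp add: ip_def R_def mult_ac flip: Bochner_Integration.integral_mult_right_zero)
  also have "\<dots> = (\<integral>y. \<integral>x. v x * r x y * u y \<partial>\<mu> \<partial>\<mu>)"
    using PP.Fubini_integral[OF int] by simp
  also have "\<dots> = ip u (R v)"
    by (simp add: ip_def R_def mult_ac r_sym flip: Bochner_Integration.integral_mult_right_zero)
  finally show ?thesis .
qed

lemma ip_S_commute: "square_integrable \<mu> u \<Longrightarrow> square_integrable \<mu> v \<Longrightarrow> ip (S u) v = ip u (S v)"
  using ip_S[of u v] ip_S[of v u] ip_R[of u v] by (simp add: ip_commute)

text \<open>Self-adjointness moves powers across the inner product, so the Gram matrix of the
  iterates is a Hankel matrix: its entries depend on i + j only.\<close>

lemma ip_Sn:
  assumes "square_integrable \<mu> u" "square_integrable \<mu> v"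
  shows "ip ((S ^^ i) u) ((S ^^ j) v) = ip ((S ^^ (i + j)) u) v"
proof (induction j arbitrary: i)
  case (Suc j)
  have "ip ((S ^^ i) u) ((S ^^ Suc j) v) = ip ((S ^^ Suc i) u) ((S ^^ j) v)"
    using ip_S_commute[OF sq_Sn[OF assms(1)] sq_Sn[OF assms(2)]] by simp
  then show ?case using Suc[of "Suc i"] by simp
qed simp

lemma R_S: "square_integrable \<mu> u \<Longrightarrow> R (S u) = S (R u)"
  using r_mult_integrable[OF square_integrable_integrable] sq_R[of u]
  by (auto simp: fun_eq_iff R_def[of "S u"] S_def right_diff_distrib R_def[symmetric])

lemma R_Sn: assumes "square_integrable \<mu> u" shows "R ((S ^^ i) u) = (S ^^ i) (R u)"
  by (induction i) (simp_all add: R_S sq_Sn assms)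

lemma ip_R_nonneg: "square_integrable \<mu> u \<Longrightarrow> 0 \<le> ip u (R u)"
  \<comment> \<open>The point is arbitrary: the right-hand side of \<open>r_dom\<close> does not
    depend on it and bounds a square.\<close>
  using r_dom[of u undefined] unfolding ip_def R_def
  by (meson order_trans zero_le_power2)

text \<open>Since |r| \<le> 1, the form is at most the squared L1 norm, and on a probability space
  this is at most the squared L2 norm. Hence R \<le> 1.\<close>

lemma ip_R_le: assumes u: "square_integrable \<mu> u" shows "ip u (R u) \<le> ip u u"
proof -
  let ?c = "\<integral>y. \<bar>u y\<bar> \<partial>\<mu>"
  have ui: "integrable \<mu> u" using u by (rule square_integrable_integrable)
  have "ip u (R u) \<le> (\<integral>x. \<bar>u x\<bar> * ?c \<partial>\<mu>)" unfolding ip_def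
  proof (rule integral_mono)
    show "u x * R u x \<le> \<bar>u x\<bar> * ?c" for x
      using mult_mono[OF order_refl[of "\<bar>u x\<bar>"] R_le[OF ui, of x]] abs_mult[of "u x" "R u x"]
      by (smt (verit) abs_ge_zero)
  qed (use u ui sq_R[OF u] in \<open>auto intro: square_integrable_mult_integrable\<close>)
  also have "\<dots> = ?c\<^sup>2" by (simp add: power2_eq_square)
  also have "\<dots> \<le> ip u u"
    using square_integrable_cauchy_schwarz[of \<mu> "\<lambda>x. \<bar>u x\<bar>" "\<lambda>_. 1"] u
      square_integrable_measurable[OF u]
    by (simp add: square_integrable_real prob_space ip_def power2_eq_square[of "u _"])
  finally show ?thesis .
qed

text \<open>Half of the power goes to each side. What remains is a squared norm for even k and the
  form of 1 - R, nonnegative by \<open>ip_R_le\<close>, for odd k.\<close>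

lemma ip_Sn_nonneg: assumes u: "square_integrable \<mu> u" shows "0 \<le> ip ((S ^^ k) u) u"
proof -
  define w where "w = (S ^^ (k div 2)) u"
  have w: "square_integrable \<mu> w" unfolding w_def by (rule sq_Sn[OF u])
  show ?thesis
  proof (cases "even k")
    case True
    then have "ip ((S ^^ k) u) u = ip w w"
      unfolding w_def ip_Sn[OF u u] by (metis mult_2 dvd_mult_div_cancel)
    then show ?thesis by (simp add: ip_def)
  next
    case False
    then have k: "k = Suc (k div 2) + k div 2" by presburger
    have "ip ((S ^^ k) u) u = ip (S w) w"
      by (subst k, subst ip_Sn[OF u u, symmetric]) (simp add: w_def)
    then show ?thesis
      using ip_S[OF w w] ip_R_le[OF w] by (simp add: ip_commute)
  qed
qed

end

text \<open>The Taylor coefficients of \<open>(1 - s) powr (-1/2)\<close>.\<close>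

definition inv_sqrt_coeff :: "nat \<Rightarrow> real" where
  "inv_sqrt_coeff i = pochhammer (1/2) i / fact i"

lemma inv_sqrt_coeff_nonneg: "0 \<le> inv_sqrt_coeff i"
  by (simp add: inv_sqrt_coeff_def pochhammer_nonneg)

text \<open>The square of (1 - s)^(-1/2) is the geometric series. The proof is the Vandermonde
  identity for rising factorials with 1/2 + 1/2 = 1, where the rising factorial of 1 is k!.\<close>

lemma inv_sqrt_coeff_convolution: "(\<Sum>i\<le>k. inv_sqrt_coeff i * inv_sqrt_coeff (k - i)) = 1"
proof -
  have "fact k = (\<Sum>i\<le>k. of_nat (k choose i) * pochhammer (1/2) i * pochhammer (1/2) (k - i) :: real)"
    using pochhammer_binomial_sum[of "1/2 :: real" "1/2" k] by (simp add: pochhammer_fact)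
  also have "\<dots> = (\<Sum>i\<le>k. fact k * (inv_sqrt_coeff i * inv_sqrt_coeff (k - i)))"
    by (intro sum.cong refl) (simp add: inv_sqrt_coeff_def binomial_fact field_simps)
  also have "\<dots> = fact k * (\<Sum>i\<le>k. inv_sqrt_coeff i * inv_sqrt_coeff (k - i))"
    by (rule sum_distrib_left[symmetric])
  finally show ?thesis by simp
qed

text \<open>For m (i + j) = <S^i u, S^j u> this is the squared norm of the part of the series for
  R^(-1/2) u with indices in \<open>A\<close>; see \<open>ip_sum_Sn\<close>.\<close>

definition inv_sqrt_form :: "(nat \<Rightarrow> real) \<Rightarrow> nat set \<Rightarrow> real" where
  "inv_sqrt_form m A = (\<Sum>i\<in>A. \<Sum>j\<in>A. inv_sqrt_coeff i * inv_sqrt_coeff j * m (i + j))"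

lemma inv_sqrt_form_cartesian:
  "inv_sqrt_form m A = (\<Sum>(i, j)\<in>A \<times> A. inv_sqrt_coeff i * inv_sqrt_coeff j * m (i + j))"
  unfolding inv_sqrt_form_def by (simp add: sum.cartesian_product)

text \<open>Summation along the lines i + j = k, on each of which the weights add up to 1.\<close>

lemma inv_sqrt_form_triangle:
  "(\<Sum>(i, j)\<in>{(i, j). i + j < n}. inv_sqrt_coeff i * inv_sqrt_coeff j * m (i + j)) = (\<Sum>k<n. m k)"
proof -
  have "(\<Sum>(i, j)\<in>{(i, j). i + j < n}. inv_sqrt_coeff i * inv_sqrt_coeff j * m (i + j)) =
      (\<Sum>k<n. \<Sum>i\<le>k. inv_sqrt_coeff i * inv_sqrt_coeff (k - i) * m (i + (k - i)))"
    by (rule sum.triangle_reindex)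
  also have "\<dots> = (\<Sum>k<n. (\<Sum>i\<le>k. inv_sqrt_coeff i * inv_sqrt_coeff (k - i)) * m k)"
    unfolding sum_distrib_right by (intro sum.cong refl) auto
  finally show ?thesis by (simp add: inv_sqrt_coeff_convolution)
qed

lemma finite_triangle: "finite {(i, j). i + j < (n::nat)}"
  by (rule finite_subset[of _ "{..<n} \<times> {..<n}"]) auto

text \<open>The square of side n contains the triangle i + j < n and lies in the triangle i + j <
  2n; all terms are nonnegative.\<close>

lemma inv_sqrt_form_bounds:
  assumes "\<And>k. 0 \<le> m k"
  shows "(\<Sum>k<n. m k) \<le> inv_sqrt_form m {..<n}" "inv_sqrt_form m {..<n} \<le> (\<Sum>k<2*n. m k)"
  unfolding inv_sqrt_form_triangle[of m, symmetric] inv_sqrt_form_cartesian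
  by (intro sum_mono2 finite_triangle;
      auto intro!: mult_nonneg_nonneg inv_sqrt_coeff_nonneg assms)+

text \<open>The two diagonal squares are disjoint and lie in the square of side p. This turns
  convergence of the squared norms of partial sums into the Cauchy property.\<close>

lemma inv_sqrt_form_diff:
  assumes "\<And>k. 0 \<le> m k" "n \<le> p"
  shows "inv_sqrt_form m {n..<p} \<le> inv_sqrt_form m {..<p} - inv_sqrt_form m {..<n}"
proof -
  let ?f = "\<lambda>(i, j). inv_sqrt_coeff i * inv_sqrt_coeff j * m (i + j)"
  have "sum ?f ({n..<p} \<times> {n..<p}) + sum ?f ({..<n} \<times> {..<n}) =
      sum ?f ({n..<p} \<times> {n..<p} \<union> {..<n} \<times> {..<n})"
    by (intro sum.union_disjoint[symmetric]) auto
  also have "\<dots> \<le> sum ?f ({..<p} \<times> {..<p})"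
    using assms(2)
    by (intro sum_mono2) (auto intro!: mult_nonneg_nonneg inv_sqrt_coeff_nonneg assms(1))
  finally show ?thesis by (simp add: inv_sqrt_form_cartesian)
qed

section \<open>Convergence of the series for the root kernel\<close>

context dominated_kernel
begin

text \<open>The partial sums of R^(-1/2) applied to the row \<open>r x\<close>.\<close>

definition root_kernel :: "nat \<Rightarrow> 'x \<Rightarrow> 'x \<Rightarrow> real" where
  "root_kernel n x y = (\<Sum>i<n. inv_sqrt_coeff i * (S ^^ i) (r x) y)"

definition moment :: "('x \<Rightarrow> real) \<Rightarrow> nat \<Rightarrow> real" where "moment u k = ip ((S ^^ k) u) u"

lemma S_Suc: "(S ^^ Suc i) u y = (S ^^ i) u y - R ((S ^^ i) u) y"
  by (simp add: S_def[of "(S ^^ i) u"])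

lemma moment_nonneg: "square_integrable \<mu> u \<Longrightarrow> 0 \<le> moment u k"
  by (simp add: moment_def ip_Sn_nonneg)

lemma ip_sum_Sn:
  assumes "square_integrable \<mu> u"
  shows "ip (\<lambda>x. \<Sum>i\<in>A. inv_sqrt_coeff i * (S ^^ i) u x) (\<lambda>x. \<Sum>i\<in>A. inv_sqrt_coeff i * (S ^^ i) u x) =
    inv_sqrt_form (moment u) A"
  by (simp add: ip_sum_sum sq_Sn assms ip_Sn inv_sqrt_form_def moment_def)

text \<open>Let w be the sum of the iterates S^k (r x). As R = 1 - S, the sum R w telescopes to r x
  - S^n (r x). The sum s of the moments is <w, r x> = (R w)(x), so \<open>r_dom\<close> gives s^2
  \<le> <w, R w> \<le> <w, r x> = s.\<close>

lemma sum_moment_r_le: "(\<Sum>k<n. moment (r x) k) \<le> 1"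
proof -
  define w where "w y = (\<Sum>k<n. (S ^^ k) (r x) y)" for y
  define s where "s = (\<Sum>k<n. moment (r x) k)"
  have w: "square_integrable \<mu> w"
    unfolding w_def[abs_def] by (intro square_integrable_sum sq_Sn sq_r)
  have s0: "0 \<le> s" unfolding s_def by (intro sum_nonneg moment_nonneg sq_r)
  have ipw: "ip w v = (\<Sum>k<n. ip ((S ^^ k) (r x)) v)" if "square_integrable \<mu> v" for v
    using that by (simp add: ip_def w_def sum_distrib_right square_integrable_mult_integrable sq_Sn sq_r)
  have Rw: "R w y = r x y - (S ^^ n) (r x) y" for y
  proof -
    have "R w y = (\<Sum>k<n. R ((S ^^ k) (r x)) y)"
      unfolding w_def R_def sum_distrib_left
      by (intro Bochner_Integration.integral_sum r_mult_integrable square_integrable_integrable sq_Sn sq_r)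
    also have "\<dots> = (\<Sum>k<n. (S ^^ k) (r x) y - (S ^^ Suc k) (r x) y)"
      unfolding S_Suc by simp
    also have "\<dots> = r x y - (S ^^ n) (r x) y"
      using sum_lessThan_telescope'[of "\<lambda>k. (S ^^ k) (r x) y" n] by simp
    finally show ?thesis .
  qed
  have "s = R w x"
    unfolding s_def moment_def ipw[OF sq_r, symmetric] by (simp add: ip_def R_def mult.commute)
  then have "s\<^sup>2 \<le> ip w (R w)"
    using r_dom[OF w, of x] by (simp add: R_def ip_def)
  also have "\<dots> = ip w (r x) - ip w ((S ^^ n) (r x))"
    using ip_diff[OF sq_r sq_Sn[OF sq_r] w, of x n x] by (simp add: Rw[abs_def] ip_commute[of w])
  also have "\<dots> \<le> ip w (r x)"
    using ipw[OF sq_Sn[OF sq_r], of n x] ip_Sn[OF sq_r[of x] sq_r[of x]] moment_nonneg[OF sq_r[of x]]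
    by (simp add: sum_nonneg moment_def)
  also have "\<dots> = s" by (simp add: ipw[OF sq_r] s_def moment_def)
  finally have "s * s \<le> 1 * s" by (simp add: power2_eq_square)
  then have "s \<le> 1" using s0 by (cases "s = 0") (auto dest: mult_right_le_imp_le)
  then show ?thesis by (simp add: s_def)
qed

lemma Sn_kernel_meas [measurable]: "(\<lambda>(x, y). (S ^^ i) (r x) y) \<in> borel_measurable (\<mu> \<Otimes>\<^sub>M \<mu>)"
proof (induction i)
  case 0 show ?case by simp
next
  case (Suc i)
  note [measurable] = Suc
  have "(\<lambda>(x, y). (S ^^ i) (r x) y - (\<integral>z. r y z * (S ^^ i) (r x) z \<partial>\<mu>)) \<in> borel_measurable (\<mu> \<Otimes>\<^sub>M \<mu>)"
    by measurable
  then show ?case unfolding S_Suc R_def[of "(S ^^ i) _"] .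
qed

text \<open>A crude bound, since S at most doubles a uniform bound; it serves the integrability
  conditions of Fubini's theorem.\<close>

lemma Sn_kernel_le: "\<bar>(S ^^ i) (r x) y\<bar> \<le> 2 ^ i"
proof (induction i arbitrary: y)
  case 0 show ?case using r_le by simp
next
  case (Suc i)
  have "\<bar>R ((S ^^ i) (r x)) y\<bar> \<le> (\<integral>z. \<bar>(S ^^ i) (r x) z\<bar> \<partial>\<mu>)"
    by (intro R_le square_integrable_integrable sq_Sn sq_r)
  also have "\<dots> \<le> (\<integral>z. 2 ^ i \<partial>\<mu>)"
    using Suc by (intro integral_mono[OF integrable_abs[OF square_integrable_integrable[OF sq_Sn[OF sq_r]]]]) auto
  finally show ?case using Suc[of y] unfolding S_Suc by (simp add: prob_space)
qed

text \<open>The kernel with rows \<open>(S ^^ i) (r x)\<close> is the symmetric kernel of the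
  operator S^i R. Fubini's theorem gives this at every \<open>y\<close>, not just almost
  everywhere.\<close>

lemma Sn_kernel_apply:
  assumes h: "square_integrable \<mu> h"
  shows "(\<integral>x. h x * (S ^^ i) (r x) y \<partial>\<mu>) = (S ^^ i) (R h) y"
proof (induction i arbitrary: y)
  case 0 show ?case by (simp add: R_def mult.commute r_sym)
next
  case (Suc i)
  have hm[measurable]: "h \<in> borel_measurable \<mu>" and hi: "integrable \<mu> h"
    using h square_integrable_integrable[OF h] by auto
  have bnd: "\<bar>h x * (r y z * (S ^^ i) (r x) z)\<bar> \<le> \<bar>2 ^ i * h x\<bar> * \<bar>1\<bar>" for x z
  proof -
    have "\<bar>r y z * (S ^^ i) (r x) z\<bar> \<le> 1 * 2 ^ i"
      unfolding abs_mult by (intro mult_mono r_le Sn_kernel_le) auto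
    from mult_left_mono[OF this, of "\<bar>h x\<bar>"] show ?thesis by (simp add: abs_mult mult_ac)
  qed
  have int: "integrable (\<mu> \<Otimes>\<^sub>M \<mu>) (\<lambda>(x, z). h x * (r y z * (S ^^ i) (r x) z))"
  proof (rule integrable_pair_bounded_product[OF prob_space_axioms prob_space_axioms])
    show "integrable \<mu> (\<lambda>x. 2 ^ i * h x)" using hi by simp
    show "integrable \<mu> (\<lambda>z. 1 :: real)" by simp
  qed (measurable, use bnd in auto)
  have int1: "integrable \<mu> (\<lambda>x. h x * (S ^^ i) (r x) y)"
  proof (rule Bochner_Integration.integrable_bound[of _ "\<lambda>x. 2 ^ i * h x"])
    have "(\<lambda>x. (S ^^ i) (r x) y) \<in> borel_measurable \<mu>"
      using measurable_Pair1[OF Sn_kernel_meas[of i], of y] by (simp add: space_UNIV)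
    then show "(\<lambda>x. h x * (S ^^ i) (r x) y) \<in> borel_measurable \<mu>" by simp
    show "AE x in \<mu>. norm (h x * (S ^^ i) (r x) y) \<le> norm (2 ^ i * h x)"
      using mult_left_mono[OF Sn_kernel_le[of i _ y], of "\<bar>h x\<bar>" x for x]
      by (intro AE_I2) (simp add: abs_mult mult_ac)
  qed (use hi in simp)
  have int2: "integrable \<mu> (\<lambda>x. h x * R ((S ^^ i) (r x)) y)"
    using PP.integrable_fst'[OF int] by (simp add: R_def)
  have "(\<integral>x. h x * (S ^^ Suc i) (r x) y \<partial>\<mu>) =
      (\<integral>x. h x * (S ^^ i) (r x) y \<partial>\<mu>) - (\<integral>x. h x * R ((S ^^ i) (r x)) y \<partial>\<mu>)"
    unfolding S_Suc using int1 int2 by (simp add: right_diff_distrib)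
  also have "(\<integral>x. h x * R ((S ^^ i) (r x)) y \<partial>\<mu>) = (\<integral>x. \<integral>z. h x * (r y z * (S ^^ i) (r x) z) \<partial>\<mu> \<partial>\<mu>)"
    by (simp add: R_def)
  also have "\<dots> = (\<integral>z. \<integral>x. h x * (r y z * (S ^^ i) (r x) z) \<partial>\<mu> \<partial>\<mu>)"
    using PP.Fubini_integral[OF int] by simp
  also have "\<dots> = (\<integral>z. r y z * (\<integral>x. h x * (S ^^ i) (r x) z \<partial>\<mu>) \<partial>\<mu>)"
    by (intro Bochner_Integration.integral_cong refl, subst integral_mult_right_zero[symmetric])
       (simp only: mult.left_commute)
  finally show ?case unfolding Suc S_Suc by (simp add: R_def[of "(S ^^ i) _"])
qed

text \<open>R integrates against an invariant measure, so the substitution z -> s z carries the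
  symmetry of \<open>r\<close> to every iterate, pointwise.\<close>

lemma Sn_kernel_invariant:
  assumes s: "s \<in> measurable \<mu> \<mu>" "distr \<mu> \<mu> s = \<mu>" "\<And>x y. r (s x) (s y) = r x y"
  shows "(S ^^ i) (r (s x)) (s y) = (S ^^ i) (r x) y"
proof (induction i arbitrary: y)
  case 0 show ?case by (simp add: s)
next
  case (Suc i)
  have "R ((S ^^ i) (r (s x))) (s y) = (\<integral>z. r (s y) z * (S ^^ i) (r (s x)) z \<partial>distr \<mu> \<mu> s)"
    by (simp add: R_def s)
  also have "\<dots> = (\<integral>z. r (s y) (s z) * (S ^^ i) (r (s x)) (s z) \<partial>\<mu>)"
    by (intro integral_distr s) (auto intro!: borel_measurable_times square_integrable_measurable[OF sq_Sn[OF sq_r]])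
  also have "\<dots> = R ((S ^^ i) (r x)) y" by (simp add: s Suc R_def)
  finally show ?case
    using Suc[of y] unfolding S_Suc by simp
qed

lemma moment_invariant:
  assumes s: "s \<in> measurable \<mu> \<mu>" "distr \<mu> \<mu> s = \<mu>" "\<And>x y. r (s x) (s y) = r x y"
  shows "moment (r (s x)) k = moment (r x) k"
proof -
  have "moment (r (s x)) k = (\<integral>z. (S ^^ k) (r (s x)) z * r (s x) z \<partial>distr \<mu> \<mu> s)"
    by (simp add: moment_def ip_def s)
  also have "\<dots> = (\<integral>z. (S ^^ k) (r (s x)) (s z) * r (s x) (s z) \<partial>\<mu>)"
    by (intro integral_distr s) (auto intro!: borel_measurable_times square_integrable_measurable[OF sq_Sn[OF sq_r]])
  finally show ?thesis by (simp add: Sn_kernel_invariant[OF s] s moment_def ip_def)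
qed

text \<open>Formally the squared norm of R^(-1/2) R h is <h, R h>. The moments of R h are the
  differences of z k = <S^k R h, h>, so by \<open>inv_sqrt_form_bounds\<close> the form lies between
  z 0 - z n and z 0 - z (2n). That z tends to 0 follows because z consists in turn of differences of
  the nonnegative p.\<close>

lemma R_form_tendsto:
  assumes h: "square_integrable \<mu> h"
  shows "(\<lambda>n. inv_sqrt_form (moment (R h)) {..<n}) \<longlonglongrightarrow> ip h (R h)"
proof -
  note sq = h sq_R[OF h] sq_Sn[OF h] sq_Sn[OF sq_R[OF h]]
  define z where "z k = ip ((S ^^ k) (R h)) h" for k
  define p where "p k = ip ((S ^^ k) h) h" for k
  have p: "p k - p (Suc k) = z k" for k
    using ip_S[OF sq(3) h, of k] by (simp add: p_def z_def R_Sn[OF h])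
  have z: "z k - z (Suc k) = moment (R h) k" for k
    using ip_S[OF sq(4) h, of k] ip_R[OF sq(4) h, of k] by (simp add: z_def moment_def)
  have m0: "0 \<le> moment (R h) k" for k by (rule moment_nonneg[OF sq(2)])
  have zdec: "decseq z" using z m0 by (intro decseq_SucI) (metis diff_ge_0_iff_ge)
  \<comment> \<open>At even indices z is a value of the form of R; monotonicity carries the sign to
    all indices.\<close>
  have z0: "0 \<le> z k" for k
  proof -
    have "z (k + k) = ip ((S ^^ k) h) (R ((S ^^ k) h))"
      unfolding z_def by (subst ip_Sn[OF sq(2) h, symmetric]) (simp add: R_Sn[OF h] ip_commute)
    then have "0 \<le> z (k + k)" by (simp add: ip_R_nonneg sq)
    also have "\<dots> \<le> z k" using zdec by (auto simp: decseq_def)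
    finally show ?thesis .
  qed
  have "summable z"
  proof (rule summableI_nonneg_bounded[OF z0])
    fix n
    have "(\<Sum>k<n. z k) = p 0 - p n"
      unfolding p[symmetric] by (rule sum_lessThan_telescope')
    then show "(\<Sum>k<n. z k) \<le> p 0" using ip_Sn_nonneg[OF h, of n] by (simp add: p_def)
  qed
  then have zlim: "z \<longlonglongrightarrow> 0" by (rule summable_LIMSEQ_zero)
  have sums: "(\<Sum>k<n. moment (R h) k) = z 0 - z n" for n
    unfolding z[symmetric] by (rule sum_lessThan_telescope')
  have l1: "(\<lambda>n. z 0 - z n) \<longlonglongrightarrow> z 0 - 0" by (intro tendsto_intros zlim)
  have l2: "(\<lambda>n. z 0 - z (2 * n)) \<longlonglongrightarrow> z 0 - 0"
    by (intro tendsto_intros LIMSEQ_subseq_LIMSEQ[OF zlim, unfolded o_def, where f = "\<lambda>n. 2 * n"])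
       (auto simp: strict_mono_def)
  have "(\<lambda>n. inv_sqrt_form (moment (R h)) {..<n}) \<longlonglongrightarrow> z 0 - 0"
    by (rule real_tendsto_sandwich[OF _ _ l1 l2])
       (use inv_sqrt_form_bounds[of "moment (R h)", OF m0] in \<open>auto simp: sums intro!: always_eventually\<close>)
  then show ?thesis by (simp add: z_def ip_commute)
qed

text \<open>The rows of \<open>k\<close> play the part of R^(1/2) applied to unit masses, so the
  last claim is ||R^(1/2) h||^2 = <h, R h>. The set \<open>\<G>\<close> is later the set of all
  translations.\<close>

theorem invariant_root:
  fixes \<G> :: "('x \<Rightarrow> 'x) set" and x0 :: 'x
  assumes \<G>: "\<And>s. s \<in> \<G> \<Longrightarrow> s \<in> measurable \<mu> \<mu>" "\<And>s. s \<in> \<G> \<Longrightarrow> distr \<mu> \<mu> s = \<mu>"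
      "\<And>s x y. s \<in> \<G> \<Longrightarrow> r (s x) (s y) = r x y"
    and trans: "\<And>x. \<exists>s\<in>\<G>. s x0 = x"
  obtains k where "(\<lambda>(x, y). k x y) \<in> borel_measurable (\<mu> \<Otimes>\<^sub>M \<mu>)"
    and "\<And>s x y. s \<in> \<G> \<Longrightarrow> k (s x) (s y) = k x y"
    and "\<And>x. square_integrable \<mu> (k x)"
    and "\<And>h. square_integrable \<mu> h \<Longrightarrow>
      (\<integral>y. (\<integral>x. h x * k x y \<partial>\<mu>)\<^sup>2 \<partial>\<mu>) = (\<integral>x. h x * (\<integral>y. r x y * h y \<partial>\<mu>) \<partial>\<mu>)"
proof -
  define Q where "Q n = inv_sqrt_form (moment (r x0)) {..<n}" for n
  \<comment> \<open>By transitivity all rows have the same moments, so one subsequence has the same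
    rate of convergence at every \<open>x\<close>.\<close>
  have mom: "moment (r x) = moment (r x0)" for x
  proof -
    obtain s where "s \<in> \<G>" "s x0 = x" using trans by blast
    with moment_invariant[OF \<G>[of s], of x0] show ?thesis by auto
  qed
  have m0: "0 \<le> moment (r x0) k" for k by (rule moment_nonneg[OF sq_r])
  have Qd: "inv_sqrt_form (moment (r x0)) {n..<p} \<le> Q p - Q n" if "n \<le> p" for n p
    unfolding Q_def by (rule inv_sqrt_form_diff[OF m0 that])
  have Qmono: "Q n \<le> Q p" if "n \<le> p" for n p
  proof -
    have "0 \<le> inv_sqrt_form (moment (r x0)) {n..<p}"
      unfolding inv_sqrt_form_def by (intro sum_nonneg mult_nonneg_nonneg inv_sqrt_coeff_nonneg m0)
    then show ?thesis using Qd[OF that] by linarith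
  qed
  have Qle: "Q n \<le> 1" for n
    using inv_sqrt_form_bounds(2)[of "moment (r x0)" n, OF m0] sum_moment_r_le[of x0 "2 * n"]
    unfolding Q_def by linarith
  obtain L where L: "Q \<longlonglongrightarrow> L" "\<And>n. Q n \<le> L"
    using incseq_convergent[of Q 1] Qmono Qle by (auto simp: incseq_def)
  have "\<exists>N. \<forall>n\<ge>N. L - Q n < (1/4) ^ i" for i
  proof -
    have "(0::real) < (1/4)^i" by simp
    from LIMSEQ_D[OF L(1) this] L(2) show ?thesis by (metis abs_of_nonneg diff_ge_0_iff_ge real_norm_def abs_minus_commute)
  qed
  then obtain N where N: "\<And>i n. n \<ge> N i \<Longrightarrow> L - Q n < (1/4) ^ i" by metis
  \<comment> \<open>The summand i makes \<phi> strictly increasing, and the sum dominates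
    \<open>N i\<close>.\<close>
  define \<phi> where "\<phi> i = i + (\<Sum>j\<le>i. N j)" for i
  have \<phi>N: "\<phi> i \<ge> N i" for i using member_le_sum[of i "{..i}" N] by (simp add: \<phi>_def)
  have \<phi>_mono: "strict_mono \<phi>" unfolding strict_mono_Suc_iff \<phi>_def by simp
  have \<phi>_le: "\<phi> i \<le> \<phi> j" if "i \<le> j" for i j using \<phi>_mono that by (simp add: strict_mono_less_eq)
  have sqk: "square_integrable \<mu> (root_kernel n x)" for n x
    unfolding root_kernel_def[abs_def] by (intro square_integrable_sum square_integrable_cmult sq_Sn sq_r)
  have cau: "(\<integral>y. (root_kernel (\<phi> j) x y - root_kernel (\<phi> i) x y)\<^sup>2 \<partial>\<mu>) \<le> (1/4) ^ i" if "i \<le> j" for i j x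
  proof -
    have eq: "root_kernel (\<phi> j) x y - root_kernel (\<phi> i) x y =
        (\<Sum>l\<in>{\<phi> i..<\<phi> j}. inv_sqrt_coeff l * (S ^^ l) (r x) y)" for y
      unfolding root_kernel_def using \<phi>_le[OF that]
      by (simp add: sum_diff_nat_ivl[of 0] lessThan_atLeast0)
    have "(\<integral>y. (root_kernel (\<phi> j) x y - root_kernel (\<phi> i) x y)\<^sup>2 \<partial>\<mu>) =
        inv_sqrt_form (moment (r x)) {\<phi> i..<\<phi> j}"
      unfolding eq ip_sum_Sn[OF sq_r, symmetric] by (simp add: ip_def power2_eq_square)
    also have "\<dots> \<le> Q (\<phi> j) - Q (\<phi> i)" unfolding mom[of x] by (rule Qd[OF \<phi>_le[OF that]])
    also have "\<dots> \<le> (1/4) ^ i" using N[OF \<phi>N, of i] L(2)[of "\<phi> j"] by linarith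
    finally show ?thesis .
  qed
  \<comment> \<open>Where the sequence diverges \<open>lim\<close> is unspecified but still a
    function of the sequence, so \<open>k\<close> inherits the exact invariance of the approximants
    there too.\<close>
  define k where "k x y = lim (\<lambda>i. root_kernel (\<phi> i) x y)" for x y
  note lim = L2_fast_cauchy_limit[OF prob_space_axioms, of "\<lambda>i. root_kernel (\<phi> i) x" for x, OF sqk cau]
  have km[measurable]: "(\<lambda>(x, y). root_kernel n x y) \<in> borel_measurable (\<mu> \<Otimes>\<^sub>M \<mu>)" for n
    unfolding root_kernel_def[abs_def] by measurable
  have kmeas[measurable]: "(\<lambda>(x, y). k x y) \<in> borel_measurable (\<mu> \<Otimes>\<^sub>M \<mu>)"
    unfolding k_def[abs_def] case_prod_beta
    by (rule borel_measurable_lim_metric) measurable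
  have ksq: "square_integrable \<mu> (k x)" for x unfolding k_def[abs_def] by (rule lim(1))
  have kinv: "k (s x) (s y) = k x y" if "s \<in> \<G>" for s x y
    using Sn_kernel_invariant[OF \<G>[OF that]] by (simp add: k_def root_kernel_def)
  have form: "(\<integral>y. (\<integral>x. h x * k x y \<partial>\<mu>)\<^sup>2 \<partial>\<mu>) = (\<integral>x. h x * (\<integral>y. r x y * h y \<partial>\<mu>) \<partial>\<mu>)"
    if h: "square_integrable \<mu> h" for h
  proof -
    define \<kappa> where "\<kappa> y = (\<integral>x. h x * k x y \<partial>\<mu>)" for y
    define \<kappa>n where "\<kappa>n i y = (\<integral>x. h x * root_kernel (\<phi> i) x y \<partial>\<mu>)" for i y
    have \<kappa>n: "\<kappa>n i y = (\<Sum>l<\<phi> i. inv_sqrt_coeff l * (S ^^ l) (R h) y)" for i y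
    proof -
      have int: "integrable \<mu> (\<lambda>x. h x * (S ^^ l) (r x) y)" for l
      proof (rule square_integrable_mult_integrable[OF h square_integrable_bounded[OF _ Sn_kernel_le]])
        show "(\<lambda>x. (S ^^ l) (r x) y) \<in> borel_measurable \<mu>"
          using measurable_Pair1[OF Sn_kernel_meas[of l], of y] by (simp add: space_UNIV)
      qed
      have "\<kappa>n i y = (\<integral>x. (\<Sum>l<\<phi> i. inv_sqrt_coeff l * (h x * (S ^^ l) (r x) y)) \<partial>\<mu>)"
        by (simp add: \<kappa>n_def root_kernel_def sum_distrib_left mult_ac)
      also have "\<dots> = (\<Sum>l<\<phi> i. inv_sqrt_coeff l * (S ^^ l) (R h) y)"
        using int by (simp add: Sn_kernel_apply[OF h])
      finally show ?thesis .
    qed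
    have n2: "(\<integral>y. (\<kappa>n i y)\<^sup>2 \<partial>\<mu>) = inv_sqrt_form (moment (R h)) {..<\<phi> i}" for i
      unfolding \<kappa>n ip_sum_Sn[OF sq_R[OF h], symmetric] by (simp add: ip_def power2_eq_square)
    have sq\<kappa>n: "square_integrable \<mu> (\<kappa>n i)" for i
      unfolding \<kappa>n[abs_def] by (intro square_integrable_sum square_integrable_cmult sq_Sn sq_R h)
    have knorm: "(\<integral>y. (k x y)\<^sup>2 \<partial>\<mu>) = (\<integral>y. (k x0 y)\<^sup>2 \<partial>\<mu>)" for x
    proof -
      obtain s where s: "s \<in> \<G>" "s x0 = x" using trans by blast
      have "(\<integral>y. (k x y)\<^sup>2 \<partial>\<mu>) = (\<integral>y. (k x y)\<^sup>2 \<partial>distr \<mu> \<mu> s)" by (simp add: \<G> s)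
      also have "\<dots> = (\<integral>y. (k x (s y))\<^sup>2 \<partial>\<mu>)"
        using ksq[of x] by (intro integral_distr \<G> s) auto
      also have "\<dots> = (\<integral>y. (k x0 y)\<^sup>2 \<partial>\<mu>)" using kinv[OF s(1), of x0] s(2) by simp
      finally show ?thesis .
    qed
    note P1 = L2_field_pairing[OF prob_space_axioms prob_space_axioms kmeas ksq eq_refl[OF knorm] h]
    have sq\<kappa>: "square_integrable \<mu> \<kappa>" unfolding \<kappa>_def[abs_def] by (rule P1(3))
    \<comment> \<open>The error of the rows is at most (1/4)^i uniformly in \<open>x\<close>;
      pairing with \<open>h\<close> multiplies it by the squared norm of \<open>h\<close>.\<close>
    have dle: "(\<integral>y. (\<kappa>n i y - \<kappa> y)\<^sup>2 \<partial>\<mu>) \<le> (\<integral>x. (h x)\<^sup>2 \<partial>\<mu>) * (1/4)^i" for i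
    proof -
      define D where "D x y = k x y - root_kernel (\<phi> i) x y" for x y
      have Dm: "(\<lambda>(x, y). D x y) \<in> borel_measurable (\<mu> \<Otimes>\<^sub>M \<mu>)"
        unfolding D_def by measurable
      have Dsq: "square_integrable \<mu> (D x)" for x
        unfolding D_def[abs_def] by (intro square_integrable_diff ksq sqk)
      have Dle: "(\<integral>y. (D x y)\<^sup>2 \<partial>\<mu>) \<le> (1/4)^i" for x
        unfolding D_def k_def by (rule lim(2))
      note P2 = L2_field_pairing[OF prob_space_axioms prob_space_axioms Dm Dsq Dle h]
      have "AE y in \<mu>. (\<kappa>n i y - \<kappa> y)\<^sup>2 = (\<integral>x. h x * D x y \<partial>\<mu>)\<^sup>2"
        using P1(2) P2(2)
      proof eventually_elim
        case (elim y)
        have "\<kappa>n i y = (\<integral>x. h x * k x y - h x * D x y \<partial>\<mu>)"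
          by (simp add: \<kappa>n_def D_def algebra_simps)
        also have "\<dots> = \<kappa> y - (\<integral>x. h x * D x y \<partial>\<mu>)"
          using elim by (simp add: \<kappa>_def square_integrable_mult_integrable[OF h])
        finally show ?case by simp
      qed
      then have "(\<integral>y. (\<kappa>n i y - \<kappa> y)\<^sup>2 \<partial>\<mu>) = (\<integral>y. (\<integral>x. h x * D x y \<partial>\<mu>)\<^sup>2 \<partial>\<mu>)"
        using square_integrable_measurable[OF sq\<kappa>n[of i]] square_integrable_measurable[OF sq\<kappa>]
          square_integrable_measurable[OF P2(3)]
        by (intro integral_cong_AE) auto
      then show ?thesis using P2(4) by simp
    qed
    have "(\<lambda>i. (\<integral>x. (h x)\<^sup>2 \<partial>\<mu>) * (1/4)^i) \<longlonglongrightarrow> (\<integral>x. (h x)\<^sup>2 \<partial>\<mu>) * 0"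
      by (intro tendsto_intros LIMSEQ_power_zero) simp
    then have c0: "(\<lambda>i. (\<integral>x. (h x)\<^sup>2 \<partial>\<mu>) * (1/4)^i) \<longlonglongrightarrow> 0" by (simp only: mult_zero_right)
    have "(\<lambda>i. \<integral>y. (\<kappa>n i y - \<kappa> y)\<^sup>2 \<partial>\<mu>) \<longlonglongrightarrow> 0"
      by (rule tendsto_sandwich[OF always_eventually[OF allI] always_eventually[OF allI, OF dle] tendsto_const c0]) simp
    then have lim0: "(\<lambda>i. \<integral>y. (\<kappa> y - \<kappa>n i y)\<^sup>2 \<partial>\<mu>) \<longlonglongrightarrow> 0" by (simp only: power2_commute)
    have "(\<lambda>i. \<integral>y. (\<kappa>n i y)\<^sup>2 \<partial>\<mu>) \<longlonglongrightarrow> (\<integral>y. (\<kappa> y)\<^sup>2 \<partial>\<mu>)"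
      unfolding power2_eq_square by (intro L2_inner_tendsto sq\<kappa>n sq\<kappa> lim0)
    then have "(\<lambda>i. inv_sqrt_form (moment (R h)) {..<\<phi> i}) \<longlonglongrightarrow> (\<integral>y. (\<kappa> y)\<^sup>2 \<partial>\<mu>)" by (simp add: n2)
    moreover have "(\<lambda>i. inv_sqrt_form (moment (R h)) {..<\<phi> i}) \<longlonglongrightarrow> ip h (R h)"
      using LIMSEQ_subseq_LIMSEQ[OF R_form_tendsto[OF h] \<phi>_mono] by (simp add: o_def)
    ultimately have "(\<integral>y. (\<kappa> y)\<^sup>2 \<partial>\<mu>) = ip h (R h)" by (rule LIMSEQ_unique)
    then show ?thesis by (simp add: \<kappa>_def ip_def R_def)
  qed
  show thesis by (rule that[OF kmeas kinv ksq form])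
qed

end

section \<open>Baire measurability on compact spaces\<close>

text \<open>Compactness of 'y gives neighbourhoods on which \<psi> varies little uniformly in y, and
  compactness of 'g leaves finitely many of them. They are enumerated by natural numbers so that a
  least index can be selected measurably.\<close>

lemma continuous_uniform_net:
  fixes \<psi> :: "'g::topological_space \<times> 'y::topological_space \<Rightarrow> real"
  assumes g: "compact (UNIV :: 'g set)" and y: "compact (UNIV :: 'y set)"
    and \<psi>: "continuous_on UNIV \<psi>" and e: "0 < e"
  obtains p :: "nat \<Rightarrow> 'g" and U where "\<And>i. open (U i)" "\<And>g. \<exists>i. g \<in> U i"
    "\<And>i g y. g \<in> U i \<Longrightarrow> \<bar>\<psi> (g, y) - \<psi> (p i, y)\<bar> \<le> e"
proof -
  have "\<exists>V. g \<in> V \<and> open V \<and> (\<forall>g'\<in>V. \<forall>y. \<bar>\<psi> (g', y) - \<psi> (g, y)\<bar> \<le> e)" for g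
    by (rule continuous_on_prod_compactE[of UNIV UNIV \<psi> g e])
       (use y \<psi> e in \<open>auto simp: dist_real_def\<close>)
  then obtain V where V: "\<And>g. g \<in> V g" "\<And>g. open (V g)"
      "\<And>g g' y. g' \<in> V g \<Longrightarrow> \<bar>\<psi> (g', y) - \<psi> (g, y)\<bar> \<le> e" by metis
  obtain C where C: "finite C" "UNIV \<subseteq> (\<Union>c\<in>C. V c)"
    by (rule compactE_image[OF g, of UNIV V]) (use V in auto)
  then have "C \<noteq> {}" by auto
  show thesis
  proof (rule that[of "\<lambda>i. V (from_nat_into C i)" "from_nat_into C"])
    show "\<exists>i. g \<in> V (from_nat_into C i)" for g
      using C from_nat_into_surj[OF countable_finite[OF C(1)]] by (metis UNIV_I UN_E subsetD)
  qed (use V in auto)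
qed

text \<open>Without second countability \<^term>\<open>borel :: ('g::topological_space \<times> 'y::topological_space) measure\<close>
  may be strictly finer than the product sigma-algebra, but continuous functions on compact spaces
  are measurable for the latter.\<close>

lemma continuous_pair_borel_measurable:
  fixes \<psi> :: "'g::topological_space \<times> 'y::topological_space \<Rightarrow> real"
  assumes g: "compact (UNIV :: 'g set)" and y: "compact (UNIV :: 'y set)"
    and \<psi>: "continuous_on UNIV \<psi>"
  shows "\<psi> \<in> borel_measurable (borel \<Otimes>\<^sub>M borel)"
proof -
  have "\<exists>f\<in>borel_measurable (borel \<Otimes>\<^sub>M borel). \<forall>z. \<bar>\<psi> z - f z\<bar> \<le> e" if e: "0 < e" for e
  proof -
    obtain p :: "nat \<Rightarrow> 'g" and U where U: "\<And>i. open (U i)" "\<And>g. \<exists>i. g \<in> U i"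
      "\<And>i g y. g \<in> U i \<Longrightarrow> \<bar>\<psi> (g, y) - \<psi> (p i, y)\<bar> \<le> e"
      using continuous_uniform_net[OF g y \<psi> e] by metis
    \<comment> \<open>The first neighbourhood containing \<open>g\<close> is a Borel function of
      \<open>g\<close> with countably many values; replacing \<open>g\<close> by its centre gives a
      product measurable uniform approximation.\<close>
    define L where "L g = (LEAST i. g \<in> U i)" for g
    have L: "g \<in> U (L g)" for g unfolding L_def by (rule LeastI_ex[OF U(2)])
    have [measurable]: "L \<in> measurable borel (count_space UNIV)"
      unfolding L_def by (intro measurable_Least pred_intros_logic) (use U in \<open>auto simp: pred_def\<close>)
    have [measurable]: "(\<lambda>y. \<psi> (p i, y)) \<in> borel_measurable borel" for i
      by (intro borel_measurable_continuous_onI continuous_on_compose2[OF \<psi>] continuous_intros) auto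
    have "(\<lambda>z. \<psi> (p (L (fst z)), snd z)) \<in> borel_measurable (borel \<Otimes>\<^sub>M borel)"
      by (rule measurable_compose_countable[where f = "\<lambda>i z. \<psi> (p i, snd z)" and g = "\<lambda>z. L (fst z)"])
         measurable
    moreover have "\<bar>\<psi> z - \<psi> (p (L (fst z)), snd z)\<bar> \<le> e" for z
      using U(3)[OF L, of "fst z" "snd z"] by simp
    ultimately show ?thesis by (intro bexI[of _ "\<lambda>z. \<psi> (p (L (fst z)), snd z)"] allI)
  qed
  then have "\<exists>f\<in>borel_measurable (borel \<Otimes>\<^sub>M borel). \<forall>z. \<bar>\<psi> z - f z\<bar> \<le> inverse (real (Suc n))" for n
    by simp
  then obtain F where F: "\<And>n. F n \<in> borel_measurable (borel \<Otimes>\<^sub>M borel)"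
      "\<And>n z. \<bar>\<psi> z - F n z\<bar> \<le> inverse (real (Suc n))" by metis
  show ?thesis
  proof (rule borel_measurable_LIMSEQ_real[OF _ F(1)])
    fix z
    have "(\<lambda>n. F n z - \<psi> z) \<longlonglongrightarrow> 0"
      by (rule Lim_null_comparison[OF always_eventually[OF allI] LIMSEQ_inverse_real_of_nat])
         (use F(2) in \<open>simp add: abs_minus_commute\<close>)
    then show "(\<lambda>n. F n z) \<longlonglongrightarrow> \<psi> z" by (simp add: LIM_zero_iff)
  qed
qed

section \<open>The Baire sigma-algebra\<close>

definition baire :: "'x::topological_space measure" where
  "baire = sigma UNIV {f -` {0<..} | f :: 'x \<Rightarrow> real. continuous_on UNIV f}"

lemma space_baire [simp]: "space baire = UNIV"
  by (simp add: baire_def space_measure_of_conv)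

lemma sets_baire: "sets baire = sigma_sets UNIV {f -` {0<..} | f :: 'x::topological_space \<Rightarrow> real. continuous_on UNIV f}"
  by (simp add: baire_def)

lemma continuous_baire_measurable:
  fixes f :: "'x::topological_space \<Rightarrow> real"
  assumes "continuous_on UNIV f"
  shows "f \<in> borel_measurable baire"
  unfolding borel_measurable_iff_greater
proof
  fix a
  have "{x \<in> space baire. a < f x} = (\<lambda>x. f x - a) -` {0<..}" by auto
  also have "\<dots> \<in> sets baire"
    unfolding sets_baire using assms
    by (intro sigma_sets.Basic CollectI exI[of _ "\<lambda>x. f x - a"] conjI refl continuous_intros)
  finally show "{x \<in> space baire. a < f x} \<in> sets baire" .
qed

text \<open>The Baire sets form the coarsest sigma-algebra for which real continuous functions are
  measurable, so these functions test measurability.\<close>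

lemma measurable_baireI:
  assumes "\<And>\<phi> :: 'x::topological_space \<Rightarrow> real. continuous_on UNIV \<phi> \<Longrightarrow> (\<lambda>z. \<phi> (h z)) \<in> borel_measurable M"
  shows "h \<in> measurable M baire"
  unfolding baire_def
proof (rule measurable_measure_of)
  fix A assume "A \<in> {f -` {0<..} | f :: 'x \<Rightarrow> real. continuous_on UNIV f}"
  then obtain f :: "'x \<Rightarrow> real" where f: "A = f -` {0<..}" "continuous_on UNIV f" by auto
  have "h -` A \<inter> space M = (\<lambda>z. f (h z)) -` {0<..} \<inter> space M" using f by auto
  also have "\<dots> \<in> sets M" by (rule measurable_sets[OF assms[OF f(2)]]) simp
  finally show "h -` A \<inter> space M \<in> sets M" .
qed auto

lemma continuous_measurable_baire:
  assumes "continuous_on UNIV h"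
  shows "h \<in> measurable baire baire"
  by (intro measurable_baireI continuous_baire_measurable continuous_on_compose2[OF _ assms]) auto

lemma measurable_borel_baire:
  assumes "h \<in> measurable M borel"
  shows "h \<in> measurable M baire"
  by (intro measurable_baireI measurable_compose[OF assms] borel_measurable_continuous_onI)

text \<open>Positivity sets of continuous functions are stable under intersection, by taking minima,
  and their indicators are limits of continuous functions. Integrals of continuous functions
  therefore determine a probability on the Baire sets.\<close>

lemma distr_baire_eqI:
  fixes h1 :: "'a \<Rightarrow> 'x::topological_space" and h2 :: "'b \<Rightarrow> 'x"
  assumes "prob_space P1" "prob_space P2"
    and h[measurable]: "h1 \<in> measurable P1 baire" "h2 \<in> measurable P2 baire"
    and eq: "\<And>\<phi> :: 'x \<Rightarrow> real. continuous_on UNIV \<phi> \<Longrightarrow> (\<And>x. 0 \<le> \<phi> x) \<Longrightarrow> (\<And>x. \<phi> x \<le> 1) \<Longrightarrow>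
      (\<integral>z. \<phi> (h1 z) \<partial>P1) = (\<integral>z. \<phi> (h2 z) \<partial>P2)"
  shows "distr P1 baire h1 = distr P2 baire h2"
proof (rule measure_eqI_generator_eq[where \<Omega> = UNIV and A = "\<lambda>_. UNIV"])
  interpret P1: prob_space P1 by fact
  interpret P2: prob_space P2 by fact
  let ?E = "{f -` {0<..} | f :: 'x \<Rightarrow> real. continuous_on UNIV f}"
  show "Int_stable ?E"
  proof (rule Int_stableI)
    fix a b assume "a \<in> ?E" "b \<in> ?E"
    then obtain f g :: "'x \<Rightarrow> real" where "a = f -` {0<..}" "b = g -` {0<..}"
      "continuous_on UNIV f" "continuous_on UNIV g" by auto
    then show "a \<inter> b \<in> ?E"
      by (intro CollectI exI[of _ "\<lambda>x. min (f x) (g x)"]) (auto intro: continuous_on_min)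
  qed
  show "emeasure (distr P1 baire h1) A = emeasure (distr P2 baire h2) A" if AE: "A \<in> ?E" for A
  proof -
    obtain f :: "'x \<Rightarrow> real" where f: "A = f -` {0<..}" "continuous_on UNIV f" using AE by auto
    \<comment> \<open>These functions increase to the indicator of the set where \<open>f\<close> is
      positive.\<close>
    define \<phi> where "\<phi> n x = min 1 (real n * max 0 (f x))" for n x
    have \<phi>: "continuous_on UNIV (\<phi> n)" "0 \<le> \<phi> n x" "\<phi> n x \<le> 1" for n x
      unfolding \<phi>_def[abs_def] using f by (auto intro!: continuous_intros)
    have [measurable]: "\<phi> n \<in> borel_measurable baire" for n
      by (rule continuous_baire_measurable[OF \<phi>(1)])
    have A[measurable]: "A \<in> sets baire"
      using AE by (auto simp: sets_baire)
    have lim: "(\<lambda>n. \<phi> n x) \<longlonglongrightarrow> indicator A x" for x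
    proof (cases "f x > 0")
      case True
      obtain N where N: "1 < real N * f x" using reals_Archimedean3[OF True] by blast
      have "\<phi> n x = 1" if "n \<ge> N" for n
      proof -
        have "real N * f x \<le> real n * f x" using that True by (intro mult_right_mono) auto
        with N have "1 \<le> real n * f x" by linarith
        then show ?thesis using True by (simp add: \<phi>_def)
      qed
      then show ?thesis using True f
        by (intro tendsto_eventually) (auto simp: eventually_sequentially)
    next
      case False
      then show ?thesis using f by (simp add: \<phi>_def)
    qed
    have 1: "(\<lambda>n. \<integral>z. \<phi> n (h1 z) \<partial>P1) \<longlonglongrightarrow> (\<integral>z. indicator A (h1 z) \<partial>P1)"
      by (rule integral_dominated_convergence[where w = "\<lambda>_. 1"]) (use lim \<phi> in auto)
    have 2: "(\<lambda>n. \<integral>z. \<phi> n (h2 z) \<partial>P2) \<longlonglongrightarrow> (\<integral>z. indicator A (h2 z) \<partial>P2)"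
      by (rule integral_dominated_convergence[where w = "\<lambda>_. 1"]) (use lim \<phi> in auto)
    have e: "(\<integral>z. indicator A (h1 z) \<partial>P1) = (\<integral>z. indicator A (h2 z) \<partial>P2 :: real)"
      using LIMSEQ_unique[OF 1] 2 eq[OF \<phi>] by simp
    have m: "(\<integral>z. indicator A (h z) \<partial>P) = measure P (h -` A \<inter> space P)"
      if "h \<in> measurable P baire" for h :: "'c \<Rightarrow> 'x" and P
    proof -
      have "(\<integral>z. indicator A (h z) \<partial>P) = (\<integral>z. indicator (h -` A \<inter> space P) z \<partial>P :: real)"
        by (intro Bochner_Integration.integral_cong) (auto simp: indicator_def)
      then show ?thesis using measurable_sets[OF that A] by simp
    qed
    show ?thesis
      using e by (simp add: m[OF h(1)] m[OF h(2)] emeasure_distr P1.emeasure_eq_measure P2.emeasure_eq_measure)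
  qed
  show "range (\<lambda>_. UNIV) \<subseteq> ?E"
    by (auto intro!: exI[of _ "\<lambda>_. 1 :: real"])
  show "emeasure (distr P1 baire h1) UNIV \<noteq> \<infinity>"
    using emeasure_distr[OF h(1), of UNIV] P1.emeasure_space_1 sets.top[of "baire :: 'x measure"] by simp
qed (auto simp: sets_baire)

section \<open>Approximation by continuous functions\<close>

lemma compact_Hausdorff_separation:
  fixes C D :: "'x::t2_space set"
  assumes "compact (UNIV :: 'x set)" "compact C" "compact D" "C \<inter> D = {}"
  obtains \<phi> :: "'x \<Rightarrow> real" where "continuous_on UNIV \<phi>" "\<And>x. 0 \<le> \<phi> x" "\<And>x. \<phi> x \<le> 1"
    "\<And>x. x \<in> C \<Longrightarrow> \<phi> x = 1" "\<And>x. x \<in> D \<Longrightarrow> \<phi> x = 0"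
proof -
  have "Hausdorff_space (euclidean :: 'x topology)"
    unfolding Hausdorff_space_def disjnt_def
    by (metis hausdorff open_openin topspace_euclidean)
  then have "normal_space (euclidean :: 'x topology)"
    by (intro compact_Hausdorff_or_regular_imp_normal_space)
       (use assms(1) in \<open>auto simp: compact_space_def\<close>)
  then obtain f :: "'x \<Rightarrow> real" where f: "continuous_map euclidean (top_of_set {0..1}) f" "f ` D \<subseteq> {0}" "f ` C \<subseteq> {1}"
    by (rule Urysohn_lemma[of _ D C 0 1]) (use assms in \<open>auto simp: compact_imp_closed disjnt_def\<close>)
  then show thesis
    by (intro that[of f]) (auto simp: continuous_map_in_subtopology image_subset_iff)
qed


text \<open>The epsilon form of inner regularity, convenient for choosing compact sets inside a set
  and inside its complement.\<close>

definition compact_inner_regular :: "'x::topological_space measure \<Rightarrow> bool" where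
  "compact_inner_regular \<mu> \<longleftrightarrow> (\<forall>A\<in>sets \<mu>. \<forall>e>0. \<exists>C\<subseteq>A. compact C \<and> C \<in> sets \<mu> \<and> measure \<mu> A - e < measure \<mu> C)"

lemma continuous_bounded:
  fixes \<phi> :: "'x::topological_space \<Rightarrow> real"
  assumes "compact (UNIV :: 'x set)" "continuous_on UNIV \<phi>"
  obtains B where "\<And>x. \<bar>\<phi> x\<bar> \<le> B"
  using compact_imp_bounded[OF compact_continuous_image[OF assms(2,1)]] that
  by (auto simp: bounded_real)

text \<open>Compact sets C in A and D in its complement each miss mass less than e/2. A continuous
  function equal to 1 on C and 0 on D differs from the indicator of A only on the missed part, and
  there by at most 1.\<close>

lemma continuous_L2_dense:
  fixes \<mu> :: "'x::t2_space measure" and f :: "'x \<Rightarrow> real"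
  assumes X: "compact (UNIV :: 'x set)" and "prob_space \<mu>" and sets: "sets \<mu> = sets borel"
    and reg: "compact_inner_regular \<mu>"
    and f: "square_integrable \<mu> f" and e: "0 < e"
  shows "\<exists>\<phi>. continuous_on UNIV \<phi> \<and> (\<integral>x. (f x - \<phi> x)\<^sup>2 \<partial>\<mu>) \<le> e"
proof -
  interpret prob_space \<mu> by fact
  have space: "space \<mu> = UNIV" using sets_eq_imp_space_eq[OF sets] by simp
  have cont_sq: "square_integrable \<mu> \<phi>" if "continuous_on UNIV \<phi>" for \<phi> :: "'x \<Rightarrow> real"
  proof -
    obtain B where "\<And>x. \<bar>\<phi> x\<bar> \<le> B" using continuous_bounded[OF X \<open>continuous_on UNIV \<phi>\<close>] by blast
    then show ?thesis
      using borel_measurable_continuous_onI[OF that] measurable_cong_sets[OF sets refl]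
      by (intro square_integrable_bounded) auto
  qed
  have ind: "\<exists>\<phi>. continuous_on UNIV \<phi> \<and> (\<integral>x. (indicator A x - \<phi> x)\<^sup>2 \<partial>\<mu>) \<le> e"
    if A: "A \<in> sets \<mu>" and e: "0 < e" for A and e :: real
  proof -
    obtain C where C: "C \<subseteq> A" "compact C" "C \<in> sets \<mu>" "prob A - e / 2 < prob C"
      using reg A e unfolding compact_inner_regular_def by (metis half_gt_zero)
    have A': "space \<mu> - A \<in> sets \<mu>" using A by auto
    obtain D where D: "D \<subseteq> space \<mu> - A" "compact D" "D \<in> sets \<mu>" "prob (space \<mu> - A) - e / 2 < prob D"
      using reg A' e unfolding compact_inner_regular_def by (metis half_gt_zero)
    obtain \<phi> :: "'x \<Rightarrow> real" where \<phi>: "continuous_on UNIV \<phi>" "\<And>x. 0 \<le> \<phi> x" "\<And>x. \<phi> x \<le> 1"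
      "\<And>x. x \<in> C \<Longrightarrow> \<phi> x = 1" "\<And>x. x \<in> D \<Longrightarrow> \<phi> x = 0"
      using compact_Hausdorff_separation[OF X C(2) D(2)] C(1) D(1) by blast
    let ?E = "(A - C) \<union> ((space \<mu> - A) - D)"
    have E: "?E \<in> sets \<mu>" using A C D by auto
    have le: "(indicator A x - \<phi> x)\<^sup>2 \<le> indicator ?E x" for x
    proof (cases "x \<in> ?E")
      case True
      have "\<bar>indicator A x - \<phi> x\<bar> \<le> 1" using \<phi>(2,3)[of x] by (auto simp: indicator_def)
      then show ?thesis using True by (simp add: abs_square_le_1)
    next
      case False
      then have "x \<in> C \<or> x \<in> D" by (auto simp: space)
      then have "indicator A x = \<phi> x" using \<phi>(4,5) C(1) D(1) by (auto simp: indicator_def)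
      then show ?thesis by simp
    qed
    have "(\<integral>x. (indicator A x - \<phi> x)\<^sup>2 \<partial>\<mu>) \<le> (\<integral>x. indicator ?E x \<partial>\<mu>)"
      using square_integrable_diff[OF square_integrable_indicator[OF A] cont_sq[OF \<phi>(1)]]
        square_integrable_integrable[OF square_integrable_indicator[OF E]] le
      by (intro integral_mono) (auto simp: square_integrable_real)
    also have "\<dots> = prob ?E" using E by simp
    also have "\<dots> \<le> prob (A - C) + prob ((space \<mu> - A) - D)"
      using A C D by (intro measure_Un_le) auto
    also have "\<dots> \<le> e"
      using C D A A' by (simp add: finite_measure_Diff)
    finally show ?thesis
      using \<phi>(1) by blast
  qed
  have "\<exists>\<phi>\<in>{\<phi>. continuous_on UNIV \<phi>}. (\<integral>x. (f x - \<phi> x)\<^sup>2 \<partial>\<mu>) \<le> e"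
    by (rule square_integrable_dense[OF f sets.Int_stable sets.space_closed sets.sigma_sets_eq[symmetric] _ _ _ _ _ e])
       (use cont_sq ind in \<open>auto intro: continuous_intros\<close>)
  then show ?thesis by blast
qed

text \<open>A subsequence with squared errors below (1/2)^n converges almost everywhere, and the
  pointwise \<open>lim\<close> of its versions is measurable for \<open>M'\<close>.\<close>

lemma L2_limit_version:
  fixes u :: "nat \<Rightarrow> 'x \<Rightarrow> real"
  assumes u: "\<And>n. square_integrable M (u n)" and v: "square_integrable M v"
    and lim: "(\<lambda>n. \<integral>x. (u n x - v x)\<^sup>2 \<partial>M) \<longlonglongrightarrow> 0"
    and ver: "\<And>n. \<exists>w\<in>borel_measurable M'. AE x in M. u n x = w x"
  shows "\<exists>w\<in>borel_measurable M'. AE x in M. v x = w x"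
proof -
  have "\<exists>N. (\<integral>x. (u N x - v x)\<^sup>2 \<partial>M) < (1/2)^n" for n
    using order_tendstoD(2)[OF lim, of "(1/2)^n"] by (auto simp: eventually_sequentially)
  then obtain N where N: "\<And>n. (\<integral>x. (u (N n) x - v x)\<^sup>2 \<partial>M) < (1/2)^n" by metis
  have conv: "AE x in M. (\<lambda>n. u (N n) x) \<longlonglongrightarrow> v x"
    using N by (intro AE_tendsto_if_L2_summable[where c = "\<lambda>n. (1/2)^n"] square_integrable_diff u v)
      (auto intro: less_imp_le)
  obtain w where w: "\<And>n. w n \<in> borel_measurable M'" "\<And>n. AE x in M. u (N n) x = w n x"
    using choice[of "\<lambda>n w. w \<in> borel_measurable M' \<and> (AE x in M. u (N n) x = w x)"] ver by blast
  have "AE x in M. \<forall>n. u (N n) x = w n x" using w(2) by (simp add: AE_all_countable)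
  with conv have "AE x in M. v x = lim (\<lambda>n. w n x)"
    by eventually_elim (auto dest: limI)
  moreover have "(\<lambda>x. lim (\<lambda>n. w n x)) \<in> borel_measurable M'"
    by (rule borel_measurable_lim_metric) (rule w(1))
  ultimately show ?thesis by (intro bexI)
qed

text \<open>Continuous functions are Baire measurable and dense, and having a Baire version survives
  mean-square limits.\<close>

lemma baire_version:
  fixes \<mu> :: "'x::t2_space measure" and f :: "'x \<Rightarrow> real"
  assumes X: "compact (UNIV :: 'x set)" and "prob_space \<mu>" and sets: "sets \<mu> = sets borel"
    and reg: "compact_inner_regular \<mu>" and f: "square_integrable \<mu> f"
  shows "\<exists>w\<in>borel_measurable baire. AE x in \<mu>. f x = w x"
proof -
  interpret prob_space \<mu> by fact
  have "\<exists>\<phi>. continuous_on UNIV \<phi> \<and> (\<integral>x. (f x - \<phi> x)\<^sup>2 \<partial>\<mu>) \<le> inverse (real (Suc n))" for n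
    by (rule continuous_L2_dense[OF assms]) simp
  then obtain \<phi> where \<phi>: "\<And>n. continuous_on UNIV (\<phi> n)"
      "\<And>n. (\<integral>x. (f x - \<phi> n x)\<^sup>2 \<partial>\<mu>) \<le> inverse (real (Suc n))" by metis
  show ?thesis
  proof (rule L2_limit_version[of \<mu> \<phi>, OF _ f])
    show "square_integrable \<mu> (\<phi> n)" for n
    proof -
      obtain B where "\<And>x. \<bar>\<phi> n x\<bar> \<le> B" using continuous_bounded[OF X \<phi>(1)] by blast
      then show ?thesis
        using borel_measurable_continuous_onI[OF \<phi>(1)] measurable_cong_sets[OF sets refl]
        by (intro square_integrable_bounded) auto
    qed
    show "(\<lambda>n. \<integral>x. (\<phi> n x - f x)\<^sup>2 \<partial>\<mu>) \<longlonglongrightarrow> 0"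
      by (rule tendsto_sandwich[OF always_eventually[OF allI] always_eventually[OF allI]
            tendsto_const LIMSEQ_inverse_real_of_nat])
         (use \<phi>(2) in \<open>auto simp: power2_commute[of "\<phi> _ _"]\<close>)
    show "\<exists>w\<in>borel_measurable baire. AE x in \<mu>. \<phi> n x = w x" for n
      using continuous_baire_measurable[OF \<phi>(1)] by blast
  qed
qed

section \<open>Compact homogeneous spaces\<close>

locale compact_homogeneous_space =
  fixes act :: "'g::{topological_group_add, t2_space} \<Rightarrow> 'x::t2_space \<Rightarrow> 'x"
    and x0 :: 'x and \<nu> :: "'g measure" and \<mu> :: "'x measure"
  assumes compact_group: "compact (UNIV :: 'g set)"
    and action: "continuous_action act" and trans: "transitive_action act"
    and haar: "normalized_haar \<nu>" and \<mu>_eq: "\<mu> = invariant_measure \<nu> act x0"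
begin

lemma act_zero [simp]: "act 0 x = x" and act_add: "act (g + h) x = act g (act h x)"
  using action by (auto simp: continuous_action_def)

lemma act_minus_cancel [simp]: "act g (act (- g) x) = x" "act (- g) (act g x) = x"
  by (simp_all flip: act_add)

lemma continuous_act [continuous_intros]:
  assumes "continuous_on A f" "continuous_on A h"
  shows "continuous_on A (\<lambda>z. act (f z) (h z))"
proof -
  have "continuous_on UNIV (\<lambda>z. act (fst z) (snd z))"
    using action by (simp add: continuous_action_def case_prod_unfold)
  from continuous_on_compose2[OF this continuous_on_Pair[OF assms]] show ?thesis by simp
qed

lemma exists_group_element: "\<exists>g. act g x = y"
  using trans by (simp add: transitive_action_def)

lemma compact_space: "compact (UNIV :: 'x set)"
proof -
  have "range (\<lambda>g. act g x0) = UNIV" using exists_group_element[of x0] by (metis surj_def)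
  moreover have "compact (range (\<lambda>g. act g x0))"
    by (intro compact_continuous_image compact_group continuous_intros)
  ultimately show ?thesis by simp
qed

sublocale \<nu>: prob_space \<nu>
  using haar by (simp add: normalized_haar_def)

lemma sets_haar [measurable_cong]: "sets \<nu> = sets borel" and space_haar [simp]: "space \<nu> = UNIV"
  using haar sets_eq_imp_space_eq[of \<nu> borel] by (auto simp: normalized_haar_def)

lemma haar_left_invariant: "distr \<nu> \<nu> (\<lambda>h. g + h) = \<nu>"
  using haar by (simp add: normalized_haar_def)

lemma continuous_measurable [measurable]:
  "(\<lambda>h. g + h) \<in> measurable borel borel" "(\<lambda>h. h + g) \<in> measurable borel borel"
  "act g \<in> measurable borel borel" "(\<lambda>g. act g x) \<in> measurable borel borel"
  by (intro borel_measurable_continuous_onI continuous_intros)+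

sublocale \<mu>: prob_space \<mu>
  unfolding \<mu>_eq invariant_measure_def by (rule \<nu>.prob_space_distr) measurable

lemma sets_\<mu> [measurable_cong]: "sets \<mu> = sets borel" and space_\<mu> [simp]: "space \<mu> = UNIV"
  by (auto simp: \<mu>_eq invariant_measure_def)

lemma haar_inner_regular: "compact_inner_regular \<nu>"
  unfolding compact_inner_regular_def
proof (intro ballI allI impI)
  fix A and e :: real assume A: "A \<in> sets \<nu>" and e: "0 < e"
  let ?C = "{C. C \<subseteq> A \<and> compact C \<and> C \<in> sets \<nu>}"
  show "\<exists>C\<subseteq>A. compact C \<and> C \<in> sets \<nu> \<and> measure \<nu> A - e < measure \<nu> C"
  proof (cases "measure \<nu> A - e < 0")
    case True
    then show ?thesis by (intro exI[of _ "{}"]) simp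
  next
    case False
    have "ennreal (measure \<nu> A - e) < emeasure \<nu> A"
      unfolding \<nu>.emeasure_eq_measure using e False by (intro ennreal_lessI) (auto intro: less_le_trans)
    also have "emeasure \<nu> A = (SUP C\<in>?C. emeasure \<nu> C)"
      using haar A by (simp add: normalized_haar_def)
    finally obtain C where C: "C \<in> ?C" "ennreal (measure \<nu> A - e) < emeasure \<nu> C"
      by (auto simp: less_SUP_iff)
    then have "measure \<nu> A - e < measure \<nu> C"
      using False by (simp add: \<nu>.emeasure_eq_measure ennreal_less_iff)
    then show ?thesis using C by auto
  qed
qed

lemma measure_\<mu>: "A \<in> sets borel \<Longrightarrow> measure \<mu> A = measure \<nu> {g. act g x0 \<in> A}"
  unfolding \<mu>_eq invariant_measure_def by (subst measure_distr) (auto simp: vimage_def)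

text \<open>The orbit map sends a compact subset of the preimage to a compact, hence closed and
  Borel, subset of \<open>A\<close> whose preimage contains the original compact set.\<close>

lemma \<mu>_inner_regular: "compact_inner_regular \<mu>"
  unfolding compact_inner_regular_def
proof (intro ballI allI impI)
  fix A and e :: real assume A: "A \<in> sets \<mu>" and e: "0 < e"
  have A': "{g. act g x0 \<in> A} \<in> sets \<nu>"
    using measurable_sets[OF continuous_measurable(4)[of x0], of A] A by (simp add: sets_\<mu> sets_haar vimage_def)
  obtain C where C: "C \<subseteq> {g. act g x0 \<in> A}" "compact C" "C \<in> sets \<nu>"
      "measure \<nu> {g. act g x0 \<in> A} - e < measure \<nu> C"
    using haar_inner_regular A' e unfolding compact_inner_regular_def by blast
  let ?D = "(\<lambda>g. act g x0) ` C"
  have D: "compact ?D" by (intro compact_continuous_image C continuous_intros)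
  then have D': "?D \<in> sets borel" by (intro borel_closed compact_imp_closed)
  have "measure \<nu> C \<le> measure \<nu> {g. act g x0 \<in> ?D}"
    using measurable_sets[OF continuous_measurable(4)[of x0] D']
    by (intro \<nu>.finite_measure_mono) (auto simp: vimage_def sets_haar)
  then show "\<exists>C\<subseteq>A. compact C \<and> C \<in> sets \<mu> \<and> measure \<mu> A - e < measure \<mu> C"
    using C D D' A by (intro exI[of _ ?D]) (auto simp: measure_\<mu> sets_\<mu>)
qed

lemma \<mu>_invariant: "distr \<mu> \<mu> (act g) = \<mu>"
proof -
  have "distr \<mu> \<mu> (act g) = distr \<mu> borel (act g)" by (intro distr_cong sets_\<mu> refl)
  also have "\<dots> = distr \<nu> borel (\<lambda>h. act (g + h) x0)"
    unfolding \<mu>_eq invariant_measure_def by (subst distr_distr) (auto simp: act_add o_def)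
  also have "\<dots> = distr (distr \<nu> \<nu> (\<lambda>h. g + h)) borel (\<lambda>h. act h x0)"
    by (subst distr_distr) (auto simp: o_def)
  finally show ?thesis by (simp add: haar_left_invariant \<mu>_eq invariant_measure_def)
qed

lemma integral_translate:
  fixes f :: "'x \<Rightarrow> 'b::{banach, second_countable_topology}"
  assumes "f \<in> borel_measurable \<mu>"
  shows "(\<integral>x. f (act g x) \<partial>\<mu>) = (\<integral>x. f x \<partial>\<mu>)"
proof -
  have "(\<integral>x. f (act g x) \<partial>\<mu>) = (\<integral>x. f x \<partial>distr \<mu> \<mu> (act g))"
    by (rule integral_distr[symmetric]) (use assms in measurable)
  then show ?thesis by (simp add: \<mu>_invariant)
qed

lemma square_integrable_translate:
  fixes f :: "'x \<Rightarrow> real"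
  assumes f: "square_integrable \<mu> f"
  shows "square_integrable \<mu> (\<lambda>x. f (act g x))"
proof -
  have "integrable (distr \<mu> \<mu> (act g)) (\<lambda>x. (f x)\<^sup>2)"
    using f by (simp add: \<mu>_invariant square_integrable_real)
  then have "integrable \<mu> (\<lambda>x. (f (act g x))\<^sup>2)"
    by (rule integrable_distr[rotated]) measurable
  moreover have "(\<lambda>x. f (act g x)) \<in> borel_measurable \<mu>"
    using square_integrable_measurable[OF f] by measurable
  ultimately show ?thesis by (simp add: square_integrable_real)
qed

section \<open>Inversion and right translation under Haar measure\<close>

lemma haar_left_integral:
  fixes \<phi> :: "'g \<Rightarrow> real"
  assumes [measurable]: "\<phi> \<in> borel_measurable borel"
  shows "(\<integral>h. \<phi> (g + h) \<partial>\<nu>) = (\<integral>h. \<phi> h \<partial>\<nu>)"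
proof -
  have "(\<integral>h. \<phi> (g + h) \<partial>\<nu>) = (\<integral>h. \<phi> h \<partial>distr \<nu> \<nu> (\<lambda>h. g + h))"
    by (rule integral_distr[symmetric]) measurable
  then show ?thesis by (simp add: haar_left_invariant)
qed

text \<open>Integrating \<open>\<phi> (- h + g)\<close> in both orders shows that the Haar measure is invariant under
  inversion, hence under right translations.  Continuity of \<open>\<phi>\<close> is what makes the integrand
  measurable for the product sigma-algebra.\<close>

lemma haar_uminus_integral:
  fixes \<phi> :: "'g \<Rightarrow> real"
  assumes \<phi>: "continuous_on UNIV \<phi>"
  shows "(\<integral>h. \<phi> (- h) \<partial>\<nu>) = (\<integral>h. \<phi> h \<partial>\<nu>)"
proof -
  interpret PP: pair_prob_space \<nu> \<nu> ..
  have \<phi>': "continuous_on UNIV (\<lambda>h. \<phi> (- h))"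
    by (intro continuous_on_compose2[OF \<phi>] continuous_intros) auto
  have [measurable]: "\<phi> \<in> borel_measurable borel" "(\<lambda>h. \<phi> (- h)) \<in> borel_measurable borel"
    using \<phi> \<phi>' by (auto intro: borel_measurable_continuous_onI)
  obtain B where B: "\<And>g. \<bar>\<phi> g\<bar> \<le> B" using continuous_bounded[OF compact_group \<phi>] by blast
  have "continuous_on UNIV (\<lambda>z :: 'g \<times> 'g. \<phi> (- fst z + snd z))"
    by (intro continuous_on_compose2[OF \<phi>] continuous_intros) auto
  from continuous_pair_borel_measurable[OF compact_group compact_group this]
  have [measurable]: "(\<lambda>(h, g). \<phi> (- h + g)) \<in> borel_measurable (\<nu> \<Otimes>\<^sub>M \<nu>)"
    by (simp add: case_prod_unfold cong: sets_pair_measure_cong measurable_cong_sets)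
  have int: "integrable (\<nu> \<Otimes>\<^sub>M \<nu>) (\<lambda>(h, g). \<phi> (- h + g))"
    by (rule integrable_pair_bounded_product[OF \<nu>.prob_space_axioms \<nu>.prob_space_axioms,
          of "\<lambda>_. B" "\<lambda>_. 1"]) (use B order_trans[OF abs_ge_zero B] in auto)
  have "(\<integral>h. \<phi> h \<partial>\<nu>) = (\<integral>h. (\<integral>g. \<phi> (- h + g) \<partial>\<nu>) \<partial>\<nu>)"
    using \<nu>.prob_space by (simp add: haar_left_integral)
  also have "\<dots> = (\<integral>g. (\<integral>h. \<phi> (- h + g) \<partial>\<nu>) \<partial>\<nu>)"
    using PP.Fubini_integral[OF int] by simp
  also have "\<dots> = (\<integral>g. (\<integral>h. \<phi> (- h) \<partial>\<nu>) \<partial>\<nu>)"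
  proof -
    \<comment> \<open>Here -h + g = -(-g + h), so left invariance applies to the function h ->
      \<phi> (-h).\<close>
    have "(\<integral>h. \<phi> (- h + g) \<partial>\<nu>) = (\<integral>h. \<phi> (- h) \<partial>\<nu>)" for g
      using haar_left_integral[of "\<lambda>h. \<phi> (- h)" "- g"] by (simp add: minus_add)
    then show ?thesis by simp
  qed
  finally show ?thesis using \<nu>.prob_space by simp
qed

lemma haar_right_integral:
  fixes \<phi> :: "'g \<Rightarrow> real"
  assumes \<phi>: "continuous_on UNIV \<phi>"
  shows "(\<integral>h. \<phi> (h + g) \<partial>\<nu>) = (\<integral>h. \<phi> h \<partial>\<nu>)"
proof -
  have c: "continuous_on UNIV (\<lambda>h. \<phi> (h + g))" "continuous_on UNIV (\<lambda>h. \<phi> (- h))"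
    by (intro continuous_on_compose2[OF \<phi>] continuous_intros; auto)+
  have "(\<integral>h. \<phi> (h + g) \<partial>\<nu>) = (\<integral>h. \<phi> (- (- g + h)) \<partial>\<nu>)"
    using haar_uminus_integral[OF c(1)] by (simp add: minus_add)
  also have "\<dots> = (\<integral>h. \<phi> (- h) \<partial>\<nu>)"
    using haar_left_integral[OF borel_measurable_continuous_onI[OF c(2)], of "- g"] by simp
  finally show ?thesis by (simp add: haar_uminus_integral[OF \<phi>])
qed

lemma id_baire_measurable [measurable]:
  "(\<lambda>x. x) \<in> measurable \<mu> baire" "(\<lambda>g. g) \<in> measurable \<nu> baire" "(\<lambda>g. g + h) \<in> measurable \<nu> baire"
  "(\<lambda>g. act g x) \<in> measurable \<nu> baire"
  by (rule measurable_borel_baire; measurable)+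

text \<open>Stated on the Baire sets, where the continuous test functions of
  \<open>haar_right_integral\<close> decide equality.\<close>

lemma haar_right_invariant_baire: "distr \<nu> baire (\<lambda>g. g + h) = distr \<nu> baire (\<lambda>g. g)"
  by (intro distr_baire_eqI \<nu>.prob_space_axioms haar_right_integral) measurable

text \<open>Moving the base point from x0 to a x0 is a right translation by a in the group, so the
  image of Haar measure is the same for every orbit map.\<close>

lemma orbit_map_distr_baire: "distr \<nu> baire (\<lambda>g. act g x) = distr \<mu> baire (\<lambda>x. x)"
proof (intro distr_baire_eqI \<nu>.prob_space_axioms \<mu>.prob_space_axioms)
  fix \<phi> :: "'x \<Rightarrow> real" assume \<phi>: "continuous_on UNIV \<phi>"
  obtain a where a: "act a x0 = x" using exists_group_element by blast
  have c: "continuous_on UNIV (\<lambda>g. \<phi> (act g x0))"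
    by (intro continuous_on_compose2[OF \<phi>] continuous_intros) auto
  have "(\<integral>g. \<phi> (act g x) \<partial>\<nu>) = (\<integral>g. \<phi> (act (g + a) x0) \<partial>\<nu>)" by (simp add: act_add a)
  also have "\<dots> = (\<integral>g. \<phi> (act g x0) \<partial>\<nu>)" by (rule haar_right_integral[OF c])
  also have "\<dots> = (\<integral>x. \<phi> x \<partial>\<mu>)"
    unfolding \<mu>_eq invariant_measure_def
    by (rule integral_distr[symmetric]) (use borel_measurable_continuous_onI[OF \<phi>] in measurable)
  finally show "(\<integral>g. \<phi> (act g x) \<partial>\<nu>) = (\<integral>x. \<phi> x \<partial>\<mu>)" .
qed measurable

lemma act_pair_measurable [measurable]: "(\<lambda>(g, x). act g x) \<in> measurable (\<nu> \<Otimes>\<^sub>M \<mu>) baire"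
proof (rule measurable_baireI)
  fix \<phi> :: "'x \<Rightarrow> real" assume \<phi>: "continuous_on UNIV \<phi>"
  have "continuous_on UNIV (\<lambda>z :: 'g \<times> 'x. \<phi> (act (fst z) (snd z)))"
    by (intro continuous_on_compose2[OF \<phi>] continuous_intros) auto
  from continuous_pair_borel_measurable[OF compact_group compact_space this]
  show "(\<lambda>z. \<phi> (case z of (g, x) \<Rightarrow> act g x)) \<in> borel_measurable (\<nu> \<Otimes>\<^sub>M \<mu>)"
    by (subst measurable_cong_sets[OF sets_pair_measure_cong[OF sets_haar sets_\<mu>] refl])
       (simp add: case_prod_unfold)
qed

text \<open>The orbit of \<open>f\<close> under translations is totally bounded: this holds
  uniformly for a continuous approximation of \<open>f\<close>, and translations preserve the error
  of approximation.\<close>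

lemma translate_net:
  fixes f :: "'x \<Rightarrow> real"
  assumes f: "square_integrable \<mu> f" and e: "0 < e"
  obtains p :: "nat \<Rightarrow> 'g" where
    "\<And>g. \<exists>i. (\<integral>x. (f (act (- g) x) - f (act (- p i) x))\<^sup>2 \<partial>\<mu>) \<le> e"
proof -
  \<comment> \<open>The difference splits into three terms, and two uses of \<open>L2_add_le\<close>
    give 2 + 4 + 4 = 10 times e/12.\<close>
  have e': "0 < e / 12" "0 < sqrt (e / 12)" using e by auto
  obtain \<phi> where \<phi>: "continuous_on UNIV \<phi>" "(\<integral>x. (f x - \<phi> x)\<^sup>2 \<partial>\<mu>) \<le> e / 12"
    using continuous_L2_dense[OF compact_space \<mu>.prob_space_axioms sets_\<mu> \<mu>_inner_regular f e'(1)] by blast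
  obtain B where "\<And>x. \<bar>\<phi> x\<bar> \<le> B" using continuous_bounded[OF compact_space \<phi>(1)] by blast
  then have sq\<phi>: "square_integrable \<mu> \<phi>"
    using borel_measurable_continuous_onI[OF \<phi>(1)] by (intro \<mu>.square_integrable_bounded[where B = B]) auto
  have "continuous_on UNIV (\<lambda>z :: 'g \<times> 'x. \<phi> (act (- fst z) (snd z)))"
    by (intro continuous_on_compose2[OF \<phi>(1)] continuous_intros) auto
  from continuous_uniform_net[OF compact_group compact_space this e'(2)]
  obtain p :: "nat \<Rightarrow> 'g" and U where U: "\<And>g. \<exists>i. g \<in> U i"
    "\<And>i g y. g \<in> U i \<Longrightarrow> \<bar>\<phi> (act (- g) y) - \<phi> (act (- p i) y)\<bar> \<le> sqrt (e / 12)" by auto metis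
  show thesis
  proof (rule that)
    fix g
    obtain i where i: "g \<in> U i" using U(1) by blast
    let ?d = "\<lambda>g x. f (act (- g) x) - \<phi> (act (- g) x)"
    let ?m = "\<lambda>x. \<phi> (act (- g) x) - \<phi> (act (- p i) x)"
    have sq: "square_integrable \<mu> (?d g)" "square_integrable \<mu> ?m" for g
      by (intro square_integrable_diff square_integrable_translate[OF f] square_integrable_translate[OF sq\<phi>])+
    have d: "(\<integral>x. (?d g x)\<^sup>2 \<partial>\<mu>) \<le> e / 12" for g
      using integral_translate[of "\<lambda>x. (f x - \<phi> x)\<^sup>2" "- g"] \<phi>(2)
        square_integrable_measurable[OF square_integrable_diff[OF f sq\<phi>]] by simp
    have m: "(\<integral>x. (?m x)\<^sup>2 \<partial>\<mu>) \<le> (\<integral>x. e / 12 \<partial>\<mu>)"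
    proof (intro integral_mono)
      fix x
      have "\<bar>?m x\<bar>\<^sup>2 \<le> (sqrt (e / 12))\<^sup>2" by (intro power_mono U(2)[OF i]) auto
      then show "(?m x)\<^sup>2 \<le> e / 12" using e by simp
    qed (use sq(2) in \<open>auto simp: square_integrable_real\<close>)
    have "(\<integral>x. (f (act (- g) x) - f (act (- p i) x))\<^sup>2 \<partial>\<mu>) = (\<integral>x. (?d g x + (?m x + - 1 * ?d (p i) x))\<^sup>2 \<partial>\<mu>)"
      by simp
    also have "\<dots> \<le> 2 * (\<integral>x. (?d g x)\<^sup>2 \<partial>\<mu>) + 2 * (\<integral>x. (?m x + - 1 * ?d (p i) x)\<^sup>2 \<partial>\<mu>)"
      by (intro L2_add_le square_integrable_add square_integrable_cmult sq)
    also have "(\<integral>x. (?m x + - 1 * ?d (p i) x)\<^sup>2 \<partial>\<mu>) \<le> 2 * (\<integral>x. (?m x)\<^sup>2 \<partial>\<mu>) + 2 * (\<integral>x. (- 1 * ?d (p i) x)\<^sup>2 \<partial>\<mu>)"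
      by (intro L2_add_le square_integrable_add square_integrable_cmult sq)
    also have "(\<integral>x. (- 1 * ?d (p i) x)\<^sup>2 \<partial>\<mu>) = (\<integral>x. (?d (p i) x)\<^sup>2 \<partial>\<mu>)"
      by (simp add: power2_commute)
    finally have "(\<integral>x. (f (act (- g) x) - f (act (- p i) x))\<^sup>2 \<partial>\<mu>) \<le> e"
      using d[of g] d[of "p i"] m e \<mu>.prob_space by simp
    then show "\<exists>i. (\<integral>x. (f (act (- g) x) - f (act (- p i) x))\<^sup>2 \<partial>\<mu>) \<le> e" by blast
  qed
qed

text \<open>On a rectangle only the second factor is replaced, by \<open>baire_version\<close>;
  \<open>square_integrable_induct\<close> does the rest. The coarser second factor is what allows
  \<open>act g x\<close> to be substituted measurably.\<close>

lemma field_baire_version: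
  fixes F :: "'a \<times> 'x \<Rightarrow> real"
  assumes "prob_space M" and F: "square_integrable (M \<Otimes>\<^sub>M \<mu>) F"
  shows "\<exists>w\<in>borel_measurable (M \<Otimes>\<^sub>M baire). AE z in M \<Otimes>\<^sub>M \<mu>. F z = w z"
proof -
  interpret M: prob_space M by fact
  interpret P: pair_prob_space M \<mu> ..
  let ?Q = "\<lambda>F :: 'a \<times> 'x \<Rightarrow> real. \<exists>w\<in>borel_measurable (M \<Otimes>\<^sub>M baire). AE z in M \<Otimes>\<^sub>M \<mu>. F z = w z"
  have rect: "?Q (indicator (A \<times> B))" if A[measurable]: "A \<in> sets M" and B[measurable]: "B \<in> sets \<mu>" for A B
  proof -
    obtain v :: "'x \<Rightarrow> real" where v[measurable]: "v \<in> borel_measurable baire" and eq: "AE x in \<mu>. indicator B x = v x"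
      using baire_version[OF compact_space \<mu>.prob_space_axioms sets_\<mu> \<mu>_inner_regular
          \<mu>.square_integrable_indicator[OF B]] by auto
    have v'[measurable]: "v \<in> borel_measurable \<mu>"
      using measurable_compose[OF id_baire_measurable(1) v] by simp
    have "AE z in M \<Otimes>\<^sub>M \<mu>. indicator B (snd z) = v (snd z)"
    proof (rule P.AE_pair_measure)
      show "{z \<in> space (M \<Otimes>\<^sub>M \<mu>). indicator B (snd z) = v (snd z)} \<in> sets (M \<Otimes>\<^sub>M \<mu>)"
        by measurable
    qed (use eq in simp)
    then have "AE z in M \<Otimes>\<^sub>M \<mu>. indicator (A \<times> B) z = indicator A (fst z) * v (snd z)"
      by eventually_elim (simp add: indicator_times)
    moreover have "(\<lambda>z. indicator A (fst z) * v (snd z)) \<in> borel_measurable (M \<Otimes>\<^sub>M baire)" by measurable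
    ultimately show ?thesis by (intro bexI)
  qed
  show ?thesis
  proof (rule P.square_integrable_induct[where Q = ?Q, OF F Int_stable_pair_measure_generator[of M \<mu>]])
    show "{a \<times> b |a b. a \<in> sets M \<and> b \<in> sets \<mu>} \<subseteq> Pow (space (M \<Otimes>\<^sub>M \<mu>))"
      unfolding space_pair_measure by (rule pair_measure_closed)
    show "sets (M \<Otimes>\<^sub>M \<mu>) = sigma_sets (space (M \<Otimes>\<^sub>M \<mu>)) {a \<times> b |a b. a \<in> sets M \<and> b \<in> sets \<mu>}"
      unfolding space_pair_measure by (rule sets_pair_measure)
    show "?Q (indicator (space (M \<Otimes>\<^sub>M \<mu>)))"
      unfolding space_pair_measure by (rule rect) auto
    show "?Q (indicator A)" if "A \<in> {a \<times> b |a b. a \<in> sets M \<and> b \<in> sets \<mu>}" for A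
      using that rect by auto
  next
    fix u :: "'a \<times> 'x \<Rightarrow> real" and c assume "?Q u"
    then obtain w where [measurable]: "w \<in> borel_measurable (M \<Otimes>\<^sub>M baire)" and w: "AE z in M \<Otimes>\<^sub>M \<mu>. u z = w z"
      by blast
    have "AE z in M \<Otimes>\<^sub>M \<mu>. c * u z = c * w z" using w by eventually_elim simp
    then show "?Q (\<lambda>z. c * u z)" by (rule bexI[where x = "\<lambda>z. c * w z"]) measurable
  next
    fix u v :: "'a \<times> 'x \<Rightarrow> real" assume "?Q u" "?Q v"
    then obtain a b where [measurable]: "a \<in> borel_measurable (M \<Otimes>\<^sub>M baire)" "b \<in> borel_measurable (M \<Otimes>\<^sub>M baire)"
      and ab: "AE z in M \<Otimes>\<^sub>M \<mu>. u z = a z" "AE z in M \<Otimes>\<^sub>M \<mu>. v z = b z"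
      by blast
    have "AE z in M \<Otimes>\<^sub>M \<mu>. u z + v z = a z + b z" using ab by eventually_elim simp
    then show "?Q (\<lambda>z. u z + v z)" by (rule bexI[where x = "\<lambda>z. a z + b z"]) measurable
  next
    fix u :: "nat \<Rightarrow> 'a \<times> 'x \<Rightarrow> real" and v
    assume u: "\<And>n. square_integrable (M \<Otimes>\<^sub>M \<mu>) (u n)" "\<And>n. ?Q (u n)" "square_integrable (M \<Otimes>\<^sub>M \<mu>) v"
      "(\<lambda>n. \<integral>z. (u n z - v z)\<^sup>2 \<partial>(M \<Otimes>\<^sub>M \<mu>)) \<longlonglongrightarrow> 0"
    show "?Q v" by (rule L2_limit_version[OF u(1) u(3) u(4) u(2)])
  qed
qed

text \<open>The field is moved by an independent group element with Haar distribution, and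
  \<open>r\<close> is the covariance of the moved field. Isotropy keeps the quadratic form
  unchanged, while the averaging makes \<open>r\<close> finite and invariant at every pair of
  points.\<close>

theorem invariant_root_of_field:
  fixes w :: "'a \<times> 'x \<Rightarrow> real"
  assumes "prob_space M" and w[measurable]: "w \<in> borel_measurable (M \<Otimes>\<^sub>M baire)"
    and w2: "integrable (M \<Otimes>\<^sub>M \<mu>) (\<lambda>z. (w z)\<^sup>2)"
    and iso: "\<And>g h. square_integrable \<mu> h \<Longrightarrow>
      (\<integral>\<omega>. (\<integral>y. w (\<omega>, y) * h (act (- g) y) \<partial>\<mu>)\<^sup>2 \<partial>M) = (\<integral>\<omega>. (\<integral>y. w (\<omega>, y) * h y \<partial>\<mu>)\<^sup>2 \<partial>M)"
  obtains k where "(\<lambda>(x, y). k x y) \<in> borel_measurable (\<mu> \<Otimes>\<^sub>M \<mu>)"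
    and "\<And>g x y. k (act g x) (act g y) = k x y"
    and "\<And>x. square_integrable \<mu> (k x)"
    and "\<And>h. square_integrable \<mu> h \<Longrightarrow>
      (\<integral>y. (\<integral>x. h x * k x y \<partial>\<mu>)\<^sup>2 \<partial>\<mu>) = (\<integral>\<omega>. (\<integral>y. w (\<omega>, y) * h y \<partial>\<mu>)\<^sup>2 \<partial>M)"
proof -
  interpret M: prob_space M by fact
  interpret P: pair_prob_space M \<mu> ..
  interpret Z: pair_prob_space M \<nu> ..
  have wsec[measurable]: "(\<lambda>y. w (\<omega>, y)) \<in> borel_measurable baire" if "\<omega> \<in> space M" for \<omega>
    using that by measurable
  have wsec'[measurable]: "(\<lambda>y. w (\<omega>, y)) \<in> borel_measurable \<mu>" if "\<omega> \<in> space M" for \<omega>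
    using measurable_compose[OF id_baire_measurable(1) wsec[OF that]] by simp
  have wm[measurable]: "w \<in> borel_measurable (M \<Otimes>\<^sub>M \<mu>)"
  proof -
    have "(\<lambda>z. w (fst z, snd z)) \<in> borel_measurable (M \<Otimes>\<^sub>M \<mu>)" by measurable
    then show ?thesis by simp
  qed
  define \<tau> where "\<tau> x z = w (fst z, act (snd z) x)" for x z
  have \<tau>m[measurable]: "(\<lambda>(x, z). \<tau> x z) \<in> borel_measurable (\<mu> \<Otimes>\<^sub>M (M \<Otimes>\<^sub>M \<nu>))"
    unfolding \<tau>_def by measurable
  have \<tau>s[measurable]: "\<tau> x \<in> borel_measurable (M \<Otimes>\<^sub>M \<nu>)" for x
    unfolding \<tau>_def[abs_def] by measurable
  define B where "B = (\<integral>z. (w z)\<^sup>2 \<partial>(M \<Otimes>\<^sub>M \<mu>))"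
  have B0: "0 \<le> B" by (simp add: B_def)
  \<comment> \<open>Averaging over the group spreads each point over the whole space, so every point
    has the same second moment, the total one. For \<open>w\<close> itself the second moment could
    be infinite at particular points.\<close>
  have nn: "(\<integral>\<^sup>+z. ennreal ((\<tau> x z)\<^sup>2) \<partial>(M \<Otimes>\<^sub>M \<nu>)) = ennreal B" for x
  proof -
    have "(\<integral>\<^sup>+z. ennreal ((\<tau> x z)\<^sup>2) \<partial>(M \<Otimes>\<^sub>M \<nu>)) = (\<integral>\<^sup>+\<omega>. \<integral>\<^sup>+g. ennreal ((w (\<omega>, act g x))\<^sup>2) \<partial>\<nu> \<partial>M)"
      by (subst \<nu>.nn_integral_fst[symmetric]) (auto simp: \<tau>_def)
    also have "\<dots> = (\<integral>\<^sup>+\<omega>. \<integral>\<^sup>+y. ennreal ((w (\<omega>, y))\<^sup>2) \<partial>distr \<nu> baire (\<lambda>g. act g x) \<partial>M)"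
      by (intro nn_integral_cong nn_integral_distr[symmetric]) auto
    also have "\<dots> = (\<integral>\<^sup>+\<omega>. \<integral>\<^sup>+y. ennreal ((w (\<omega>, y))\<^sup>2) \<partial>\<mu> \<partial>M)"
      unfolding orbit_map_distr_baire by (intro nn_integral_cong nn_integral_distr) auto
    also have "\<dots> = (\<integral>\<^sup>+z. ennreal ((w z)\<^sup>2) \<partial>(M \<Otimes>\<^sub>M \<mu>))"
      by (subst \<mu>.nn_integral_fst) auto
    also have "\<dots> = ennreal B"
      unfolding B_def by (rule nn_integral_eq_integral[OF w2]) simp
    finally show ?thesis .
  qed
  note \<tau>sq = square_integrable_if_nn_integral[OF \<tau>s eq_refl[OF nn] B0]
  define r where "r x y = (\<integral>z. \<tau> x z * \<tau> y z \<partial>(M \<Otimes>\<^sub>M \<nu>))" for x y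
  have rm[measurable]: "(\<lambda>(x, y). r x y) \<in> borel_measurable (\<mu> \<Otimes>\<^sub>M \<mu>)"
    unfolding r_def by measurable
  have rle: "\<bar>r x y\<bar> \<le> B" for x y
  proof -
    have "(r x y)\<^sup>2 \<le> (\<integral>z. (\<tau> x z)\<^sup>2 \<partial>(M \<Otimes>\<^sub>M \<nu>)) * (\<integral>z. (\<tau> y z)\<^sup>2 \<partial>(M \<Otimes>\<^sub>M \<nu>))"
      unfolding r_def by (rule square_integrable_cauchy_schwarz[OF \<tau>sq(1) \<tau>sq(1)])
    also have "\<dots> \<le> B * B" by (intro mult_mono \<tau>sq(2)) (auto simp: B0)
    finally show ?thesis using B0 by (simp add: power2_eq_square[symmetric] abs_le_square_iff[of "r x y" B, symmetric])
  qed
  \<comment> \<open>Acting by h on the points is a right translation by h of the group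
    variable.\<close>
  have rinv: "r (act h x) (act h y) = r x y" for h x y
  proof -
    define G where "G \<omega> g = w (\<omega>, act g x) * w (\<omega>, act g y)" for \<omega> g
    have Gm: "G \<omega> \<in> borel_measurable baire" if "\<omega> \<in> space M" for \<omega>
    proof -
      have [measurable]: "(\<lambda>g :: 'g. act g x) \<in> measurable baire baire" for x
        by (intro continuous_measurable_baire continuous_intros)
      show ?thesis unfolding G_def[abs_def] using that by measurable
    qed
    have int: "integrable (M \<Otimes>\<^sub>M \<nu>) (\<lambda>(\<omega>, g). w (\<omega>, act g x) * w (\<omega>, act g y))" for x y
      using square_integrable_mult_integrable[OF \<tau>sq(1)[of x] \<tau>sq(1)[of y]]
      by (simp add: \<tau>_def case_prod_unfold)
    have r_eq: "r x y = (\<integral>\<omega>. \<integral>g. w (\<omega>, act g x) * w (\<omega>, act g y) \<partial>\<nu> \<partial>M)" for x y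
      using Z.integral_fst[OF int] by (simp add: r_def \<tau>_def case_prod_unfold)
    have "r (act h x) (act h y) = (\<integral>\<omega>. \<integral>g. G \<omega> (g + h) \<partial>\<nu> \<partial>M)"
      by (simp add: r_eq G_def act_add)
    also have "\<dots> = (\<integral>\<omega>. \<integral>g. G \<omega> g \<partial>distr \<nu> baire (\<lambda>g. g + h) \<partial>M)"
      by (intro Bochner_Integration.integral_cong refl integral_distr[symmetric] Gm) auto
    also have "\<dots> = (\<integral>\<omega>. \<integral>g. G \<omega> g \<partial>\<nu> \<partial>M)"
      unfolding haar_right_invariant_baire
      by (intro Bochner_Integration.integral_cong refl integral_distr Gm) auto
    also have "\<dots> = r x y" by (simp add: r_eq G_def)
    finally show ?thesis .
  qed
  note pairing = L2_field_pairing[OF \<mu>.prob_space_axioms Z.prob_space_axioms \<tau>m \<tau>sq]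
  define Th where "Th h z = (\<integral>x. h x * \<tau> x z \<partial>\<mu>)" for h z
  have Thsq: "square_integrable (M \<Otimes>\<^sub>M \<nu>) (Th h)" if "square_integrable \<mu> h" for h
    unfolding Th_def[abs_def] by (rule pairing(3)[OF that])
  have rTh: "(\<integral>y. r x y * h y \<partial>\<mu>) = (\<integral>z. \<tau> x z * Th h z \<partial>(M \<Otimes>\<^sub>M \<nu>))" if "square_integrable \<mu> h" for h x
    using pairing(5)[OF that \<tau>sq(1)[of x]] by (simp add: r_def Th_def mult.commute)
  have form: "(\<integral>x. h x * (\<integral>y. r x y * h y \<partial>\<mu>) \<partial>\<mu>) = (\<integral>z. (Th h z)\<^sup>2 \<partial>(M \<Otimes>\<^sub>M \<nu>))"
    if "square_integrable \<mu> h" for h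
    using pairing(5)[OF that Thsq[OF that]] by (simp add: rTh[OF that] Th_def power2_eq_square)
  \<comment> \<open>For each fixed g the field moved by g is paired with \<open>h\<close> as the
    original one is with a translate of \<open>h\<close>, so isotropy makes the inner expectation
    constant in g.\<close>
  have form': "(\<integral>z. (Th h z)\<^sup>2 \<partial>(M \<Otimes>\<^sub>M \<nu>)) = (\<integral>\<omega>. (\<integral>y. w (\<omega>, y) * h y \<partial>\<mu>)\<^sup>2 \<partial>M)"
    if h: "square_integrable \<mu> h" for h
  proof -
    have hm[measurable]: "h \<in> borel_measurable \<mu>" using h by blast
    have inner: "(\<integral>\<omega>. (Th h (\<omega>, g))\<^sup>2 \<partial>M) = (\<integral>\<omega>. (\<integral>y. w (\<omega>, y) * h y \<partial>\<mu>)\<^sup>2 \<partial>M)" for g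
    proof -
      have "Th h (\<omega>, g) = (\<integral>y. w (\<omega>, y) * h (act (- g) y) \<partial>\<mu>)" if "\<omega> \<in> space M" for \<omega>
      proof -
        have "(\<lambda>y. w (\<omega>, y) * h (act (- g) y)) \<in> borel_measurable \<mu>"
          using wsec'[OF that] by measurable
        from integral_translate[OF this, of g] show ?thesis
          by (simp add: Th_def \<tau>_def mult.commute)
      qed
      then show ?thesis using iso[OF h, of g] by (simp cong: Bochner_Integration.integral_cong)
    qed
    have "integrable (M \<Otimes>\<^sub>M \<nu>) (\<lambda>(\<omega>, g). (Th h (\<omega>, g))\<^sup>2)"
      using Thsq[OF h] by (simp add: square_integrable_real case_prod_unfold)
    from Z.Fubini_integral[OF this] Z.integral_fst[OF this]
    have "(\<integral>z. (Th h z)\<^sup>2 \<partial>(M \<Otimes>\<^sub>M \<nu>)) = (\<integral>g. \<integral>\<omega>. (Th h (\<omega>, g))\<^sup>2 \<partial>M \<partial>\<nu>)"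
      by (simp add: case_prod_unfold)
    then show ?thesis using \<nu>.prob_space by (simp add: inner)
  qed
  \<comment> \<open>Adding 1 keeps the normalisation possible for a vanishing field.\<close>
  define b where "b = B + 1"
  have b: "0 < b" "B \<le> b" using B0 by (auto simp: b_def)
  have dom: "dominated_kernel \<mu> (\<lambda>x y. r x y / b)"
  proof
    show "r x y / b = r y x / b" for x y by (simp add: r_def mult.commute)
    show "\<bar>r x y / b\<bar> \<le> 1" for x y using rle[of x y] b by (simp add: abs_divide)
    \<comment> \<open>Both sides are inner products over the probability space and the group: the
      left integral is <\<tau> x, Th h> / b, and the right-hand side is ||Th h||^2 / b.\<close>
    show "(\<integral>y. r x y / b * h y \<partial>\<mu>)\<^sup>2 \<le> (\<integral>y. h y * (\<integral>z. r y z / b * h z \<partial>\<mu>) \<partial>\<mu>)"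
      if h: "square_integrable \<mu> h" for h x
    proof -
      let ?N = "\<integral>z. (Th h z)\<^sup>2 \<partial>(M \<Otimes>\<^sub>M \<nu>)"
      have "(\<integral>y. r x y * h y \<partial>\<mu>)\<^sup>2 \<le> (\<integral>z. (\<tau> x z)\<^sup>2 \<partial>(M \<Otimes>\<^sub>M \<nu>)) * ?N"
        unfolding rTh[OF h] by (rule square_integrable_cauchy_schwarz[OF \<tau>sq(1) Thsq[OF h]])
      also have "\<dots> \<le> b * ?N" using \<tau>sq(2)[of x] b by (intro mult_right_mono) auto
      finally have "(\<integral>y. r x y * h y \<partial>\<mu>)\<^sup>2 / b\<^sup>2 \<le> b * ?N / b\<^sup>2" by (rule divide_right_mono) simp
      then show ?thesis using b form[OF h] by (simp add: power_divide power2_eq_square)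
    qed
  qed (use rm in auto)
  interpret D: dominated_kernel \<mu> "\<lambda>x y. r x y / b" by (rule dom)
  have G1: "s \<in> measurable \<mu> \<mu>" "distr \<mu> \<mu> s = \<mu>" "r (s x) (s y) / b = r x y / b" if "s \<in> range act" for s x y
    using that by (auto simp: \<mu>_invariant rinv)
  have G2: "\<exists>s\<in>range act. s x0 = x" for x using exists_group_element by blast
  obtain k where k: "(\<lambda>(x, y). k x y) \<in> borel_measurable (\<mu> \<Otimes>\<^sub>M \<mu>)"
    "\<And>s x y. s \<in> range act \<Longrightarrow> k (s x) (s y) = k x y" "\<And>x. square_integrable \<mu> (k x)"
    "\<And>h. square_integrable \<mu> h \<Longrightarrow>
      (\<integral>y. (\<integral>x. h x * k x y \<partial>\<mu>)\<^sup>2 \<partial>\<mu>) = (\<integral>x. h x * (\<integral>y. r x y / b * h y \<partial>\<mu>) \<partial>\<mu>)"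
    by (rule D.invariant_root[OF G1 G2]) auto
  show thesis
  \<comment> \<open>The root of r / b is scaled back by the square root of b.\<close>
  proof (rule that[of "\<lambda>x y. sqrt b * k x y"])
    show "(\<lambda>(x, y). sqrt b * k x y) \<in> borel_measurable (\<mu> \<Otimes>\<^sub>M \<mu>)" using k(1) by measurable
    show "sqrt b * k (act g x) (act g y) = sqrt b * k x y" for g x y by (simp add: k(2))
    show "square_integrable \<mu> (\<lambda>y. sqrt b * k x y)" for x by (rule square_integrable_cmult[OF k(3)])
    show "(\<integral>y. (\<integral>x. h x * (sqrt b * k x y) \<partial>\<mu>)\<^sup>2 \<partial>\<mu>) = (\<integral>\<omega>. (\<integral>y. w (\<omega>, y) * h y \<partial>\<mu>)\<^sup>2 \<partial>M)"
      if h: "square_integrable \<mu> h" for h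
    proof -
      have "(\<integral>y. (\<integral>x. h x * (sqrt b * k x y) \<partial>\<mu>)\<^sup>2 \<partial>\<mu>) = b * (\<integral>y. (\<integral>x. h x * k x y \<partial>\<mu>)\<^sup>2 \<partial>\<mu>)"
        using b(1) by (simp add: mult.left_commute[of _ "sqrt b"] power_mult_distrib)
      also have "\<dots> = (\<integral>x. h x * (\<integral>y. r x y * h y \<partial>\<mu>) \<partial>\<mu>)"
        using k(4)[OF h] b by simp
      finally show ?thesis by (simp add: form[OF h] form'[OF h])
    qed
  qed
qed

end

section \<open>White noise\<close>

lemma orthonormal_inner:
  fixes e :: "'i \<Rightarrow> 'x \<Rightarrow> real"
  assumes "finite F" "\<And>i. i \<in> F \<Longrightarrow> square_integrable M (e i)"
    and "\<And>i j. i \<in> F \<Longrightarrow> j \<in> F \<Longrightarrow> (\<integral>x. e i x * e j x \<partial>M) = (if i = j then 1 else 0)"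
  shows "(\<integral>x. (\<Sum>i\<in>F. a i * e i x) * (\<Sum>i\<in>F. b i * e i x) \<partial>M) = (\<Sum>i\<in>F. a i * b i)"
proof -
  have "(\<integral>x. (\<Sum>i\<in>F. a i * e i x) * (\<Sum>i\<in>F. b i * e i x) \<partial>M) =
      (\<integral>x. (\<Sum>i\<in>F. \<Sum>j\<in>F. a i * b j * (e i x * e j x)) \<partial>M)"
    unfolding sum_product by (simp add: mult_ac)
  also have "\<dots> = (\<Sum>i\<in>F. \<Sum>j\<in>F. a i * b j * (\<integral>x. e i x * e j x \<partial>M))"
    using assms(2) by (simp add: square_integrable_mult_integrable)
  also have "\<dots> = (\<Sum>i\<in>F. \<Sum>j\<in>F. if i = j then a i * b j else 0)"
    by (intro sum.cong refl) (simp add: assms(3))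
  also have "\<dots> = (\<Sum>i\<in>F. a i * b i)"
    using assms(1) by (intro sum.cong refl) simp
  finally show ?thesis .
qed

lemma iexp_diff_le: "cmod (iexp a - iexp b) \<le> \<bar>a - b\<bar>"
proof -
  have "iexp a - iexp b = iexp b * (iexp (a - b) - 1)"
    by (simp add: algebra_simps flip: exp_add)
  then have "cmod (iexp a - iexp b) = cmod (iexp (a - b) - 1)"
    by (simp add: norm_mult)
  also have "\<dots> \<le> \<bar>a - b\<bar>"
    using iexp_approx1[of "a - b" 0] by simp
  finally show ?thesis .
qed

text \<open>A Lipschitz bound in mean square, suited to limits along the net of finite subsets, for
  which dominated convergence of sequences does not serve.\<close>

lemma (in prob_space) iexp_expectation_diff_le:
  fixes a b :: "'a \<Rightarrow> real"
  assumes "square_integrable M a" "square_integrable M b"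
  shows "cmod ((\<integral>x. iexp (a x) \<partial>M) - (\<integral>x. iexp (b x) \<partial>M)) \<le> sqrt (\<integral>x. (a x - b x)\<^sup>2 \<partial>M)"
proof -
  have [measurable]: "a \<in> borel_measurable M" "b \<in> borel_measurable M" using assms by auto
  note d = square_integrable_diff[OF assms]
  have i: "integrable M (\<lambda>x. iexp (a x))" "integrable M (\<lambda>x. iexp (b x))"
    by (intro integrable_const_bound[where B = 1] AE_I2; simp)+
  have "cmod ((\<integral>x. iexp (a x) \<partial>M) - (\<integral>x. iexp (b x) \<partial>M)) = cmod (\<integral>x. iexp (a x) - iexp (b x) \<partial>M)"
    using i by simp
  also have "\<dots> \<le> (\<integral>x. \<bar>a x - b x\<bar> \<partial>M)"
    using square_integrable_integrable[OF d] i iexp_diff_le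
    by (intro order_trans[OF integral_norm_bound] integral_mono) auto
  also have "\<dots> \<le> sqrt (\<integral>x. (a x - b x)\<^sup>2 \<partial>M)"
  proof (rule real_le_rsqrt)
    have "square_integrable M (\<lambda>x. \<bar>a x - b x\<bar>)" using d by (simp add: square_integrable_real)
    from square_integrable_cauchy_schwarz[OF this, of "\<lambda>_. 1"]
    show "(\<integral>x. \<bar>a x - b x\<bar> \<partial>M)\<^sup>2 \<le> (\<integral>x. (a x - b x)\<^sup>2 \<partial>M)"
      by (simp add: square_integrable_real prob_space)
  qed
  finally show ?thesis .
qed

lemma (in prob_space) std_normal_facts:
  assumes D: "distributed M lborel Y std_normal_density"
  shows "square_integrable M Y" "(\<integral>x. Y x \<partial>M) = 0" "(\<integral>x. (Y x)\<^sup>2 \<partial>M) = 1"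
    "char (distr M borel Y) t = exp (- (t\<^sup>2) / 2)"
proof -
  have Ym[measurable]: "Y \<in> borel_measurable M" using distributed_measurable[OF D] by simp
  have "integrable lborel (\<lambda>x. std_normal_density x * x ^ 2)"
    using std_normal_moment_even[of 1] by (auto simp: has_bochner_integral_iff)
  then have "integrable M (\<lambda>x. (Y x)\<^sup>2)"
    using distributed_integrable[OF D, of "\<lambda>x. x\<^sup>2"] by simp
  then show "square_integrable M Y" by (simp add: square_integrable_real)
  show m: "(\<integral>x. Y x \<partial>M) = 0" by (rule standard_normal_distributed_expectation[OF D])
  have "(\<integral>x. (Y x)\<^sup>2 \<partial>M) = variance Y" by (simp add: m)
  also have "\<dots> = 1" by (rule standard_normal_distributed_variance[OF D])
  finally show "(\<integral>x. (Y x)\<^sup>2 \<partial>M) = 1" .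
  have "distr M borel Y = density lborel std_normal_density"
    using distributed_distr_eq_density[OF D] by (metis distr_cong sets_lborel)
  then show "char (distr M borel Y) t = exp (- (t\<^sup>2) / 2)"
    using char_std_normal_distribution by (simp add: fun_eq_iff of_real_exp)
qed

lemma char_distr:
  assumes [measurable]: "Y \<in> borel_measurable M"
  shows "char (distr M borel Y) t = (\<integral>x. iexp (t * Y x) \<partial>M)"
  unfolding char_def by (subst integral_distr) auto

text \<open>Finite partial sums over the basis have the same inner products on both sides, because
  the \<open>X i\<close> are orthonormal as well, and their characteristic functions factor by
  independence. Everything then passes to the limit along finite subsets of
  \<open>I\<close>.\<close>

lemma white_noise_real_part:
  fixes \<mu> :: "'x measure" and N :: "'w measure" and e :: "'i \<Rightarrow> 'x \<Rightarrow> real"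
  assumes wn: "white_noise N \<mu> I e X S"
  defines "\<sigma> \<equiv> \<lambda>\<phi> \<omega>. Re (S (\<lambda>x. complex_of_real (\<phi> x)) \<omega>)"
  shows "\<And>\<phi>. square_integrable \<mu> \<phi> \<Longrightarrow> square_integrable N (\<sigma> \<phi>)"
    and "\<And>\<phi>. square_integrable \<mu> \<phi> \<Longrightarrow> AE \<omega> in N. S (\<lambda>x. complex_of_real (\<phi> x)) \<omega> = complex_of_real (\<sigma> \<phi> \<omega>)"
    and "\<And>\<phi> \<psi>. square_integrable \<mu> \<phi> \<Longrightarrow> square_integrable \<mu> \<psi> \<Longrightarrow>
      (\<integral>\<omega>. \<sigma> \<phi> \<omega> * \<sigma> \<psi> \<omega> \<partial>N) = (\<integral>x. \<phi> x * \<psi> x \<partial>\<mu>)"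
    and "\<And>\<phi>. square_integrable \<mu> \<phi> \<Longrightarrow>
      (\<integral>\<omega>. iexp (\<sigma> \<phi> \<omega>) \<partial>N) = exp (- complex_of_real (\<integral>x. (\<phi> x)\<^sup>2 \<partial>\<mu>) / 2)"
proof -
  interpret N: prob_space N using wn by (simp add: white_noise_def)
  have e: "\<And>i. i \<in> I \<Longrightarrow> square_integrable \<mu> (e i)"
    "\<And>i j. i \<in> I \<Longrightarrow> j \<in> I \<Longrightarrow> (\<integral>x. e i x * e j x \<partial>\<mu>) = (if i = j then 1 else 0)"
    "\<And>\<phi>. square_integrable \<mu> \<phi> \<Longrightarrow> L2_has_sum \<mu> I (\<lambda>i x. (\<integral>y. \<phi> y * e i y \<partial>\<mu>) * e i x) \<phi>"
    using wn by (auto simp: white_noise_def real_orthonormal_basis_def)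
  have X: "N.indep_vars (\<lambda>_. borel) X I" "\<And>i. i \<in> I \<Longrightarrow> distributed N lborel (X i) std_normal_density"
    using wn by (auto simp: white_noise_def)
  have Xsq: "square_integrable N (X i)" if "i \<in> I" for i by (rule N.std_normal_facts(1)[OF X(2)[OF that]])
  have Xon: "(\<integral>\<omega>. X i \<omega> * X j \<omega> \<partial>N) = (if i = j then 1 else 0)" if ij: "i \<in> I" "j \<in> I" for i j
  proof (cases "i = j")
    case True
    then show ?thesis using N.std_normal_facts(3)[OF X(2)[OF ij(1)]] by (simp add: power2_eq_square)
  next
    case False
    have "(\<integral>\<omega>. (\<Prod>l\<in>{i, j}. X l \<omega>) \<partial>N) = (\<Prod>l\<in>{i, j}. \<integral>\<omega>. X l \<omega> \<partial>N)"
      using ij by (intro N.indep_vars_lebesgue_integral N.indep_vars_subset[OF X(1)])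
        (auto intro: N.square_integrable_integrable Xsq)
    then show ?thesis using False ij N.std_normal_facts(2)[OF X(2)] by simp
  qed
  have Ssum: "L2_has_sum N I (\<lambda>i \<omega>. complex_of_real ((\<integral>y. \<phi> y * e i y \<partial>\<mu>) * X i \<omega>)) (S (\<lambda>x. complex_of_real (\<phi> x)))"
    and Sm: "S (\<lambda>x. complex_of_real (\<phi> x)) \<in> borel_measurable N" if "square_integrable \<mu> \<phi>" for \<phi>
  proof -
    show "L2_has_sum N I (\<lambda>i \<omega>. complex_of_real ((\<integral>y. \<phi> y * e i y \<partial>\<mu>) * X i \<omega>)) (S (\<lambda>x. complex_of_real (\<phi> x)))"
      using wn that by (simp add: white_noise_def)
    have [measurable]: "\<phi> \<in> borel_measurable \<mu>" using that by blast
    have "(\<lambda>x. complex_of_real (\<phi> x)) \<in> borel_measurable \<mu>" by measurable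
    then have "square_integrable \<mu> (\<lambda>x. complex_of_real (\<phi> x))" using that by (simp add: square_integrable_def)
    then show "S (\<lambda>x. complex_of_real (\<phi> x)) \<in> borel_measurable N" using wn by (simp add: white_noise_def)
  qed
  define c where "c \<phi> i = (\<integral>y. \<phi> y * e i y \<partial>\<mu>)" for \<phi> i
  \<comment> \<open>Intersecting with \<open>I\<close> makes the sums square integrable for every
    index set F, as \<open>L2_inner_tendsto\<close> demands, and changes nothing along the
    filter.\<close>
  define G where "G \<phi> F \<omega> = (\<Sum>i\<in>F \<inter> I. c \<phi> i * X i \<omega>)" for \<phi> F \<omega>
  define P where "P \<phi> F x = (\<Sum>i\<in>F \<inter> I. c \<phi> i * e i x)" for \<phi> F x
  have Gsq: "square_integrable N (G \<phi> F)" and Psq: "square_integrable \<mu> (P \<phi> F)" for \<phi> F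
    unfolding G_def[abs_def] P_def[abs_def]
    by (auto intro!: square_integrable_sum square_integrable_cmult Xsq e)
  let ?\<F> = "finite_subsets_at_top I"
  have ev: "eventually (\<lambda>F. finite F \<and> F \<subseteq> I) ?\<F>"
    by (rule eventually_finite_subsets_at_top_weakI) auto
  have lim\<mu>: "((\<lambda>F. \<integral>x. (\<phi> x - P \<phi> F x)\<^sup>2 \<partial>\<mu>) \<longlongrightarrow> 0) ?\<F>" if \<phi>: "square_integrable \<mu> \<phi>" for \<phi>
  proof -
    have "((\<lambda>F. \<integral>\<^sup>+x. ennreal ((norm (\<phi> x - (\<Sum>i\<in>F. c \<phi> i * e i x)))\<^sup>2) \<partial>\<mu>) \<longlongrightarrow> ennreal 0) ?\<F>"
      using e(3)[OF \<phi>] by (simp add: L2_has_sum_def c_def)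
    moreover have "eventually (\<lambda>F. (\<integral>\<^sup>+x. ennreal ((norm (\<phi> x - (\<Sum>i\<in>F. c \<phi> i * e i x)))\<^sup>2) \<partial>\<mu>) =
        ennreal (\<integral>x. (\<phi> x - P \<phi> F x)\<^sup>2 \<partial>\<mu>)) ?\<F>"
      using ev
    proof eventually_elim
      case (elim F)
      then show ?case
        using nn_integral_square_integrable[OF square_integrable_diff[OF \<phi> Psq], of \<phi> F]
        by (simp add: P_def Int_absorb2)
    qed
    ultimately have "((\<lambda>F. ennreal (\<integral>x. (\<phi> x - P \<phi> F x)\<^sup>2 \<partial>\<mu>)) \<longlongrightarrow> ennreal 0) ?\<F>"
      by (rule Lim_transform_eventually)
    then show ?thesis by (subst (asm) tendsto_ennreal_iff) auto
  qed
  have S0: "((\<lambda>F. \<integral>\<^sup>+\<omega>. ennreal ((norm (S (\<lambda>x. complex_of_real (\<phi> x)) \<omega> - complex_of_real (G \<phi> F \<omega>)))\<^sup>2) \<partial>N) \<longlongrightarrow> 0) ?\<F>"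
    if \<phi>: "square_integrable \<mu> \<phi>" for \<phi>
  proof (rule Lim_transform_eventually)
    show "((\<lambda>F. \<integral>\<^sup>+\<omega>. ennreal ((norm (S (\<lambda>x. complex_of_real (\<phi> x)) \<omega> -
        (\<Sum>i\<in>F. complex_of_real (c \<phi> i * X i \<omega>))))\<^sup>2) \<partial>N) \<longlongrightarrow> 0) ?\<F>"
      using Ssum[OF \<phi>] by (simp add: L2_has_sum_def c_def)
    show "\<forall>\<^sub>F F in ?\<F>. (\<integral>\<^sup>+\<omega>. ennreal ((norm (S (\<lambda>x. complex_of_real (\<phi> x)) \<omega> -
        (\<Sum>i\<in>F. complex_of_real (c \<phi> i * X i \<omega>))))\<^sup>2) \<partial>N) =
      (\<integral>\<^sup>+\<omega>. ennreal ((norm (S (\<lambda>x. complex_of_real (\<phi> x)) \<omega> - complex_of_real (G \<phi> F \<omega>)))\<^sup>2) \<partial>N)"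
      using ev by eventually_elim (simp add: G_def Int_absorb2)
  qed
  have \<sigma>m[measurable]: "\<sigma> \<phi> \<in> borel_measurable N" if "square_integrable \<mu> \<phi>" for \<phi>
    unfolding \<sigma>_def using Sm[OF that] by measurable
  have nn\<sigma>: "((\<lambda>F. \<integral>\<^sup>+\<omega>. ennreal ((\<sigma> \<phi> \<omega> - G \<phi> F \<omega>)\<^sup>2) \<partial>N) \<longlongrightarrow> 0) ?\<F>" if \<phi>: "square_integrable \<mu> \<phi>" for \<phi>
  proof (rule tendsto_sandwich[OF _ _ tendsto_const S0[OF \<phi>]])
    show "\<forall>\<^sub>F F in ?\<F>. (\<integral>\<^sup>+\<omega>. ennreal ((\<sigma> \<phi> \<omega> - G \<phi> F \<omega>)\<^sup>2) \<partial>N) \<le>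
      (\<integral>\<^sup>+\<omega>. ennreal ((norm (S (\<lambda>x. complex_of_real (\<phi> x)) \<omega> - complex_of_real (G \<phi> F \<omega>)))\<^sup>2) \<partial>N)"
    proof (intro always_eventually allI nn_integral_mono ennreal_leI)
      show "(\<sigma> \<phi> \<omega> - G \<phi> F \<omega>)\<^sup>2 \<le> (norm (S (\<lambda>x. complex_of_real (\<phi> x)) \<omega> - complex_of_real (G \<phi> F \<omega>)))\<^sup>2" for F \<omega>
        by (simp add: \<sigma>_def cmod_power2)
    qed
  qed simp
  show \<sigma>sq: "square_integrable N (\<sigma> \<phi>)" if \<phi>: "square_integrable \<mu> \<phi>" for \<phi>
  proof -
    \<comment> \<open>One partial sum at finite distance is enough, as it is square integrable
      itself.\<close>
    obtain F where F: "(\<integral>\<^sup>+\<omega>. ennreal ((\<sigma> \<phi> \<omega> - G \<phi> F \<omega>)\<^sup>2) \<partial>N) < ennreal 1"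
      using eventually_happens'[OF finite_subsets_at_top_neq_bot order_tendstoD(2)[OF nn\<sigma>[OF \<phi>], of "ennreal 1"]] by auto
    have "square_integrable N (\<lambda>\<omega>. (\<sigma> \<phi> \<omega> - G \<phi> F \<omega>) + G \<phi> F \<omega>)"
      by (intro square_integrable_add Gsq square_integrable_if_nn_integral(1)[OF _ less_imp_le[OF F]])
         (use \<sigma>m[OF \<phi>] square_integrable_measurable[OF Gsq] in auto)
    then show ?thesis by simp
  qed
  have lim\<sigma>: "((\<lambda>F. \<integral>\<omega>. (\<sigma> \<phi> \<omega> - G \<phi> F \<omega>)\<^sup>2 \<partial>N) \<longlongrightarrow> 0) ?\<F>" if \<phi>: "square_integrable \<mu> \<phi>" for \<phi>
  proof -
    have "((\<lambda>F. ennreal (\<integral>\<omega>. (\<sigma> \<phi> \<omega> - G \<phi> F \<omega>)\<^sup>2 \<partial>N)) \<longlongrightarrow> ennreal 0) ?\<F>"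
      using nn\<sigma>[OF \<phi>] by (simp add: nn_integral_square_integrable[OF square_integrable_diff[OF \<sigma>sq[OF \<phi>] Gsq]])
    then show ?thesis by (subst (asm) tendsto_ennreal_iff) auto
  qed
  show "AE \<omega> in N. S (\<lambda>x. complex_of_real (\<phi> x)) \<omega> = complex_of_real (\<sigma> \<phi> \<omega>)"
    if \<phi>: "square_integrable \<mu> \<phi>" for \<phi>
  proof -
    let ?im = "\<lambda>\<omega>. Im (S (\<lambda>x. complex_of_real (\<phi> x)) \<omega>)"
    have [measurable]: "?im \<in> borel_measurable N" using Sm[OF \<phi>] by measurable
    \<comment> \<open>The partial sums are real, so the imaginary part is bounded by the distance to
      each of them.\<close>
    have "(\<integral>\<^sup>+\<omega>. ennreal ((?im \<omega>)\<^sup>2) \<partial>N) \<le> 0"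
    proof (rule tendsto_lowerbound[OF S0[OF \<phi>]])
      show "\<forall>\<^sub>F F in ?\<F>. (\<integral>\<^sup>+\<omega>. ennreal ((?im \<omega>)\<^sup>2) \<partial>N) \<le>
        (\<integral>\<^sup>+\<omega>. ennreal ((norm (S (\<lambda>x. complex_of_real (\<phi> x)) \<omega> - complex_of_real (G \<phi> F \<omega>)))\<^sup>2) \<partial>N)"
        by (intro always_eventually allI nn_integral_mono ennreal_leI) (simp add: cmod_power2)
    qed simp
    then have "AE \<omega> in N. ennreal ((?im \<omega>)\<^sup>2) = 0"
      by (subst (asm) le_zero_eq, subst (asm) nn_integral_0_iff_AE) auto
    then show ?thesis by eventually_elim (simp add: \<sigma>_def complex_eq_iff)
  qed
  have finI: "finite (F \<inter> I)" if "finite F" for F using that by simp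
  show "(\<integral>\<omega>. \<sigma> \<phi> \<omega> * \<sigma> \<psi> \<omega> \<partial>N) = (\<integral>x. \<phi> x * \<psi> x \<partial>\<mu>)"
    if sq: "square_integrable \<mu> \<phi>" "square_integrable \<mu> \<psi>" for \<phi> \<psi>
  proof (rule tendsto_unique[OF finite_subsets_at_top_neq_bot])
    show "((\<lambda>F. \<integral>\<omega>. G \<phi> F \<omega> * G \<psi> F \<omega> \<partial>N) \<longlongrightarrow> (\<integral>\<omega>. \<sigma> \<phi> \<omega> * \<sigma> \<psi> \<omega> \<partial>N)) ?\<F>"
      by (intro L2_inner_tendsto Gsq \<sigma>sq lim\<sigma> sq)
    have "((\<lambda>F. \<integral>x. P \<phi> F x * P \<psi> F x \<partial>\<mu>) \<longlongrightarrow> (\<integral>x. \<phi> x * \<psi> x \<partial>\<mu>)) ?\<F>"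
      by (intro L2_inner_tendsto Psq lim\<mu> sq)
    then show "((\<lambda>F. \<integral>\<omega>. G \<phi> F \<omega> * G \<psi> F \<omega> \<partial>N) \<longlongrightarrow> (\<integral>x. \<phi> x * \<psi> x \<partial>\<mu>)) ?\<F>"
    proof (rule Lim_transform_eventually)
      show "\<forall>\<^sub>F F in ?\<F>. (\<integral>x. P \<phi> F x * P \<psi> F x \<partial>\<mu>) = (\<integral>\<omega>. G \<phi> F \<omega> * G \<psi> F \<omega> \<partial>N)"
        using ev
      proof eventually_elim
        case (elim F)
        then have "finite (F \<inter> I)" by simp
        then show ?case unfolding P_def G_def
          using orthonormal_inner[of "F \<inter> I" \<mu> e] orthonormal_inner[of "F \<inter> I" N X] e Xsq Xon by simp
      qed
    qed
  qed
  show "(\<integral>\<omega>. iexp (\<sigma> \<phi> \<omega>) \<partial>N) = exp (- complex_of_real (\<integral>x. (\<phi> x)\<^sup>2 \<partial>\<mu>) / 2)"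
    if \<phi>: "square_integrable \<mu> \<phi>" for \<phi>
  proof (rule tendsto_unique[OF finite_subsets_at_top_neq_bot])
    have "((\<lambda>F. sqrt (\<integral>\<omega>. (\<sigma> \<phi> \<omega> - G \<phi> F \<omega>)\<^sup>2 \<partial>N)) \<longlongrightarrow> sqrt 0) ?\<F>"
      by (intro tendsto_intros lim\<sigma> \<phi>)
    then have "((\<lambda>F. (\<integral>\<omega>. iexp (\<sigma> \<phi> \<omega>) \<partial>N) - (\<integral>\<omega>. iexp (G \<phi> F \<omega>) \<partial>N)) \<longlongrightarrow> 0) ?\<F>"
      by (intro Lim_null_comparison[OF always_eventually[OF allI[OF N.iexp_expectation_diff_le[OF \<sigma>sq[OF \<phi>] Gsq]]]]) simp
    from tendsto_diff[OF tendsto_const[of "\<integral>\<omega>. iexp (\<sigma> \<phi> \<omega>) \<partial>N"] this]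
    show "((\<lambda>F. \<integral>\<omega>. iexp (G \<phi> F \<omega>) \<partial>N) \<longlongrightarrow> (\<integral>\<omega>. iexp (\<sigma> \<phi> \<omega>) \<partial>N)) ?\<F>" by simp
    have "((\<lambda>F. \<integral>x. P \<phi> F x * P \<phi> F x \<partial>\<mu>) \<longlongrightarrow> (\<integral>x. \<phi> x * \<phi> x \<partial>\<mu>)) ?\<F>"
      by (intro L2_inner_tendsto Psq lim\<mu> \<phi>)
    then have "((\<lambda>F. exp (- complex_of_real (\<integral>x. P \<phi> F x * P \<phi> F x \<partial>\<mu>) / 2)) \<longlongrightarrow>
        exp (- complex_of_real (\<integral>x. \<phi> x * \<phi> x \<partial>\<mu>) / 2)) ?\<F>"
      by (intro tendsto_intros) auto
    then show "((\<lambda>F. \<integral>\<omega>. iexp (G \<phi> F \<omega>) \<partial>N) \<longlongrightarrow> exp (- complex_of_real (\<integral>x. (\<phi> x)\<^sup>2 \<partial>\<mu>) / 2)) ?\<F>"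
      unfolding power2_eq_square
    proof (rule Lim_transform_eventually)
      show "\<forall>\<^sub>F F in ?\<F>. exp (- complex_of_real (\<integral>x. P \<phi> F x * P \<phi> F x \<partial>\<mu>) / 2) = (\<integral>\<omega>. iexp (G \<phi> F \<omega>) \<partial>N)"
        using ev
      proof eventually_elim
        case (elim F)
        then have F: "finite F" "F \<inter> I = F" "F \<subseteq> I" by auto
        have Xm[measurable]: "X i \<in> borel_measurable N" if "i \<in> F" for i
          using square_integrable_measurable[OF Xsq] that F by auto
        have ind: "N.indep_vars (\<lambda>_. borel) (\<lambda>i \<omega>. c \<phi> i * X i \<omega>) F"
          by (rule N.indep_vars_compose2[OF N.indep_vars_subset[OF X(1) F(3)], where Y = "\<lambda>i x. c \<phi> i * x"]) simp
        have "(\<integral>\<omega>. iexp (G \<phi> F \<omega>) \<partial>N) = char (distr N borel (\<lambda>\<omega>. \<Sum>i\<in>F. c \<phi> i * X i \<omega>)) 1"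
          by (subst char_distr) (auto simp: G_def F)
        also have "\<dots> = (\<Prod>i\<in>F. char (distr N borel (\<lambda>\<omega>. c \<phi> i * X i \<omega>)) 1)"
          by (rule N.char_distr_sum[OF ind])
        also have "\<dots> = (\<Prod>i\<in>F. exp (- complex_of_real ((c \<phi> i)\<^sup>2) / 2))"
        proof (intro prod.cong refl)
          fix i assume i: "i \<in> F"
          have "char (distr N borel (\<lambda>\<omega>. c \<phi> i * X i \<omega>)) 1 = char (distr N borel (X i)) (c \<phi> i)"
            using Xm[OF i] by (simp add: char_distr)
          also have "\<dots> = exp (- complex_of_real ((c \<phi> i)\<^sup>2) / 2)"
            using N.std_normal_facts(4)[OF X(2), of i "c \<phi> i"] i F by (auto simp: of_real_exp)
          finally show "char (distr N borel (\<lambda>\<omega>. c \<phi> i * X i \<omega>)) 1 = exp (- complex_of_real ((c \<phi> i)\<^sup>2) / 2)" .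
        qed
        also have "\<dots> = exp (\<Sum>i\<in>F. - complex_of_real ((c \<phi> i)\<^sup>2) / 2)"
          using F(1) by (rule exp_sum[symmetric])
        also have "(\<Sum>i\<in>F. - complex_of_real ((c \<phi> i)\<^sup>2) / 2) = - complex_of_real (\<Sum>i\<in>F. c \<phi> i * c \<phi> i) / 2"
          by (simp add: power2_eq_square sum_divide_distrib sum_negf)
        also have "(\<Sum>i\<in>F. c \<phi> i * c \<phi> i) = (\<integral>x. P \<phi> F x * P \<phi> F x \<partial>\<mu>)"
          unfolding P_def F(2) using F by (intro orthonormal_inner[symmetric] e) auto
        finally show ?case by simp
      qed
    qed
  qed
qed


text \<open>Expanding both squares leaves inner products only. Additivity of \<sigma>, which for
  white noise holds up to null sets, is thereby avoided.\<close>

lemma L2_isometry_dist: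
  fixes \<sigma> :: "('x \<Rightarrow> real) \<Rightarrow> 'w \<Rightarrow> real"
  assumes \<sigma>: "\<And>\<phi>. square_integrable \<mu> \<phi> \<Longrightarrow> square_integrable N (\<sigma> \<phi>)"
      "\<And>\<phi> \<psi>. square_integrable \<mu> \<phi> \<Longrightarrow> square_integrable \<mu> \<psi> \<Longrightarrow>
        (\<integral>\<omega>. \<sigma> \<phi> \<omega> * \<sigma> \<psi> \<omega> \<partial>N) = (\<integral>x. \<phi> x * \<psi> x \<partial>\<mu>)"
    and sq: "square_integrable \<mu> \<phi>" "square_integrable \<mu> \<psi>"
  shows "(\<integral>\<omega>. (\<sigma> \<phi> \<omega> - \<sigma> \<psi> \<omega>)\<^sup>2 \<partial>N) = (\<integral>x. (\<phi> x - \<psi> x)\<^sup>2 \<partial>\<mu>)"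
proof -
  have expand: "(\<integral>z. (u z - v z)\<^sup>2 \<partial>M) = (\<integral>z. u z * u z \<partial>M) - 2 * (\<integral>z. u z * v z \<partial>M) + (\<integral>z. v z * v z \<partial>M)"
    if uv: "square_integrable M u" "square_integrable M v" for M :: "'c measure" and u v :: "'c \<Rightarrow> real"
  proof -
    have "(\<integral>z. (u z - v z)\<^sup>2 \<partial>M) = (\<integral>z. u z * u z - 2 * (u z * v z) + v z * v z \<partial>M)"
      by (intro Bochner_Integration.integral_cong refl) (simp add: power2_eq_square algebra_simps)
    then show ?thesis by (simp add: square_integrable_mult_integrable uv)
  qed
  show ?thesis by (simp add: expand \<sigma> sq)
qed

section \<open>Random fields built from white noise and an invariant kernel\<close>

context compact_homogeneous_space
begin

text \<open>The field \<open>x \<mapsto> \<sigma> (k x)\<close> is continuous in mean square, so it is a fast limit of fields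
  that take countably many values in \<open>x\<close>; these are jointly measurable.\<close>

lemma measurable_version:
  fixes \<sigma> :: "('x \<Rightarrow> real) \<Rightarrow> 'w \<Rightarrow> real" and k :: "'x \<Rightarrow> 'x \<Rightarrow> real"
  assumes k[measurable]: "(\<lambda>(x, y). k x y) \<in> borel_measurable (\<mu> \<Otimes>\<^sub>M \<mu>)"
    and kinv: "\<And>g x y. k (act g x) (act g y) = k x y" and ksq: "\<And>x. square_integrable \<mu> (k x)"
    and \<sigma>: "\<And>\<phi>. square_integrable \<mu> \<phi> \<Longrightarrow> square_integrable N (\<sigma> \<phi>)"
      "\<And>\<phi> \<psi>. square_integrable \<mu> \<phi> \<Longrightarrow> square_integrable \<mu> \<psi> \<Longrightarrow>
        (\<integral>\<omega>. \<sigma> \<phi> \<omega> * \<sigma> \<psi> \<omega> \<partial>N) = (\<integral>x. \<phi> x * \<psi> x \<partial>\<mu>)"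
  obtains t :: "'x \<Rightarrow> 'w \<Rightarrow> real" where "(\<lambda>(\<omega>, x). t x \<omega>) \<in> borel_measurable (N \<Otimes>\<^sub>M \<mu>)"
    "\<And>x. AE \<omega> in N. t x \<omega> = \<sigma> (k x) \<omega>"
proof -
  \<comment> \<open>Invariance makes all rows of \<open>k\<close> translates of one row, so
    \<open>translate_net\<close> supplies countably many of them that approximate all.\<close>
  have kx: "k (act g x0) y = k x0 (act (- g) y)" for g y
    using kinv[of g x0 "act (- g) y"] by simp
  have "\<exists>p :: nat \<Rightarrow> 'x. \<forall>x. \<exists>i. (\<integral>y. (k x y - k (p i) y)\<^sup>2 \<partial>\<mu>) \<le> (1/4)^n" for n
  proof -
    obtain p :: "nat \<Rightarrow> 'g" where p: "\<And>g. \<exists>i. (\<integral>x. (k x0 (act (- g) x) - k x0 (act (- p i) x))\<^sup>2 \<partial>\<mu>) \<le> (1/4)^n"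
      using translate_net[OF ksq[of x0], of "(1/4)^n"] by auto
    show ?thesis
    proof (intro exI[of _ "\<lambda>i. act (p i) x0"] allI)
      fix x
      obtain g where "act g x0 = x" using exists_group_element by blast
      then show "\<exists>i. (\<integral>y. (k x y - k (act (p i) x0) y)\<^sup>2 \<partial>\<mu>) \<le> (1/4)^n"
        using p[of g] by (auto simp flip: kx)
    qed
  qed
  then obtain p :: "nat \<Rightarrow> nat \<Rightarrow> 'x" where
    p: "\<And>n x. \<exists>i. (\<integral>y. (k x y - k (p n i) y)\<^sup>2 \<partial>\<mu>) \<le> (1/4)^n"
    by metis
  \<comment> \<open>The least admissible index is measurable in \<open>x\<close> because the squared
    distance to each fixed row is.\<close>
  define L where "L n x = (LEAST i. (\<integral>y. (k x y - k (p n i) y)\<^sup>2 \<partial>\<mu>) \<le> (1/4)^n)" for n x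
  have L: "(\<integral>y. (k x y - k (p n (L n x)) y)\<^sup>2 \<partial>\<mu>) \<le> (1/4)^n" for n x
    unfolding L_def by (rule LeastI_ex[OF p])
  have [measurable]: "k x \<in> borel_measurable \<mu>" for x using ksq[of x] by blast
  have [measurable]: "L n \<in> measurable \<mu> (count_space UNIV)" for n
    unfolding L_def by measurable
  have [measurable]: "\<sigma> (k x) \<in> borel_measurable N" for x using \<sigma>(1)[OF ksq] by blast
  define t where "t n x \<omega> = \<sigma> (k (p n (L n x))) \<omega>" for n x \<omega>
  have tm[measurable]: "(\<lambda>z. t n (snd z) (fst z)) \<in> borel_measurable (N \<Otimes>\<^sub>M \<mu>)" for n
    unfolding t_def
    by (rule measurable_compose_countable[where f = "\<lambda>i z. \<sigma> (k (p n i)) (fst z)" and g = "\<lambda>z. L n (snd z)"])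
       measurable
  show thesis
  proof (rule that[of "\<lambda>x \<omega>. lim (\<lambda>n. t n x \<omega>)"])
    show "(\<lambda>(\<omega>, x). lim (\<lambda>n. t n x \<omega>)) \<in> borel_measurable (N \<Otimes>\<^sub>M \<mu>)"
      unfolding case_prod_unfold by (rule borel_measurable_lim_metric) measurable
  next
    fix x
    have "AE \<omega> in N. (\<lambda>n. t n x \<omega>) \<longlonglongrightarrow> \<sigma> (k x) \<omega>"
    proof (rule AE_tendsto_if_L2_summable[where c = "\<lambda>n. (1/4)^n"])
      show "square_integrable N (\<lambda>\<omega>. t n x \<omega> - \<sigma> (k x) \<omega>)" for n
        unfolding t_def by (intro square_integrable_diff \<sigma> ksq)
      have "(\<integral>\<omega>. (\<sigma> (k x) \<omega> - t n x \<omega>)\<^sup>2 \<partial>N) \<le> (1/4)^n" for n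
        unfolding t_def using L2_isometry_dist[of \<mu> N \<sigma>, OF \<sigma> ksq ksq] L by simp
      then show "(\<integral>\<omega>. (t n x \<omega> - \<sigma> (k x) \<omega>)\<^sup>2 \<partial>N) \<le> (1/4)^n" for n
        by (simp add: power2_commute)
    qed (simp add: summable_geometric)
    then show "AE \<omega> in N. lim (\<lambda>n. t n x \<omega>) = \<sigma> (k x) \<omega>"
      by eventually_elim (rule limI)
  qed
qed

text \<open>A Fubini theorem for white noise: integrating \<open>t\<close> against \<open>h\<close>
  amounts to evaluating \<sigma> at the integral of the rows of \<open>k\<close> against
  \<open>h\<close>. Both variables are compared in mean square; \<open>L2_field_pairing\<close>
  computes all three inner products that occur in the expanded square.\<close>

lemma version_pairing:
  fixes \<sigma> :: "('x \<Rightarrow> real) \<Rightarrow> 'w \<Rightarrow> real" and k :: "'x \<Rightarrow> 'x \<Rightarrow> real" and t :: "'x \<Rightarrow> 'w \<Rightarrow> real"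
  assumes "prob_space N"
    and k[measurable]: "(\<lambda>(x, y). k x y) \<in> borel_measurable (\<mu> \<Otimes>\<^sub>M \<mu>)"
    and kinv: "\<And>g x y. k (act g x) (act g y) = k x y" and ksq: "\<And>x. square_integrable \<mu> (k x)"
    and \<sigma>: "\<And>\<phi>. square_integrable \<mu> \<phi> \<Longrightarrow> square_integrable N (\<sigma> \<phi>)"
      "\<And>\<phi> \<psi>. square_integrable \<mu> \<phi> \<Longrightarrow> square_integrable \<mu> \<psi> \<Longrightarrow>
        (\<integral>\<omega>. \<sigma> \<phi> \<omega> * \<sigma> \<psi> \<omega> \<partial>N) = (\<integral>x. \<phi> x * \<psi> x \<partial>\<mu>)"
    and t[measurable]: "(\<lambda>(\<omega>, x). t x \<omega>) \<in> borel_measurable (N \<Otimes>\<^sub>M \<mu>)"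
    and t_eq: "\<And>x. AE \<omega> in N. t x \<omega> = \<sigma> (k x) \<omega>"
    and h: "square_integrable \<mu> h"
  shows "AE \<omega> in N. square_integrable \<mu> (\<lambda>x. t x \<omega>)"
    and "square_integrable \<mu> (\<lambda>y. \<integral>x. h x * k x y \<partial>\<mu>)"
    and "AE \<omega> in N. (\<integral>x. h x * t x \<omega> \<partial>\<mu>) = \<sigma> (\<lambda>y. \<integral>x. h x * k x y \<partial>\<mu>) \<omega>"
proof -
  interpret N: prob_space N by fact
  define \<kappa> where "\<kappa> y = (\<integral>x. h x * k x y \<partial>\<mu>)" for y
  define H where "H \<omega> = (\<integral>x. h x * t x \<omega> \<partial>\<mu>)" for \<omega>
  have knorm: "(\<integral>y. (k x y)\<^sup>2 \<partial>\<mu>) = (\<integral>y. (k x0 y)\<^sup>2 \<partial>\<mu>)" for x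
  proof -
    obtain g where g: "act g x0 = x" using exists_group_element by blast
    have "(\<integral>y. (k x y)\<^sup>2 \<partial>\<mu>) = (\<integral>y. (k x (act g y))\<^sup>2 \<partial>\<mu>)"
      using ksq[of x] by (intro integral_translate[symmetric]) auto
    then show ?thesis using kinv[of g x0] by (simp add: g)
  qed
  have tm[measurable]: "t x \<in> borel_measurable N" for x
    using measurable_Pair1[OF t, of x] by simp
  have tint: "(\<integral>\<omega>. t x \<omega> * Y \<omega> \<partial>N) = (\<integral>\<omega>. \<sigma> (k x) \<omega> * Y \<omega> \<partial>N)"
    if Y: "square_integrable N Y" for x Y
    using t_eq[of x] square_integrable_measurable[OF \<sigma>(1)[OF ksq]] square_integrable_measurable[OF Y]
    by (intro integral_cong_AE) auto
  have tsq: "square_integrable N (t x)" for x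
  proof -
    have "integrable N (\<lambda>\<omega>. (t x \<omega>)\<^sup>2)"
      by (rule Bochner_Integration.integrable_cong_AE_imp[of _ "\<lambda>\<omega>. (\<sigma> (k x) \<omega>)\<^sup>2"])
         (use \<sigma>(1)[OF ksq] t_eq[of x] in \<open>auto simp: square_integrable_real\<close>)
    then show ?thesis by (simp add: square_integrable_real)
  qed
  have tt: "(\<integral>\<omega>. t x \<omega> * t x' \<omega> \<partial>N) = (\<integral>y. k x y * k x' y \<partial>\<mu>)" for x x'
    using tint[OF tsq, of x x'] tint[OF \<sigma>(1)[OF ksq], of x' x] \<sigma>(2)[OF ksq ksq, of x x']
    by (simp add: mult.commute)
  have "(\<integral>\<omega>. (t x \<omega>)\<^sup>2 \<partial>N) \<le> (\<integral>y. (k x0 y)\<^sup>2 \<partial>\<mu>)" for x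
    using tt[of x x] knorm[of x] by (simp add: power2_eq_square)
  note T = L2_field_pairing[OF \<mu>.prob_space_axioms N.prob_space_axioms _ tsq this h]
  have tm': "(\<lambda>(x, \<omega>). t x \<omega>) \<in> borel_measurable (\<mu> \<Otimes>\<^sub>M N)" by measurable
  note T = T[OF tm']
  note \<kappa> = L2_field_pairing[OF \<mu>.prob_space_axioms \<mu>.prob_space_axioms k ksq eq_refl[OF knorm] h]
  show "AE \<omega> in N. square_integrable \<mu> (\<lambda>x. t x \<omega>)" by (rule T(2))
  show \<kappa>sq: "square_integrable \<mu> \<kappa>" unfolding \<kappa>_def[abs_def] by (rule \<kappa>(3))
  have Hsq: "square_integrable N H" unfolding H_def[abs_def] by (rule T(3))
  have H\<sigma>: "(\<integral>\<omega>. H \<omega> * \<sigma> \<psi> \<omega> \<partial>N) = (\<integral>y. \<kappa> y * \<psi> y \<partial>\<mu>)" if \<psi>: "square_integrable \<mu> \<psi>" for \<psi>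
  proof -
    have "(\<integral>\<omega>. H \<omega> * \<sigma> \<psi> \<omega> \<partial>N) = (\<integral>x. h x * (\<integral>\<omega>. t x \<omega> * \<sigma> \<psi> \<omega> \<partial>N) \<partial>\<mu>)"
      unfolding H_def by (rule T(5)[OF \<sigma>(1)[OF \<psi>]])
    also have "\<dots> = (\<integral>x. h x * (\<integral>y. k x y * \<psi> y \<partial>\<mu>) \<partial>\<mu>)"
      by (simp add: tint[OF \<sigma>(1)[OF \<psi>]] \<sigma>(2)[OF ksq \<psi>])
    also have "\<dots> = (\<integral>y. \<kappa> y * \<psi> y \<partial>\<mu>)"
      unfolding \<kappa>_def by (rule \<kappa>(5)[OF \<psi>, symmetric])
    finally show ?thesis .
  qed
  \<comment> \<open>The weak characterisation of H is applied with H itself as test variable, and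
    then \<open>H\<sigma>\<close> with the rows of \<open>k\<close>.\<close>
  have HH: "(\<integral>\<omega>. H \<omega> * H \<omega> \<partial>N) = (\<integral>y. \<kappa> y * \<kappa> y \<partial>\<mu>)"
  proof -
    have "(\<integral>\<omega>. t x \<omega> * H \<omega> \<partial>N) = (\<integral>y. k x y * \<kappa> y \<partial>\<mu>)" for x
      using tint[OF Hsq, of x] H\<sigma>[OF ksq, of x] by (simp add: mult.commute)
    then have "(\<integral>\<omega>. H \<omega> * H \<omega> \<partial>N) = (\<integral>x. h x * (\<integral>y. k x y * \<kappa> y \<partial>\<mu>) \<partial>\<mu>)"
      using T(5)[OF Hsq] by (simp add: H_def[abs_def])
    also have "\<dots> = (\<integral>y. \<kappa> y * \<kappa> y \<partial>\<mu>)"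
      using \<kappa>(5)[OF \<kappa>sq] by (simp add: \<kappa>_def[abs_def])
    finally show ?thesis .
  qed
  note sq = Hsq \<sigma>(1)[OF \<kappa>sq]
  have "(\<integral>\<omega>. (H \<omega> - \<sigma> \<kappa> \<omega>)\<^sup>2 \<partial>N) = (\<integral>\<omega>. H \<omega> * H \<omega> - 2 * (H \<omega> * \<sigma> \<kappa> \<omega>) + \<sigma> \<kappa> \<omega> * \<sigma> \<kappa> \<omega> \<partial>N)"
    by (intro Bochner_Integration.integral_cong refl) (simp add: power2_eq_square algebra_simps)
  also have "\<dots> = 0"
    using HH H\<sigma>[OF \<kappa>sq] \<sigma>(2)[OF \<kappa>sq \<kappa>sq] by (simp add: square_integrable_mult_integrable sq)
  finally have "AE \<omega> in N. (H \<omega> - \<sigma> \<kappa> \<omega>)\<^sup>2 = 0"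
    using square_integrable_diff[OF sq]
    by (subst (asm) integral_nonneg_eq_0_iff_AE) (auto simp: square_integrable_real)
  then show "AE \<omega> in N. (\<integral>x. h x * t x \<omega> \<partial>\<mu>) = \<sigma> \<kappa> \<omega>"
    by eventually_elim (simp add: H_def)
qed

end

section \<open>Uniqueness of multivariate laws\<close>

text \<open>Evaluating at s = 0 shows that both weights have the same total mass c. If c > 0,
  dividing by c gives two probability measures to which Levy's theorem applies; if c = 0, both
  weights vanish almost everywhere.\<close>

lemma weighted_char_uniqueness:
  fixes f :: "'a \<Rightarrow> real" and g :: "'b \<Rightarrow> real"
  assumes "prob_space M" "prob_space N"
    and [measurable]: "f \<in> borel_measurable M" "Y \<in> borel_measurable M" "g \<in> borel_measurable N" "Z \<in> borel_measurable N"
    and f: "\<And>x. 0 \<le> f x" "\<And>x. f x \<le> B" and g: "\<And>x. 0 \<le> g x" "\<And>x. g x \<le> B"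
    and eq: "\<And>s. (\<integral>x. of_real (f x) * iexp (s * Y x) \<partial>M) = (\<integral>x. of_real (g x) * iexp (s * Z x) \<partial>N)"
    and A[measurable]: "A \<in> sets borel"
  shows "(\<integral>x. f x * indicator A (Y x) \<partial>M) = (\<integral>x. g x * indicator A (Z x) \<partial>N)"
proof -
  interpret M: prob_space M by fact
  interpret N: prob_space N by fact
  have fi: "integrable M f" by (rule M.integrable_const_bound[where B = B]) (use f in auto)
  have gi: "integrable N g" by (rule N.integrable_const_bound[where B = B]) (use g in auto)
  define c where "c = (\<integral>x. f x \<partial>M)"
  have "complex_of_real c = complex_of_real (\<integral>x. g x \<partial>N)"
    using eq[of 0] by (simp add: c_def)
  then have cg: "c = (\<integral>x. g x \<partial>N)" by simp
  have c0: "0 \<le> c" unfolding c_def using f by simp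
  show ?thesis
  proof (cases "c = 0")
    case True
    have z: "(\<integral>x. h x * indicator A (U x) \<partial>P) = 0"
      if "integrable P h" "\<And>x. 0 \<le> h x" "(\<integral>x. h x \<partial>P) = 0" "U \<in> borel_measurable P"
      for P :: "'c measure" and h :: "'c \<Rightarrow> real" and U
    proof -
      have [measurable]: "U \<in> borel_measurable P" "h \<in> borel_measurable P" using that by auto
      have "AE x in P. h x = 0" using integral_nonneg_eq_0_iff_AE[OF that(1)] that by auto
      then have "(\<integral>x. h x * indicator A (U x) \<partial>P) = (\<integral>x. 0 \<partial>P)"
        by (intro integral_cong_AE) (auto elim: eventually_mono)
      then show ?thesis by simp
    qed
    show ?thesis using True by (simp add: z[OF fi] z[OF gi] f g cg[symmetric] c_def[symmetric])
  next
    case False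
    with c0 have c: "0 < c" by simp
    have d: "real_distribution (distr (density P (\<lambda>x. ennreal (h x / c))) borel U)"
        "char (distr (density P (\<lambda>x. ennreal (h x / c))) borel U) s = (\<integral>x. of_real (h x) * iexp (s * U x) \<partial>P) / c"
        "measure (distr (density P (\<lambda>x. ennreal (h x / c))) borel U) A = (\<integral>x. h x * indicator A (U x) \<partial>P) / c"
      if h: "integrable P h" "\<And>x. 0 \<le> h x" "(\<integral>x. h x \<partial>P) = c" and U[measurable]: "U \<in> borel_measurable P"
      for P :: "'c measure" and h U and s :: real
    proof -
      have [measurable]: "h \<in> borel_measurable P" using h by auto
      let ?P = "density P (\<lambda>x. ennreal (h x / c))"
      have e1: "emeasure ?P (space ?P) = 1"
      proof -
        have "emeasure ?P (space ?P) = (\<integral>\<^sup>+x. ennreal (h x / c) \<partial>P)"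
          by (subst emeasure_density) (auto intro!: nn_integral_cong)
        also have "\<dots> = ennreal (\<integral>x. h x / c \<partial>P)"
          using h c by (intro nn_integral_eq_integral) auto
        also have "\<dots> = 1" using h c by simp
        finally show ?thesis .
      qed
      interpret P': prob_space ?P by (rule prob_spaceI[OF e1])
      have Um: "U \<in> borel_measurable ?P" by simp
      show "real_distribution (distr ?P borel U)"
        by (rule P'.real_distribution_distr[OF Um])
      have "char (distr ?P borel U) s = (\<integral>x. iexp (s * U x) \<partial>?P)"
        by (rule char_distr[OF Um])
      also have "\<dots> = (\<integral>x. (h x / c) *\<^sub>R iexp (s * U x) \<partial>P)"
        using h c by (intro integral_density) auto
      also have "\<dots> = (\<integral>x. of_real (h x) * iexp (s * U x) / of_real c \<partial>P)"
        by (intro Bochner_Integration.integral_cong refl) (simp add: scaleR_conv_of_real)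
      finally show "char (distr ?P borel U) s = (\<integral>x. of_real (h x) * iexp (s * U x) \<partial>P) / c"
        by simp
      have "measure (distr ?P borel U) A = (\<integral>x. indicator A x \<partial>distr ?P borel U)" by simp
      also have "\<dots> = (\<integral>x. indicator A (U x) \<partial>?P)" by (rule integral_distr) auto
      also have "\<dots> = (\<integral>x. (h x / c) *\<^sub>R indicator A (U x) \<partial>P)"
        using h c by (intro integral_density) auto
      finally show "measure (distr ?P borel U) A = (\<integral>x. h x * indicator A (U x) \<partial>P) / c" by simp
    qed
    have "distr (density M (\<lambda>x. ennreal (f x / c))) borel Y = distr (density N (\<lambda>x. ennreal (g x / c))) borel Z"
    proof (rule Levy_uniqueness)
      show "char (distr (density M (\<lambda>x. ennreal (f x / c))) borel Y) =
          char (distr (density N (\<lambda>x. ennreal (g x / c))) borel Z)"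
        by (rule ext) (simp only: d(2)[OF fi f(1) c_def[symmetric] assms(4)] d(2)[OF gi g(1) cg[symmetric] assms(6)] eq)
    qed (intro d(1) fi gi f g c_def[symmetric] cg[symmetric]; measurable)+
    then have "(\<integral>x. f x * indicator A (Y x) \<partial>M) / c = (\<integral>x. g x * indicator A (Z x) \<partial>N) / c"
      unfolding d(3)[OF fi f(1) c_def[symmetric] assms(4), symmetric] d(3)[OF gi g(1) cg[symmetric] assms(6), symmetric]
      by simp
    then show ?thesis using c by simp
  qed
qed

lemma iexp_cos_sin: "iexp t = complex_of_real (cos t) + \<i> * complex_of_real (sin t)"
  by (simp add: complex_eq_iff Re_exp Im_exp)

text \<open>Adding the weight \<open>1 + cos V\<close> (or \<open>1 + sin V\<close>) keeps the measure positive, so the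
  uniqueness theorem on the line applies to one coordinate at a time.\<close>

lemma char_step:
  fixes W V Y :: "'a \<Rightarrow> real" and W' V' Y' :: "'b \<Rightarrow> real"
  assumes "prob_space M" "prob_space N"
    and [measurable]: "W \<in> borel_measurable M" "V \<in> borel_measurable M" "Y \<in> borel_measurable M"
      "W' \<in> borel_measurable N" "V' \<in> borel_measurable N" "Y' \<in> borel_measurable N"
    and W: "\<And>x. 0 \<le> W x" "\<And>x. W x \<le> 1" and W': "\<And>x. 0 \<le> W' x" "\<And>x. W' x \<le> 1"
    and eq: "\<And>s v. (\<integral>x. of_real (W x) * iexp (s * Y x + v * V x) \<partial>M) = (\<integral>x. of_real (W' x) * iexp (s * Y' x + v * V' x) \<partial>N)"
    and A[measurable]: "A \<in> sets borel"
  shows "(\<integral>x. of_real (W x * indicator A (Y x)) * iexp (V x) \<partial>M) = (\<integral>x. of_real (W' x * indicator A (Y' x)) * iexp (V' x) \<partial>N)"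
proof -
  interpret M: prob_space M by fact
  interpret N: prob_space N by fact
  let ?w = "\<lambda>a b P w v t. w * (1 + a * cos v + b * sin v)"
  \<comment> \<open>In exponentials the weight is 1 + (a - ib)/2 e^(iv) + (a + ib)/2 e^(-iv), so the
    hypothesis is used for three values of its second parameter: 0, 1 and -1.\<close>
  have expand: "(\<integral>x. of_real (w x * (1 + a * cos (v x) + b * sin (v x))) * iexp (s * y x) \<partial>P) =
      (\<integral>x. of_real (w x) * iexp (s * y x + 0 * v x) \<partial>P)
      + (of_real a - \<i> * of_real b) / 2 * (\<integral>x. of_real (w x) * iexp (s * y x + 1 * v x) \<partial>P)
      + (of_real a + \<i> * of_real b) / 2 * (\<integral>x. of_real (w x) * iexp (s * y x + (-1) * v x) \<partial>P)"
    if "prob_space P" and [measurable]: "w \<in> borel_measurable P" "v \<in> borel_measurable P" "y \<in> borel_measurable P"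
      and w: "\<And>x. 0 \<le> w x" "\<And>x. w x \<le> 1"
    for P :: "'c measure" and w v y a b s
  proof -
    interpret P: prob_space P by fact
    have int: "integrable P (\<lambda>x. of_real (w x) * iexp (s * y x + c * v x))" for c
      by (rule P.integrable_const_bound[where B = 1]) (use w in \<open>auto simp: norm_mult\<close>)
    have "of_real (w x * (1 + a * cos (v x) + b * sin (v x))) * iexp (s * y x) =
        of_real (w x) * iexp (s * y x + 0 * v x)
        + (of_real a - \<i> * of_real b) / 2 * (of_real (w x) * iexp (s * y x + 1 * v x))
        + (of_real a + \<i> * of_real b) / 2 * (of_real (w x) * iexp (s * y x + (-1) * v x))" for x
    proof -
      have 1: "iexp (s * y x + 1 * v x) = iexp (s * y x) * (of_real (cos (v x)) + \<i> * of_real (sin (v x)))"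
        by (simp add: distrib_left exp_add iexp_cos_sin[of "v x", symmetric])
      have "iexp (s * y x + (-1) * v x) = iexp (s * y x) * iexp (- v x)"
        by (simp add: distrib_left right_diff_distrib flip: exp_add)
      then have 2: "iexp (s * y x + (-1) * v x) = iexp (s * y x) * (of_real (cos (v x)) - \<i> * of_real (sin (v x)))"
        using iexp_cos_sin[of "- v x"] by simp
      show ?thesis unfolding 1 2 by (simp add: algebra_simps add_divide_distrib diff_divide_distrib)
    qed
    then have "(\<integral>x. of_real (w x * (1 + a * cos (v x) + b * sin (v x))) * iexp (s * y x) \<partial>P) =
        (\<integral>x. of_real (w x) * iexp (s * y x + 0 * v x)
          + (of_real a - \<i> * of_real b) / 2 * (of_real (w x) * iexp (s * y x + 1 * v x))
          + (of_real a + \<i> * of_real b) / 2 * (of_real (w x) * iexp (s * y x + (-1) * v x)) \<partial>P)"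
      by (intro Bochner_Integration.integral_cong refl)
    also have "\<dots> = (\<integral>x. of_real (w x) * iexp (s * y x + 0 * v x) \<partial>P)
      + (of_real a - \<i> * of_real b) / 2 * (\<integral>x. of_real (w x) * iexp (s * y x + 1 * v x) \<partial>P)
      + (of_real a + \<i> * of_real b) / 2 * (\<integral>x. of_real (w x) * iexp (s * y x + (-1) * v x) \<partial>P)"
    proof -
      have "(\<integral>x. f x + \<alpha> * g x + \<beta> * h x \<partial>P) = (\<integral>x. f x \<partial>P) + \<alpha> * (\<integral>x. g x \<partial>P) + \<beta> * (\<integral>x. h x \<partial>P)"
        if "integrable P f" "integrable P g" "integrable P h" for f g h :: "'c \<Rightarrow> complex" and \<alpha> \<beta>
        using that by simp
      from this[OF int int int] show ?thesis .
    qed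
    finally show ?thesis .
  qed
  have meas_eq: "(\<integral>x. (W x * (1 + a * cos (V x) + b * sin (V x))) * indicator A (Y x) \<partial>M) =
      (\<integral>x. (W' x * (1 + a * cos (V' x) + b * sin (V' x))) * indicator A (Y' x) \<partial>N)"
    if ab: "\<And>t. \<bar>a * cos t + b * sin t\<bar> \<le> 1" for a b
  proof (rule weighted_char_uniqueness[where B = 2, OF assms(1,2)])
    have "0 \<le> 1 + a * cos t + b * sin t" "1 + a * cos t + b * sin t \<le> 2" for t
      using ab[of t] by linarith+
    then show "0 \<le> W x * (1 + a * cos (V x) + b * sin (V x))" "W x * (1 + a * cos (V x) + b * sin (V x)) \<le> 2"
      "0 \<le> W' y * (1 + a * cos (V' y) + b * sin (V' y))" "W' y * (1 + a * cos (V' y) + b * sin (V' y)) \<le> 2" for x y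
      using W[of x] W'[of y] mult_mono[of "W x" 1 "1 + a * cos (V x) + b * sin (V x)" 2]
        mult_mono[of "W' y" 1 "1 + a * cos (V' y) + b * sin (V' y)" 2] by auto
    show "(\<integral>x. of_real (W x * (1 + a * cos (V x) + b * sin (V x))) * iexp (s * Y x) \<partial>M) =
        (\<integral>x. of_real (W' x * (1 + a * cos (V' x) + b * sin (V' x))) * iexp (s * Y' x) \<partial>N)" for s
      unfolding expand[OF assms(1,3,4,5) W] expand[OF assms(2,6,7,8) W'] by (simp only: eq)
  qed measurable
  \<comment> \<open>The weights with (a, b) = (1, 0), (0, 1) and (0, 0) recover cosine and sine by
    subtraction.\<close>
  have split: "(\<integral>x. of_real (w x * indicator A (y x)) * iexp (v x) \<partial>P) =
      of_real ((\<integral>x. (w x * (1 + 1 * cos (v x) + 0 * sin (v x))) * indicator A (y x) \<partial>P)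
        - (\<integral>x. (w x * (1 + 0 * cos (v x) + 0 * sin (v x))) * indicator A (y x) \<partial>P))
      + \<i> * of_real ((\<integral>x. (w x * (1 + 0 * cos (v x) + 1 * sin (v x))) * indicator A (y x) \<partial>P)
        - (\<integral>x. (w x * (1 + 0 * cos (v x) + 0 * sin (v x))) * indicator A (y x) \<partial>P))"
    if "prob_space P" and [measurable]: "w \<in> borel_measurable P" "v \<in> borel_measurable P" "y \<in> borel_measurable P"
      and w: "\<And>x. 0 \<le> w x" "\<And>x. w x \<le> 1"
    for P :: "'c measure" and w v y
  proof -
    interpret P: prob_space P by fact
    have b: "\<bar>w x * (g * indicator A (y x))\<bar> \<le> 1" if "\<bar>g\<bar> \<le> 1" for x and g :: real
      using mult_mono[of "w x" 1 "\<bar>g\<bar>" 1] w[of x] that by (auto simp: abs_mult indicator_def)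
    have i: "integrable P (\<lambda>x. w x * (cos (v x) * indicator A (y x)))" "integrable P (\<lambda>x. w x * (sin (v x) * indicator A (y x)))"
      "integrable P (\<lambda>x. w x * indicator A (y x))"
      using b[of 1] by (auto intro!: P.integrable_const_bound[where B = 1] AE_I2 b)
    have 1: "(w x * (1 + 1 * cos (v x) + 0 * sin (v x))) * indicator A (y x) =
        w x * indicator A (y x) + w x * (cos (v x) * indicator A (y x))"
      "(w x * (1 + 0 * cos (v x) + 1 * sin (v x))) * indicator A (y x) =
        w x * indicator A (y x) + w x * (sin (v x) * indicator A (y x))"
      "(w x * (1 + 0 * cos (v x) + 0 * sin (v x))) * indicator A (y x) = w x * indicator A (y x)" for x
      by (simp_all add: algebra_simps)
    have 2: "of_real (w x * indicator A (y x)) * iexp (v x) =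
        complex_of_real (w x * (cos (v x) * indicator A (y x))) + \<i> * complex_of_real (w x * (sin (v x) * indicator A (y x)))" for x
      unfolding iexp_cos_sin by (simp add: algebra_simps)
    have "(\<integral>x. complex_of_real (f x) + \<i> * complex_of_real (g x) \<partial>P) =
        complex_of_real (\<integral>x. f x \<partial>P) + \<i> * complex_of_real (\<integral>x. g x \<partial>P)"
      if "integrable P f" "integrable P g" for f g :: "'c \<Rightarrow> real"
      using that by simp
    from this[OF i(1,2)] show ?thesis unfolding 1 2 using i by simp
  qed
  have ab: "\<bar>1 * cos t + 0 * sin t\<bar> \<le> 1" "\<bar>0 * cos t + 1 * sin t\<bar> \<le> 1" "\<bar>0 * cos t + 0 * sin t\<bar> \<le> 1" for t :: real
    by auto
  show ?thesis
    unfolding split[OF assms(1,3,4,5) W] split[OF assms(2,6,7,8) W']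
    by (simp only: meas_eq[of 1 0, OF ab(1)] meas_eq[of 0 1, OF ab(2)] meas_eq[of 0 0, OF ab(3)])
qed


text \<open>Coordinates are converted one by one from exponentials to indicators. No indicators is
  the hypothesis, and indicators in all coordinates give the measures of boxes, which generate the
  product sigma-algebra.\<close>

theorem cramer_wold:
  fixes Y :: "nat \<Rightarrow> 'a \<Rightarrow> real" and Z :: "nat \<Rightarrow> 'b \<Rightarrow> real"
  assumes "prob_space M" "prob_space N"
    and Y[measurable]: "\<And>i. Y i \<in> borel_measurable M" and Z[measurable]: "\<And>i. Z i \<in> borel_measurable N"
    and eq: "\<And>u. (\<integral>\<omega>. iexp (\<Sum>i<m. u i * Y i \<omega>) \<partial>M) = (\<integral>\<omega>. iexp (\<Sum>i<m. u i * Z i \<omega>) \<partial>N)"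
  shows "distr M (\<Pi>\<^sub>M i\<in>{..<m}. borel) (\<lambda>\<omega>. \<lambda>i\<in>{..<m}. Y i \<omega>) =
    distr N (\<Pi>\<^sub>M i\<in>{..<m}. borel) (\<lambda>\<omega>. \<lambda>i\<in>{..<m}. Z i \<omega>)"
proof -
  interpret M: prob_space M by fact
  interpret N: prob_space N by fact
  have step: "(\<integral>\<omega>. of_real (\<Prod>i<j. indicator (A i) (Y i \<omega>)) * iexp (\<Sum>i=j..<m. u i * Y i \<omega>) \<partial>M) =
      (\<integral>\<omega>. of_real (\<Prod>i<j. indicator (A i) (Z i \<omega>)) * iexp (\<Sum>i=j..<m. u i * Z i \<omega>) \<partial>N)"
    if "j \<le> m" and A[measurable]: "\<And>i. A i \<in> sets borel" for j u and A :: "nat \<Rightarrow> real set"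
    using that(1)
  proof (induction j arbitrary: u)
    case 0
    then show ?case using eq[of u] by (simp add: lessThan_atLeast0)
  next
    case (Suc j)
    \<comment> \<open>Since the induction hypothesis holds for all coefficients, coordinate j may
      get its own parameter s while the later ones share the factor v, as \<open>char_step\<close>
      requires.\<close>
    have s1: "(\<Sum>i=j..<m. (\<lambda>i. if i = j then s else v * u i) i * x i) = s * x j + v * (\<Sum>i=Suc j..<m. u i * x i)"
      for s v :: real and x
    proof -
      have "{j..<m} = insert j {Suc j..<m}" using Suc.prems by auto
      then show ?thesis by (simp add: sum_distrib_left mult_ac)
    qed
    have W: "0 \<le> (\<Prod>i<j. indicator (A i) (x i) :: real)" "(\<Prod>i<j. indicator (A i) (x i) :: real) \<le> 1" for x
      by (auto intro!: prod_nonneg prod_le_1 simp: indicator_def)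
    have p: "(\<Prod>i<Suc j. indicator (A i) (x i) :: real) = (\<Prod>i<j. indicator (A i) (x i)) * indicator (A j) (x j)" for x
      by simp
    show ?case unfolding p
    proof (rule char_step[OF assms(1,2)])
      show "(\<integral>\<omega>. of_real (\<Prod>i<j. indicator (A i) (Y i \<omega>)) * iexp (s * Y j \<omega> + v * (\<Sum>i=Suc j..<m. u i * Y i \<omega>)) \<partial>M) =
        (\<integral>\<omega>. of_real (\<Prod>i<j. indicator (A i) (Z i \<omega>)) * iexp (s * Z j \<omega> + v * (\<Sum>i=Suc j..<m. u i * Z i \<omega>)) \<partial>N)" for s v
        using Suc.IH[of "\<lambda>i. if i = j then s else v * u i"] Suc.prems unfolding s1 by simp
    qed (use W in \<open>auto\<close>)
  qed
  show ?thesis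
  proof (rule measure_eqI_PiM_finite[where A = "\<lambda>_. \<Pi>\<^sub>E i\<in>{..<m}. UNIV"])
    fix A :: "nat \<Rightarrow> real set" assume "\<And>i. i \<in> {..<m} \<Longrightarrow> A i \<in> sets borel"
    \<comment> \<open>\<open>step\<close> asks for a Borel set at every index, so the family is
      padded with \<open>UNIV\<close> beyond \<open>m\<close>.\<close>
    then have B: "(if i < m then A i else UNIV) \<in> sets borel" for i by auto
    have rect: "emeasure (distr P (\<Pi>\<^sub>M i\<in>{..<m}. borel) (\<lambda>\<omega>. \<lambda>i\<in>{..<m}. U i \<omega>)) (Pi\<^sub>E {..<m} A) =
        ennreal (\<integral>\<omega>. (\<Prod>i<m. indicator (if i < m then A i else UNIV) (U i \<omega>)) \<partial>P)"
      if "prob_space P" and U[measurable]: "\<And>i. U i \<in> borel_measurable P" for P :: "'c measure" and U :: "nat \<Rightarrow> 'c \<Rightarrow> real"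
    proof -
      interpret P: prob_space P by fact
      have S: "Pi\<^sub>E {..<m} A \<in> sets (\<Pi>\<^sub>M i\<in>{..<m}. borel)"
        by (rule sets_PiM_I_finite) (use \<open>\<And>i. i \<in> {..<m} \<Longrightarrow> A i \<in> sets borel\<close> in auto)
      have Um: "(\<lambda>\<omega>. \<lambda>i\<in>{..<m}. U i \<omega>) \<in> measurable P (\<Pi>\<^sub>M i\<in>{..<m}. borel)"
        by (rule measurable_restrict) simp
      let ?E = "(\<lambda>\<omega>. \<lambda>i\<in>{..<m}. U i \<omega>) -` (Pi\<^sub>E {..<m} A) \<inter> space P"
      have "(\<integral>\<omega>. (\<Prod>i<m. indicator (if i < m then A i else UNIV) (U i \<omega>)) \<partial>P) = (\<integral>\<omega>. indicator ?E \<omega> \<partial>P :: real)"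
      proof (intro Bochner_Integration.integral_cong refl)
        fix \<omega> assume "\<omega> \<in> space P"
        show "(\<Prod>i<m. indicator (if i < m then A i else UNIV) (U i \<omega>)) = (indicator ?E \<omega> :: real)"
        proof (cases "\<forall>i<m. U i \<omega> \<in> A i")
          case True
          then show ?thesis using \<open>\<omega> \<in> space P\<close> by (auto simp: indicator_def)
        next
          case False
          then show ?thesis by (auto simp: indicator_def prod_zero_iff)
        qed
      qed
      also have "\<dots> = P.prob ?E" using measurable_sets[OF Um S] by simp
      finally show ?thesis using S Um by (simp add: emeasure_distr P.emeasure_eq_measure)
    qed
    have "complex_of_real (\<integral>\<omega>. (\<Prod>i<m. indicator (if i < m then A i else UNIV) (Y i \<omega>)) \<partial>M) =
        complex_of_real (\<integral>\<omega>. (\<Prod>i<m. indicator (if i < m then A i else UNIV) (Z i \<omega>)) \<partial>N)"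
      using step[OF order_refl, of "\<lambda>i. if i < m then A i else UNIV" "\<lambda>_. 0"] B
      by (simp del: of_real_prod add: integral_complex_of_real)
    then show "emeasure (distr M (\<Pi>\<^sub>M i\<in>{..<m}. borel) (\<lambda>\<omega>. \<lambda>i\<in>{..<m}. Y i \<omega>)) (Pi\<^sub>E {..<m} A) =
        emeasure (distr N (\<Pi>\<^sub>M i\<in>{..<m}. borel) (\<lambda>\<omega>. \<lambda>i\<in>{..<m}. Z i \<omega>)) (Pi\<^sub>E {..<m} A)"
      by (simp only: rect[OF assms(1) Y] rect[OF assms(2) Z] of_real_eq_iff)
  next
    show "emeasure (distr M (\<Pi>\<^sub>M i\<in>{..<m}. borel) (\<lambda>\<omega>. \<lambda>i\<in>{..<m}. Y i \<omega>)) (\<Pi>\<^sub>E i\<in>{..<m}. UNIV) \<noteq> \<infinity>"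
    proof -
      interpret D: prob_space "distr M (\<Pi>\<^sub>M i\<in>{..<m}. borel) (\<lambda>\<omega>. \<lambda>i\<in>{..<m}. Y i \<omega>)"
        by (rule M.prob_space_distr) (rule measurable_restrict, simp)
      show ?thesis by simp
    qed
  qed (auto intro!: prod_algebraI_finite simp: space_PiM)
qed

definition re_im_coords :: "(nat \<Rightarrow> 'a \<Rightarrow> complex) \<Rightarrow> nat \<Rightarrow> 'a \<Rightarrow> real" where
  "re_im_coords U i \<omega> = (if even i then Re (U (i div 2) \<omega>) else Im (U (i div 2) \<omega>))"

text \<open>A complex vector is read as a real vector of twice the length. A real functional a Re z
  + b Im z is Re ((a - ib) z), which is where the complex coefficients come from.\<close>

lemma cramer_wold_complex:
  fixes Y :: "nat \<Rightarrow> 'a \<Rightarrow> complex" and Z :: "nat \<Rightarrow> 'b \<Rightarrow> complex"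
  assumes "prob_space M" "prob_space N"
    and Y[measurable]: "\<And>i. Y i \<in> borel_measurable M" and Z[measurable]: "\<And>i. Z i \<in> borel_measurable N"
    and eq: "\<And>c. (\<integral>\<omega>. iexp (\<Sum>i<m. Re (c i * Y i \<omega>)) \<partial>M) = (\<integral>\<omega>. iexp (\<Sum>i<m. Re (c i * Z i \<omega>)) \<partial>N)"
  shows "distr M (\<Pi>\<^sub>M i\<in>{..<m}. borel) (\<lambda>\<omega>. \<lambda>i\<in>{..<m}. Y i \<omega>) =
    distr N (\<Pi>\<^sub>M i\<in>{..<m}. borel) (\<lambda>\<omega>. \<lambda>i\<in>{..<m}. Z i \<omega>)"
proof -
  define G where "G x = (\<lambda>i\<in>{..<m}. Complex (x (2 * i)) (x (2 * i + 1)))" for x :: "nat \<Rightarrow> real"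
  have [measurable]: "re_im_coords U i \<in> borel_measurable P" if "\<And>i. U i \<in> borel_measurable P"
    for P :: "'c measure" and U i
    using that unfolding re_im_coords_def by (cases "even i") auto
  have Gm: "G \<in> measurable (\<Pi>\<^sub>M i\<in>{..<2*m}. borel) (\<Pi>\<^sub>M i\<in>{..<m}. borel)"
    unfolding G_def
  proof (rule measurable_restrict)
    fix i assume "i \<in> {..<m}"
    then have [measurable]: "(\<lambda>x. x (2 * i)) \<in> borel_measurable (\<Pi>\<^sub>M i\<in>{..<2*m}. borel :: real measure)"
      "(\<lambda>x. x (2 * i + 1)) \<in> borel_measurable (\<Pi>\<^sub>M i\<in>{..<2*m}. borel :: real measure)"
      by (auto intro!: measurable_component_singleton)
    show "(\<lambda>x. Complex (x (2 * i)) (x (2 * i + 1))) \<in> borel_measurable (\<Pi>\<^sub>M i\<in>{..<2*m}. borel)"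
      unfolding Complex_eq by measurable
  qed
  have factor: "distr P (\<Pi>\<^sub>M i\<in>{..<m}. borel) (\<lambda>\<omega>. \<lambda>i\<in>{..<m}. U i \<omega>) =
      distr (distr P (\<Pi>\<^sub>M i\<in>{..<2*m}. borel) (\<lambda>\<omega>. \<lambda>i\<in>{..<2*m}. re_im_coords U i \<omega>)) (\<Pi>\<^sub>M i\<in>{..<m}. borel) G"
    if [measurable]: "\<And>i. U i \<in> borel_measurable P" for P :: "'c measure" and U
  proof -
    have m: "(\<lambda>\<omega>. \<lambda>i\<in>{..<2*m}. re_im_coords U i \<omega>) \<in> measurable P (\<Pi>\<^sub>M i\<in>{..<2*m}. borel)"
      by (rule measurable_restrict) measurable
    have "G (\<lambda>i\<in>{..<2*m}. re_im_coords U i \<omega>) = (\<lambda>i\<in>{..<m}. U i \<omega>)" for \<omega>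
      by (auto simp: G_def re_im_coords_def fun_eq_iff restrict_def)
    then show ?thesis by (simp add: distr_distr[OF Gm m] o_def)
  qed
  have sum: "(\<Sum>i<2*m. u i * re_im_coords U i \<omega>) = (\<Sum>i<m. Re (Complex (u (2 * i)) (- u (2 * i + 1)) * U i \<omega>))" for u U and \<omega> :: 'c
  proof -
    have "(\<Sum>i<2*m. u i * re_im_coords U i \<omega>) = (\<Sum>i<2*m. if even i then u i * Re (U (i div 2) \<omega>) else u i * Im (U (i div 2) \<omega>))"
      by (intro sum.cong refl) (simp add: re_im_coords_def)
    also have "\<dots> = (\<Sum>i<m. u (2 * i) * Re (U i \<omega>)) + (\<Sum>i<m. u (2 * i + 1) * Im (U i \<omega>))"
      by (subst sum_split_even_odd) simp
    also have "\<dots> = (\<Sum>i<m. Re (Complex (u (2 * i)) (- u (2 * i + 1)) * U i \<omega>))"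
      by (simp add: sum.distrib)
    finally show ?thesis .
  qed
  have "distr M (\<Pi>\<^sub>M i\<in>{..<2*m}. borel) (\<lambda>\<omega>. \<lambda>i\<in>{..<2*m}. re_im_coords Y i \<omega>) =
      distr N (\<Pi>\<^sub>M i\<in>{..<2*m}. borel) (\<lambda>\<omega>. \<lambda>i\<in>{..<2*m}. re_im_coords Z i \<omega>)"
  proof (rule cramer_wold[OF assms(1,2)])
    show "(\<integral>\<omega>. iexp (\<Sum>i<2*m. u i * re_im_coords Y i \<omega>) \<partial>M) =
        (\<integral>\<omega>. iexp (\<Sum>i<2*m. u i * re_im_coords Z i \<omega>) \<partial>N)" for u
      unfolding sum by (rule eq)
  qed measurable
  then show ?thesis unfolding factor[OF Y] factor[OF Z] by simp
qed

section \<open>Second moment of a Gaussian field\<close>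

lemma (in prob_space) std_normal_fourth_moment:
  assumes D: "distributed M lborel Y std_normal_density"
  shows "integrable M (\<lambda>x. (Y x) ^ 4)" "(\<integral>x. (Y x) ^ 4 \<partial>M) = 3"
proof -
  have h: "has_bochner_integral lborel (\<lambda>x. std_normal_density x * x ^ 4) 3"
    using std_normal_moment_even[of 2] by (simp add: fact_numeral)
  then have "integrable lborel (\<lambda>x. std_normal_density x * x ^ 4)" by (simp add: has_bochner_integral_iff)
  then show "integrable M (\<lambda>x. (Y x) ^ 4)"
    using distributed_integrable[OF D, of "\<lambda>x. x ^ 4"] by simp
  have "(\<integral>x. (Y x) ^ 4 \<partial>M) = (\<integral>x. std_normal_density x * x ^ 4 \<partial>lborel)"
    using distributed_integral[OF D, of "\<lambda>x. x ^ 4"] by simp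
  then show "(\<integral>x. (Y x) ^ 4 \<partial>M) = 3" using has_bochner_integral_integral_eq[OF h] by simp
qed

text \<open>The fourth-moment identity and the formula for the characteristic function hold for the
  degenerate law too, with variance 0, so later arguments need no case distinction.\<close>

lemma (in prob_space) centered_gaussian_facts:
  assumes Y: "centered_gaussian M Y"
  shows "square_integrable M Y" "square_integrable M (\<lambda>x. (Y x)\<^sup>2)"
    "(\<integral>x. ((Y x)\<^sup>2)\<^sup>2 \<partial>M) = 3 * (\<integral>x. (Y x)\<^sup>2 \<partial>M)\<^sup>2"
    "(\<integral>x. iexp (Y x) \<partial>M) = exp (- complex_of_real (\<integral>x. (Y x)\<^sup>2 \<partial>M) / 2)"
proof -
  have Ym[measurable]: "Y \<in> borel_measurable M" using Y by (simp add: centered_gaussian_def)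
  have "square_integrable M Y \<and> square_integrable M (\<lambda>x. (Y x)\<^sup>2) \<and>
    (\<integral>x. ((Y x)\<^sup>2)\<^sup>2 \<partial>M) = 3 * (\<integral>x. (Y x)\<^sup>2 \<partial>M)\<^sup>2 \<and>
    (\<integral>x. iexp (Y x) \<partial>M) = exp (- complex_of_real (\<integral>x. (Y x)\<^sup>2 \<partial>M) / 2)"
  proof (cases "AE x in M. Y x = 0")
    case True
    have i: "integrable M (\<lambda>x. (Y x)\<^sup>2)" "integrable M (\<lambda>x. ((Y x)\<^sup>2)\<^sup>2)"
      by (rule Bochner_Integration.integrable_cong_AE_imp[of _ "\<lambda>_. 0"]; use True in \<open>auto elim: eventually_mono\<close>)+
    have "(\<integral>x. (Y x)\<^sup>2 \<partial>M) = (\<integral>x. 0 \<partial>M)" "(\<integral>x. ((Y x)\<^sup>2)\<^sup>2 \<partial>M) = (\<integral>x. 0 \<partial>M)"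
      by (rule integral_cong_AE; use True in \<open>auto elim: eventually_mono\<close>)+
    moreover have "(\<integral>x. iexp (Y x) \<partial>M) = (\<integral>x. 1 \<partial>M)"
      by (rule integral_cong_AE) (use True in \<open>auto elim: eventually_mono\<close>)
    ultimately show ?thesis using i by (simp add: square_integrable_real prob_space)
  next
    case False
    then obtain s where s: "0 < s" "distributed M lborel Y (normal_density 0 s)"
      using Y by (auto simp: centered_gaussian_def)
    define Z where "Z x = Y x / s" for x
    have Z: "distributed M lborel Z std_normal_density"
      using s(2) normal_standard_normal_convert[OF s(1), of Y 0] by (simp add: Z_def[abs_def])
    have YZ: "Y x = s * Z x" for x using s by (simp add: Z_def)
    note z = std_normal_facts[OF Z] std_normal_fourth_moment[OF Z]
    have Zm[measurable]: "Z \<in> borel_measurable M" using z(1) by blast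
    have Z4: "((Z x)\<^sup>2)\<^sup>2 = Z x ^ 4" for x by (simp add: power_even_eq)
    have "square_integrable M Y" unfolding YZ[abs_def] by (rule square_integrable_cmult[OF z(1)])
    moreover have "square_integrable M (\<lambda>x. (Y x)\<^sup>2)"
      unfolding YZ power_mult_distrib
      by (rule square_integrable_cmult) (use z(5) in \<open>simp add: square_integrable_real Z4\<close>)
    moreover have v: "(\<integral>x. (Y x)\<^sup>2 \<partial>M) = s\<^sup>2" by (simp add: YZ power_mult_distrib z(3))
    moreover have "(\<integral>x. ((Y x)\<^sup>2)\<^sup>2 \<partial>M) = 3 * (s\<^sup>2)\<^sup>2"
      by (simp add: YZ power_mult_distrib Z4 z(6))
    moreover have "(\<integral>x. iexp (Y x) \<partial>M) = exp (- complex_of_real (s\<^sup>2) / 2)"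
      using z(4)[of s] char_distr[OF Zm, of s] by (simp add: YZ of_real_exp)
    ultimately show ?thesis by simp
  qed
  then show "square_integrable M Y" "square_integrable M (\<lambda>x. (Y x)\<^sup>2)"
    "(\<integral>x. ((Y x)\<^sup>2)\<^sup>2 \<partial>M) = 3 * (\<integral>x. (Y x)\<^sup>2 \<partial>M)\<^sup>2"
    "(\<integral>x. iexp (Y x) \<partial>M) = exp (- complex_of_real (\<integral>x. (Y x)\<^sup>2 \<partial>M) / 2)" by auto
qed

text \<open>Paley--Zygmund: a finite sum of squares of Gaussian variables has \<open>E Y\<^sup>2 \<le> 3 (E Y)\<^sup>2\<close>,
  whatever their joint law, so a bound in probability bounds the mean.\<close>

lemma (in prob_space) gaussian_squares_sum_le:
  assumes "finite F" and Y: "\<And>i. i \<in> F \<Longrightarrow> centered_gaussian M (Y i)"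
    and le: "AE \<omega> in M. (\<Sum>i\<in>F. (Y i \<omega>)\<^sup>2) \<le> q \<omega>" and q[measurable]: "q \<in> borel_measurable M"
    and p: "prob {\<omega>\<in>space M. C < q \<omega>} \<le> 1 / 12" and C: "0 \<le> C"
  shows "(\<Sum>i\<in>F. \<integral>\<omega>. (Y i \<omega>)\<^sup>2 \<partial>M) \<le> 2 * C"
proof -
  define Z where "Z \<omega> = (\<Sum>i\<in>F. (Y i \<omega>)\<^sup>2)" for \<omega>
  define a where "a i = (\<integral>\<omega>. (Y i \<omega>)\<^sup>2 \<partial>M)" for i
  define s where "s = (\<Sum>i\<in>F. a i)"
  have a0: "0 \<le> a i" for i by (simp add: a_def)
  have s0: "0 \<le> s" unfolding s_def by (intro sum_nonneg a0)
  note g = centered_gaussian_facts[OF Y]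
  have Zsq: "square_integrable M Z"
    unfolding Z_def[abs_def] by (intro square_integrable_sum g)
  have Zi: "integrable M Z" by (rule square_integrable_integrable[OF Zsq])
  have Zm[measurable]: "Z \<in> borel_measurable M" using Zsq by blast
  have EZ: "(\<integral>\<omega>. Z \<omega> \<partial>M) = s"
    unfolding Z_def s_def a_def
    by (intro Bochner_Integration.integral_sum square_integrable_integrable g)
  have prod: "(\<integral>\<omega>. (Y i \<omega>)\<^sup>2 * (Y j \<omega>)\<^sup>2 \<partial>M) \<le> 3 * a i * a j" if "i \<in> F" "j \<in> F" for i j
  proof -
    have "(\<integral>\<omega>. (Y i \<omega>)\<^sup>2 * (Y j \<omega>)\<^sup>2 \<partial>M)\<^sup>2 \<le> (3 * (a i)\<^sup>2) * (3 * (a j)\<^sup>2)"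
      using square_integrable_cauchy_schwarz[OF g(2)[OF that(1)] g(2)[OF that(2)]]
      unfolding g(3)[OF that(1)] g(3)[OF that(2)] a_def .
    also have "\<dots> = (3 * a i * a j)\<^sup>2" by (simp add: power2_eq_square)
    finally show ?thesis by (rule power2_le_imp_le) (simp add: a0)
  qed
  have "(\<integral>\<omega>. (Z \<omega>)\<^sup>2 \<partial>M) = (\<Sum>i\<in>F. \<Sum>j\<in>F. \<integral>\<omega>. (Y i \<omega>)\<^sup>2 * (Y j \<omega>)\<^sup>2 \<partial>M)"
    unfolding Z_def power2_eq_square[of "sum _ _"] sum_product
    by (simp add: square_integrable_mult_integrable g)
  also have "\<dots> \<le> (\<Sum>i\<in>F. \<Sum>j\<in>F. 3 * a i * a j)" by (intro sum_mono prod)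
  also have "\<dots> = 3 * s\<^sup>2" by (simp add: s_def power2_eq_square sum_product sum_distrib_left mult_ac)
  finally have Z2: "(\<integral>\<omega>. (Z \<omega>)\<^sup>2 \<partial>M) \<le> 3 * s\<^sup>2" .
  let ?A = "{\<omega>\<in>space M. C < q \<omega>}"
  have A[measurable]: "?A \<in> events" by measurable
  have sqA: "square_integrable M (indicator ?A :: 'a \<Rightarrow> real)" by (rule square_integrable_indicator[OF A])
  have iA: "integrable M (\<lambda>\<omega>. Z \<omega> * indicator ?A \<omega>)"
    by (rule square_integrable_mult_integrable[OF Zsq sqA])
  \<comment> \<open>With E Z^2 \<le> 3 s^2 and a bad event of probability at most 1/12, this is at
    most s^2/4. So the bad event carries at most half of the mean s, and the other half is at most
    C.\<close>
  have "(\<integral>\<omega>. Z \<omega> * indicator ?A \<omega> \<partial>M)\<^sup>2 \<le> (\<integral>\<omega>. (Z \<omega>)\<^sup>2 \<partial>M) * (\<integral>\<omega>. (indicator ?A \<omega>)\<^sup>2 \<partial>M)"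
    by (rule square_integrable_cauchy_schwarz[OF Zsq sqA])
  also have "(\<integral>\<omega>. (indicator ?A \<omega>)\<^sup>2 \<partial>M) = prob ?A"
    using A by (simp add: power2_eq_square flip: indicator_inter_arith)
  also have "(\<integral>\<omega>. (Z \<omega>)\<^sup>2 \<partial>M) * prob ?A \<le> (3 * s\<^sup>2) * (1 / 12)"
    by (intro mult_mono Z2 p) auto
  also have "\<dots> = (s / 2)\<^sup>2" by (simp add: power2_eq_square)
  finally have ZA: "(\<integral>\<omega>. Z \<omega> * indicator ?A \<omega> \<partial>M) \<le> s / 2"
    by (rule power2_le_imp_le) (use s0 in simp)
  have "s = (\<integral>\<omega>. Z \<omega> * indicator ?A \<omega> + (Z \<omega> - Z \<omega> * indicator ?A \<omega>) \<partial>M)" by (simp add: EZ)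
  also have "\<dots> = (\<integral>\<omega>. Z \<omega> * indicator ?A \<omega> \<partial>M) + (\<integral>\<omega>. Z \<omega> - Z \<omega> * indicator ?A \<omega> \<partial>M)"
    using iA Zi by (intro Bochner_Integration.integral_add) auto
  also have "(\<integral>\<omega>. Z \<omega> - Z \<omega> * indicator ?A \<omega> \<partial>M) \<le> (\<integral>\<omega>. C \<partial>M)"
  proof (rule integral_mono_AE)
    show "AE \<omega> in M. Z \<omega> - Z \<omega> * indicator ?A \<omega> \<le> C"
      using le AE_space by eventually_elim (use C in \<open>auto simp: indicator_def Z_def[symmetric]\<close>)
  qed (use iA Zi in auto)
  finally have "s \<le> s / 2 + C" using ZA by (simp add: prob_space)
  then show ?thesis by (simp add: s_def a_def)
qed

section \<open>Finite-rank approximation and the second moment\<close>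

lemma square_integrable_pair_product:
  fixes a :: "'a \<Rightarrow> real" and b :: "'x \<Rightarrow> real"
  assumes "prob_space M" "prob_space \<mu>" and ab: "square_integrable M a" "square_integrable \<mu> b"
  shows "square_integrable (M \<Otimes>\<^sub>M \<mu>) (\<lambda>z. a (fst z) * b (snd z))"
    "(\<integral>z. (a (fst z) * b (snd z))\<^sup>2 \<partial>(M \<Otimes>\<^sub>M \<mu>)) \<le> (\<integral>\<omega>. (a \<omega>)\<^sup>2 \<partial>M) * (\<integral>x. (b x)\<^sup>2 \<partial>\<mu>)"
proof -
  interpret M: prob_space M by fact
  interpret \<mu>: prob_space \<mu> by fact
  have [measurable]: "a \<in> borel_measurable M" "b \<in> borel_measurable \<mu>" using ab by auto
  have m: "(\<lambda>z. a (fst z) * b (snd z)) \<in> borel_measurable (M \<Otimes>\<^sub>M \<mu>)" by measurable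
  have "(\<integral>\<^sup>+z. ennreal ((a (fst z) * b (snd z))\<^sup>2) \<partial>(M \<Otimes>\<^sub>M \<mu>)) =
      (\<integral>\<^sup>+\<omega>. \<integral>\<^sup>+x. ennreal ((a \<omega>)\<^sup>2) * ennreal ((b x)\<^sup>2) \<partial>\<mu> \<partial>M)"
    by (subst \<mu>.nn_integral_fst[symmetric]) (auto simp: power_mult_distrib ennreal_mult)
  also have "\<dots> = (\<integral>\<^sup>+\<omega>. ennreal ((a \<omega>)\<^sup>2) \<partial>M) * (\<integral>\<^sup>+x. ennreal ((b x)\<^sup>2) \<partial>\<mu>)"
    by (simp add: nn_integral_cmult nn_integral_multc)
  also have "\<dots> = ennreal ((\<integral>\<omega>. (a \<omega>)\<^sup>2 \<partial>M) * (\<integral>x. (b x)\<^sup>2 \<partial>\<mu>))"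
    by (simp add: nn_integral_square_integrable ab ennreal_mult)
  finally have nn: "(\<integral>\<^sup>+z. ennreal ((a (fst z) * b (snd z))\<^sup>2) \<partial>(M \<Otimes>\<^sub>M \<mu>)) \<le>
      ennreal ((\<integral>\<omega>. (a \<omega>)\<^sup>2 \<partial>M) * (\<integral>x. (b x)\<^sup>2 \<partial>\<mu>))" by simp
  show "square_integrable (M \<Otimes>\<^sub>M \<mu>) (\<lambda>z. a (fst z) * b (snd z))"
    "(\<integral>z. (a (fst z) * b (snd z))\<^sup>2 \<partial>(M \<Otimes>\<^sub>M \<mu>)) \<le> (\<integral>\<omega>. (a \<omega>)\<^sup>2 \<partial>M) * (\<integral>x. (b x)\<^sup>2 \<partial>\<mu>)"
    by (rule square_integrable_if_nn_integral[OF m nn]; simp)+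
qed

lemma real_orthonormal_basis_dense:
  assumes ob: "real_orthonormal_basis \<mu> I e" and \<phi>: "square_integrable \<mu> \<phi>" and \<epsilon>: "0 < \<epsilon>"
  shows "\<exists>F c. finite F \<and> F \<subseteq> I \<and> (\<integral>x. (\<phi> x - (\<Sum>i\<in>F. c i * e i x))\<^sup>2 \<partial>\<mu>) \<le> \<epsilon>"
proof -
  define c where "c i = (\<integral>y. \<phi> y * e i y \<partial>\<mu>)" for i
  have e: "square_integrable \<mu> (e i)" if "i \<in> I" for i using ob that by (simp add: real_orthonormal_basis_def)
  have "((\<lambda>F. \<integral>\<^sup>+ x. ennreal ((norm (\<phi> x - (\<Sum>i\<in>F. c i * e i x)))\<^sup>2) \<partial>\<mu>) \<longlongrightarrow> 0) (finite_subsets_at_top I)"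
    using ob \<phi> by (simp add: real_orthonormal_basis_def L2_has_sum_def c_def)
  from order_tendstoD(2)[OF this, of "ennreal \<epsilon>"] \<epsilon>
  have "\<forall>\<^sub>F F in finite_subsets_at_top I. (\<integral>\<^sup>+ x. ennreal ((norm (\<phi> x - (\<Sum>i\<in>F. c i * e i x)))\<^sup>2) \<partial>\<mu>) < ennreal \<epsilon>"
    by simp
  then obtain F where F: "finite F" "F \<subseteq> I" "(\<integral>\<^sup>+ x. ennreal ((norm (\<phi> x - (\<Sum>i\<in>F. c i * e i x)))\<^sup>2) \<partial>\<mu>) < ennreal \<epsilon>"
    unfolding eventually_finite_subsets_at_top by blast
  have sq: "square_integrable \<mu> (\<lambda>x. \<phi> x - (\<Sum>i\<in>F. c i * e i x))"
    by (intro square_integrable_diff square_integrable_sum square_integrable_cmult \<phi> e) (use F in auto)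
  have "(\<integral>x. (\<phi> x - (\<Sum>i\<in>F. c i * e i x))\<^sup>2 \<partial>\<mu>) \<le> \<epsilon>"
    using F(3) \<epsilon> by (intro square_integrable_if_nn_integral(2) square_integrable_measurable[OF sq]) auto
  then show ?thesis using F by blast
qed

text \<open>Only the variable x is expanded in the basis, and the coefficients are arbitrary square
  integrable variables. Each function involves finitely many basis elements, whatever the size of
  \<open>I\<close>.\<close>

definition finite_rank :: "'a measure \<Rightarrow> 'i set \<Rightarrow> ('i \<Rightarrow> 'x \<Rightarrow> real) \<Rightarrow> ('a \<times> 'x \<Rightarrow> real) set" where
  "finite_rank M I e = {\<lambda>z. \<Sum>i\<in>F. a i (fst z) * e i (snd z) | F a.
     finite F \<and> F \<subseteq> I \<and> (\<forall>i. square_integrable M (a i))}"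

text \<open>For a rectangle A x B, the indicator of B is expanded in the basis and that of A becomes
  part of the coefficients.\<close>

lemma finite_rank_dense:
  fixes e :: "'i \<Rightarrow> 'x \<Rightarrow> real"
  assumes "prob_space M" "prob_space \<mu>" and ob: "real_orthonormal_basis \<mu> I e"
    and u: "square_integrable (M \<Otimes>\<^sub>M \<mu>) u" and \<epsilon>: "0 < \<epsilon>"
  shows "\<exists>s\<in>finite_rank M I e. (\<integral>z. (u z - s z)\<^sup>2 \<partial>(M \<Otimes>\<^sub>M \<mu>)) \<le> \<epsilon>"
proof -
  interpret M: prob_space M by fact
  interpret \<mu>: prob_space \<mu> by fact
  interpret P: pair_prob_space M \<mu> ..
  have e: "square_integrable \<mu> (e i)" if "i \<in> I" for i using ob that by (simp add: real_orthonormal_basis_def)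
  have rect: "\<exists>s\<in>finite_rank M I e. (\<integral>z. (indicator (A \<times> B) z - s z)\<^sup>2 \<partial>(M \<Otimes>\<^sub>M \<mu>)) \<le> \<epsilon>"
    if A: "A \<in> sets M" and B: "B \<in> sets \<mu>" and \<epsilon>: "0 < \<epsilon>" for A B \<epsilon>
  proof -
    obtain F c where F: "finite F" "F \<subseteq> I" "(\<integral>x. (indicator B x - (\<Sum>i\<in>F. c i * e i x))\<^sup>2 \<partial>\<mu>) \<le> \<epsilon>"
      using real_orthonormal_basis_dense[OF ob \<mu>.square_integrable_indicator[OF B] \<epsilon>] by blast
    define s where "s z = (\<Sum>i\<in>F. (c i * indicator A (fst z)) * e i (snd z))" for z
    have sA: "square_integrable M (indicator A :: 'a \<Rightarrow> real)" by (rule M.square_integrable_indicator[OF A])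
    have s: "s \<in> finite_rank M I e"
      unfolding finite_rank_def s_def
      by (intro CollectI exI[of _ F] exI[of _ "\<lambda>i \<omega>. c i * indicator A \<omega>"] conjI allI F refl square_integrable_cmult sA ext)
    have s_eq: "indicator (A \<times> B) z - s z = indicator A (fst z) * (indicator B (snd z) - (\<Sum>i\<in>F. c i * e i (snd z)))" for z
      by (simp add: s_def indicator_times right_diff_distrib sum_distrib_left mult_ac)
    have "(\<integral>z. (indicator A (fst z) * (indicator B (snd z) - (\<Sum>i\<in>F. c i * e i (snd z))))\<^sup>2 \<partial>(M \<Otimes>\<^sub>M \<mu>)) \<le> \<epsilon>"
    proof -
      have sB: "square_integrable \<mu> (\<lambda>x. indicator B x - (\<Sum>i\<in>F. c i * e i x))"
        using F by (intro square_integrable_diff \<mu>.square_integrable_indicator[OF B] square_integrable_sum square_integrable_cmult e) auto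
      have "(\<integral>\<omega>. (indicator A \<omega>)\<^sup>2 \<partial>M) = M.prob A"
        using A by (simp add: power2_eq_square flip: indicator_inter_arith)
      then have "(\<integral>\<omega>. (indicator A \<omega>)\<^sup>2 \<partial>M) \<le> (1::real)" by simp
      then have "(\<integral>\<omega>. (indicator A \<omega>)\<^sup>2 \<partial>M) * (\<integral>x. (indicator B x - (\<Sum>i\<in>F. c i * e i x))\<^sup>2 \<partial>\<mu>) \<le> 1 * \<epsilon>"
        by (intro mult_mono F(3)) auto
      then show ?thesis
        using square_integrable_pair_product(2)[OF assms(1,2) sA sB] by linarith
    qed
    then show ?thesis unfolding s_eq[symmetric] by (rule bexI[OF _ s])
  qed
  show ?thesis
  proof (rule P.square_integrable_dense[OF u Int_stable_pair_measure_generator[of M \<mu>] _ _ _ _ _ _ _ \<epsilon>])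
    show "{a \<times> b |a b. a \<in> sets M \<and> b \<in> sets \<mu>} \<subseteq> Pow (space (M \<Otimes>\<^sub>M \<mu>))"
      unfolding space_pair_measure by (rule pair_measure_closed)
    show "sets (M \<Otimes>\<^sub>M \<mu>) = sigma_sets (space (M \<Otimes>\<^sub>M \<mu>)) {a \<times> b |a b. a \<in> sets M \<and> b \<in> sets \<mu>}"
      unfolding space_pair_measure by (rule sets_pair_measure)
    show "\<exists>s\<in>finite_rank M I e. (\<integral>z. (indicator (space (M \<Otimes>\<^sub>M \<mu>)) z - s z)\<^sup>2 \<partial>(M \<Otimes>\<^sub>M \<mu>)) \<le> \<epsilon>" if "0 < \<epsilon>" for \<epsilon>
      unfolding space_pair_measure by (rule rect) (use that in auto)
    show "\<exists>s\<in>finite_rank M I e. (\<integral>z. (indicator A z - s z)\<^sup>2 \<partial>(M \<Otimes>\<^sub>M \<mu>)) \<le> \<epsilon>"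
      if "A \<in> {a \<times> b |a b. a \<in> sets M \<and> b \<in> sets \<mu>}" "0 < \<epsilon>" for A \<epsilon>
      using that rect by auto
  next
    fix s assume "s \<in> finite_rank M I e"
    then obtain F a where s: "s = (\<lambda>z. \<Sum>i\<in>F. a i (fst z) * e i (snd z))" "finite F" "F \<subseteq> I"
      "\<And>i. square_integrable M (a i)" by (auto simp: finite_rank_def)
    show "square_integrable (M \<Otimes>\<^sub>M \<mu>) s"
      unfolding s(1) using s(3)
      by (intro square_integrable_sum square_integrable_pair_product(1) assms s e) auto
    show "(\<lambda>z. c * s z) \<in> finite_rank M I e" for c
      unfolding finite_rank_def s(1)
      by (intro CollectI exI[of _ F] exI[of _ "\<lambda>i \<omega>. c * a i \<omega>"] conjI allI s square_integrable_cmult ext)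
         (simp add: sum_distrib_left mult_ac)
    fix t assume "t \<in> finite_rank M I e"
    then obtain G b where t: "t = (\<lambda>z. \<Sum>i\<in>G. b i (fst z) * e i (snd z))" "finite G" "G \<subseteq> I"
      "\<And>i. square_integrable M (b i)" by (auto simp: finite_rank_def)
    \<comment> \<open>Padding coefficients with zeros allows two sums over different finite sets to
      be added.\<close>
    have ext: "(\<Sum>i\<in>F \<union> G. (if i \<in> H then x i else 0) * y i) = (\<Sum>i\<in>H. x i * y i)"
      if "H \<subseteq> F \<union> G" for H and x y :: "'i \<Rightarrow> real"
    proof -
      have "(\<Sum>i\<in>F \<union> G. (if i \<in> H then x i else 0) * y i) = (\<Sum>i\<in>H. (if i \<in> H then x i else 0) * y i)"
        by (rule sum.mono_neutral_right) (use s(2) t(2) that in auto)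
      then show ?thesis by simp
    qed
    show "(\<lambda>z. s z + t z) \<in> finite_rank M I e"
      unfolding finite_rank_def
    proof (intro CollectI exI[of _ "F \<union> G"]
        exI[of _ "\<lambda>i \<omega>. (if i \<in> F then a i \<omega> else 0) + (if i \<in> G then b i \<omega> else 0)"] conjI allI)
      show "(\<lambda>z. s z + t z) = (\<lambda>z. \<Sum>i\<in>F \<union> G. ((if i \<in> F then a i (fst z) else 0) + (if i \<in> G then b i (fst z) else 0)) * e i (snd z))"
        by (simp add: s(1) t(1) distrib_right sum.distrib ext)
      show "square_integrable M (\<lambda>\<omega>. (if i \<in> F then a i \<omega> else 0) + (if i \<in> G then b i \<omega> else 0))" for i
        using s(4)[of i] t(4)[of i] by (cases "i \<in> F"; cases "i \<in> G"; simp add: square_integrable_add)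
    qed (use s t in auto)
  qed
qed


text \<open>The coefficients are arbitrary since those of a finite-rank approximant need not be
  Fourier coefficients; for Fourier coefficients it yields Bessel's inequality.\<close>

lemma orthonormal_distance:
  fixes e :: "'i \<Rightarrow> 'x \<Rightarrow> real"
  assumes F: "finite F" "\<And>i. i \<in> F \<Longrightarrow> square_integrable M (e i)"
    "\<And>i j. i \<in> F \<Longrightarrow> j \<in> F \<Longrightarrow> (\<integral>x. e i x * e j x \<partial>M) = (if i = j then 1 else 0)"
    and u: "square_integrable M u"
  shows "(\<integral>x. (u x - (\<Sum>i\<in>F. a i * e i x))\<^sup>2 \<partial>M) =
    (\<integral>x. (u x)\<^sup>2 \<partial>M) + (\<Sum>i\<in>F. (a i)\<^sup>2 - 2 * a i * (\<integral>x. u x * e i x \<partial>M))"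
proof -
  let ?s = "\<lambda>x. \<Sum>i\<in>F. a i * e i x"
  have s: "square_integrable M ?s" by (intro square_integrable_sum square_integrable_cmult F)
  have "(\<integral>x. u x * ?s x \<partial>M) = (\<integral>x. (\<Sum>i\<in>F. a i * (u x * e i x)) \<partial>M)"
    by (simp add: sum_distrib_left mult_ac)
  also have "\<dots> = (\<Sum>i\<in>F. a i * (\<integral>x. u x * e i x \<partial>M))"
    by (simp add: square_integrable_mult_integrable u F)
  finally have us: "(\<integral>x. u x * ?s x \<partial>M) = (\<Sum>i\<in>F. a i * (\<integral>x. u x * e i x \<partial>M))" .
  have ss: "(\<integral>x. ?s x * ?s x \<partial>M) = (\<Sum>i\<in>F. a i * a i)"
    by (rule orthonormal_inner[OF F])
  have lin: "(\<integral>x. (u x - v x)\<^sup>2 \<partial>M) = (\<integral>x. (u x)\<^sup>2 \<partial>M) - 2 * (\<integral>x. u x * v x \<partial>M) + (\<integral>x. v x * v x \<partial>M)"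
    if v: "square_integrable M v" for v
  proof -
    have "(\<integral>x. (u x - v x)\<^sup>2 \<partial>M) = (\<integral>x. (u x)\<^sup>2 - 2 * (u x * v x) + v x * v x \<partial>M)"
      by (intro Bochner_Integration.integral_cong refl) (simp add: power2_eq_square algebra_simps)
    moreover have "integrable M (\<lambda>x. (u x)\<^sup>2)" using u by (simp add: square_integrable_real)
    ultimately show ?thesis by (simp add: square_integrable_mult_integrable u v)
  qed
  show ?thesis
    unfolding lin[OF s] us ss
    by (simp add: sum_subtractf sum_distrib_left power2_eq_square mult_ac)
qed

text \<open>Bessel's inequality and the Paley-Zygmund bound control the sum of E <T, e_i>^2 over
  every finite set of indices by one constant. A finite-rank approximant then bounds the second
  moment of the truncated field by this constant plus the error, because completing the square
  compares its coefficients with <T, e_i>. Fatou's lemma removes the truncation.\<close>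

theorem gaussian_field_second_moment:
  fixes t :: "'x \<Rightarrow> 'a \<Rightarrow> real" and e :: "'i \<Rightarrow> 'x \<Rightarrow> real"
  assumes "prob_space M" "prob_space \<mu>" and ob: "real_orthonormal_basis \<mu> I e"
    and t[measurable]: "(\<lambda>(\<omega>, x). t x \<omega>) \<in> borel_measurable (M \<Otimes>\<^sub>M \<mu>)"
    and as: "AE \<omega> in M. square_integrable \<mu> (\<lambda>x. t x \<omega>)"
    and gauss: "\<And>h. square_integrable \<mu> h \<Longrightarrow> centered_gaussian M (\<lambda>\<omega>. \<integral>x. t x \<omega> * h x \<partial>\<mu>)"
  shows "square_integrable (M \<Otimes>\<^sub>M \<mu>) (\<lambda>z. t (snd z) (fst z))"
proof -
  interpret M: prob_space M by fact
  interpret \<mu>: prob_space \<mu> by fact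
  interpret P: pair_prob_space M \<mu> ..
  have e: "square_integrable \<mu> (e i)" if "i \<in> I" for i using ob that by (simp add: real_orthonormal_basis_def)
  have on: "(\<integral>x. e i x * e j x \<partial>\<mu>) = (if i = j then 1 else 0)" if "i \<in> I" "j \<in> I" for i j
    using ob that by (simp add: real_orthonormal_basis_def)
  have tm[measurable]: "(\<lambda>z. t (snd z) (fst z)) \<in> borel_measurable (M \<Otimes>\<^sub>M \<mu>)"
    using t by (simp add: case_prod_unfold)
  have tsec: "(\<lambda>x. t x \<omega>) \<in> borel_measurable \<mu>" if "\<omega> \<in> space M" for \<omega>
    using measurable_Pair2[OF t that] by simp
  \<comment> \<open>As a Bochner integral \<open>q\<close> has the default value 0 where the section
    is not square integrable, while \<open>qn\<close> is infinite there. So \<open>q\<close> is a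
    finite bound on the almost sure event, and \<open>qn\<close> detects the exceptional
    one.\<close>
  define q where "q \<omega> = (\<integral>x. (t x \<omega>)\<^sup>2 \<partial>\<mu>)" for \<omega>
  define qn where "qn \<omega> = (\<integral>\<^sup>+x. ennreal ((t x \<omega>)\<^sup>2) \<partial>\<mu>)" for \<omega>
  have [measurable]: "q \<in> borel_measurable M" "qn \<in> borel_measurable M"
    unfolding q_def[abs_def] qn_def[abs_def] by measurable
  define A where "A n = {\<omega>\<in>space M. real n < q \<omega>}" for n
  have [measurable]: "A n \<in> sets M" for n unfolding A_def by measurable
  \<comment> \<open>\<open>q\<close> is real valued, so these events decrease to the empty set, and
    some threshold meets the 1/12 of \<open>gaussian_squares_sum_le\<close>.\<close>
  have "(\<lambda>n. M.prob (A n)) \<longlonglongrightarrow> M.prob (\<Inter>n. A n)"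
    by (intro M.finite_Lim_measure_decseq) (auto simp: A_def decseq_def intro: le_less_trans of_nat_mono)
  moreover have "(\<Inter>n. A n) = {}"
  proof -
    have "\<exists>n. q \<omega> \<le> real n" for \<omega> by (rule real_arch_simple)
    then show ?thesis by (auto simp: A_def not_less[symmetric])
  qed
  ultimately have "(\<lambda>n. M.prob (A n)) \<longlonglongrightarrow> 0" by simp
  from order_tendstoD(2)[OF this, of "1/12"] obtain n where n: "M.prob (A n) < 1 / 12"
    by (auto simp: eventually_sequentially)
  define C where "C = real n"
  define Y where "Y i \<omega> = (\<integral>x. t x \<omega> * e i x \<partial>\<mu>)" for i \<omega>
  have Yg: "centered_gaussian M (Y i)" if "i \<in> I" for i unfolding Y_def[abs_def] by (rule gauss[OF e[OF that]])
  have bessel: "(\<Sum>i\<in>F. (\<integral>x. u x * e i x \<partial>\<mu>)\<^sup>2) \<le> (\<integral>x. (u x)\<^sup>2 \<partial>\<mu>)"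
    if F: "finite F" "F \<subseteq> I" and u: "square_integrable \<mu> u" for F u
  proof -
    note F' = e[OF subsetD[OF F(2)]] on[OF subsetD[OF F(2)] subsetD[OF F(2)]]
    have "0 \<le> (\<integral>x. (u x - (\<Sum>i\<in>F. (\<integral>x. u x * e i x \<partial>\<mu>) * e i x))\<^sup>2 \<partial>\<mu>)" by simp
    also have "\<dots> = (\<integral>x. (u x)\<^sup>2 \<partial>\<mu>) + (\<Sum>i\<in>F. (\<integral>x. u x * e i x \<partial>\<mu>)\<^sup>2 -
        2 * (\<integral>x. u x * e i x \<partial>\<mu>) * (\<integral>x. u x * e i x \<partial>\<mu>))"
      by (rule orthonormal_distance[OF F(1) F' u])
    also have "\<dots> = (\<integral>x. (u x)\<^sup>2 \<partial>\<mu>) - (\<Sum>i\<in>F. (\<integral>x. u x * e i x \<partial>\<mu>)\<^sup>2)"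
      by (simp add: power2_eq_square sum_negf)
    finally show ?thesis by simp
  qed
  have sumY: "(\<Sum>i\<in>F. \<integral>\<omega>. (Y i \<omega>)\<^sup>2 \<partial>M) \<le> 2 * C" if F: "finite F" "F \<subseteq> I" for F
  proof (rule M.gaussian_squares_sum_le[where q = q])
    show "AE \<omega> in M. (\<Sum>i\<in>F. (Y i \<omega>)\<^sup>2) \<le> q \<omega>"
      using as by eventually_elim (use bessel[OF F] in \<open>simp add: Y_def q_def\<close>)
    show "M.prob {\<omega> \<in> space M. C < q \<omega>} \<le> 1 / 12" using n by (simp add: A_def C_def)
  qed (use F Yg in \<open>auto simp: C_def\<close>)
  \<comment> \<open>Setting the field to 0 where its squared norm exceeds m makes it square
    integrable on the product.\<close>
  define tr where "tr m z = (if qn (fst z) \<le> of_nat m then t (snd z) (fst z) else 0)" for m :: nat and z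
  have trm[measurable]: "tr m \<in> borel_measurable (M \<Otimes>\<^sub>M \<mu>)" for m
    unfolding tr_def[abs_def] by measurable
  have tr_nn: "(\<integral>\<^sup>+z. ennreal ((tr m z)\<^sup>2) \<partial>(M \<Otimes>\<^sub>M \<mu>)) = (\<integral>\<^sup>+\<omega>. (if qn \<omega> \<le> of_nat m then qn \<omega> else 0) \<partial>M)" for m
    by (subst \<mu>.nn_integral_fst[symmetric]) (auto simp: tr_def qn_def intro!: nn_integral_cong)
  have trsq: "square_integrable (M \<Otimes>\<^sub>M \<mu>) (tr m)" for m
  proof (rule square_integrable_if_nn_integral(1)[OF trm, of _ "real m"])
    have "(\<integral>\<^sup>+\<omega>. (if qn \<omega> \<le> of_nat m then qn \<omega> else 0) \<partial>M) \<le> (\<integral>\<^sup>+\<omega>. of_nat m \<partial>M)"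
      by (intro nn_integral_mono) auto
    then show "(\<integral>\<^sup>+z. ennreal ((tr m z)\<^sup>2) \<partial>(M \<Otimes>\<^sub>M \<mu>)) \<le> ennreal (real m)"
      by (simp add: tr_nn M.emeasure_space_1 ennreal_of_nat_eq_real_of_nat)
  qed simp
  have tr_le: "(\<integral>z. (tr m z)\<^sup>2 \<partial>(M \<Otimes>\<^sub>M \<mu>)) \<le> 2 * C + \<epsilon>" if \<epsilon>: "0 < \<epsilon>" for m \<epsilon>
  proof -
    obtain s where s: "s \<in> finite_rank M I e" "(\<integral>z. (tr m z - s z)\<^sup>2 \<partial>(M \<Otimes>\<^sub>M \<mu>)) \<le> \<epsilon>"
      using finite_rank_dense[OF assms(1-3) trsq \<epsilon>] by blast
    then obtain F a where F: "s = (\<lambda>z. \<Sum>i\<in>F. a i (fst z) * e i (snd z))" "finite F" "F \<subseteq> I"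
      "\<And>i. square_integrable M (a i)" by (auto simp: finite_rank_def)
    note eF = e[OF subsetD[OF F(3)]] on[OF subsetD[OF F(3)] subsetD[OF F(3)]]
    have ssq: "square_integrable (M \<Otimes>\<^sub>M \<mu>) s"
      unfolding F(1) by (intro square_integrable_sum square_integrable_pair_product(1) assms F(4) eF)
    have i1: "integrable (M \<Otimes>\<^sub>M \<mu>) (\<lambda>(\<omega>, x). (tr m (\<omega>, x) - s (\<omega>, x))\<^sup>2)"
      and i2: "integrable (M \<Otimes>\<^sub>M \<mu>) (\<lambda>(\<omega>, x). (tr m (\<omega>, x))\<^sup>2)"
      using square_integrable_diff[OF trsq ssq] trsq by (auto simp: square_integrable_real case_prod_unfold)
    have Yi: "integrable M (\<lambda>\<omega>. (Y i \<omega>)\<^sup>2)" if "i \<in> F" for i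
      using M.centered_gaussian_facts(1)[OF Yg[OF subsetD[OF F(3) that]]] by (simp add: square_integrable_real)
    then have i3: "integrable M (\<lambda>\<omega>. \<Sum>i\<in>F. (Y i \<omega>)\<^sup>2)" by simp
    \<comment> \<open>For a coefficient a and c = <tr, e_i>, completing the square gives a^2 - 2ac
      \<ge> -c^2, and c is either \<open>Y i \<omega>\<close> or 0 because of the
      truncation.\<close>
    have pt: "(\<integral>x. (tr m (\<omega>, x))\<^sup>2 \<partial>\<mu>) - (\<Sum>i\<in>F. (Y i \<omega>)\<^sup>2) \<le> (\<integral>x. (tr m (\<omega>, x) - s (\<omega>, x))\<^sup>2 \<partial>\<mu>)"
      if \<omega>: "\<omega> \<in> space M" for \<omega>
    proof -
      have sec: "square_integrable \<mu> (\<lambda>x. tr m (\<omega>, x))"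
      proof (cases "qn \<omega> \<le> of_nat m")
        case True
        then have "square_integrable \<mu> (\<lambda>x. t x \<omega>)"
          by (intro square_integrable_if_nn_integral(1)[OF tsec[OF \<omega>], of "real m"])
             (auto simp: qn_def ennreal_of_nat_eq_real_of_nat)
        then show ?thesis using True by (simp add: tr_def)
      qed (simp add: tr_def)
      have c: "(\<integral>x. tr m (\<omega>, x) * e i x \<partial>\<mu>)\<^sup>2 \<le> (Y i \<omega>)\<^sup>2" for i
        by (cases "qn \<omega> \<le> of_nat m") (auto simp: tr_def Y_def)
      have "- (Y i \<omega>)\<^sup>2 \<le> (a i \<omega>)\<^sup>2 - 2 * a i \<omega> * (\<integral>x. tr m (\<omega>, x) * e i x \<partial>\<mu>)" for i
      proof -
        have "0 \<le> (a i \<omega> - (\<integral>x. tr m (\<omega>, x) * e i x \<partial>\<mu>))\<^sup>2" by simp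
        then show ?thesis using c[of i] by (simp add: power2_diff)
      qed
      then have "- (\<Sum>i\<in>F. (Y i \<omega>)\<^sup>2) \<le> (\<Sum>i\<in>F. (a i \<omega>)\<^sup>2 - 2 * a i \<omega> * (\<integral>x. tr m (\<omega>, x) * e i x \<partial>\<mu>))"
        unfolding sum_negf[symmetric] by (intro sum_mono)
      then show ?thesis
        using orthonormal_distance[OF F(2) eF sec, of "\<lambda>i. a i \<omega>"] by (simp add: F(1))
    qed
    have "(\<integral>z. (tr m z)\<^sup>2 \<partial>(M \<Otimes>\<^sub>M \<mu>)) - (\<Sum>i\<in>F. \<integral>\<omega>. (Y i \<omega>)\<^sup>2 \<partial>M) =
        (\<integral>\<omega>. (\<integral>x. (tr m (\<omega>, x))\<^sup>2 \<partial>\<mu>) - (\<Sum>i\<in>F. (Y i \<omega>)\<^sup>2) \<partial>M)"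
    proof -
      have "(\<integral>\<omega>. (\<Sum>i\<in>F. (Y i \<omega>)\<^sup>2) \<partial>M) = (\<Sum>i\<in>F. \<integral>\<omega>. (Y i \<omega>)\<^sup>2 \<partial>M)"
        by (intro Bochner_Integration.integral_sum Yi)
      moreover have "(\<integral>\<omega>. \<integral>x. (tr m (\<omega>, x))\<^sup>2 \<partial>\<mu> \<partial>M) = (\<integral>z. (tr m z)\<^sup>2 \<partial>(M \<Otimes>\<^sub>M \<mu>))"
        using P.integral_fst[OF i2] by (simp add: case_prod_unfold)
      ultimately show ?thesis
        using P.integrable_fst[OF i2] i3 by simp
    qed
    also have "\<dots> \<le> (\<integral>\<omega>. (\<integral>x. (tr m (\<omega>, x) - s (\<omega>, x))\<^sup>2 \<partial>\<mu>) \<partial>M)"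
      by (rule integral_mono[OF Bochner_Integration.integrable_diff[OF P.integrable_fst[OF i2] i3] P.integrable_fst[OF i1] pt])
    also have "\<dots> = (\<integral>z. (tr m z - s z)\<^sup>2 \<partial>(M \<Otimes>\<^sub>M \<mu>))"
      using P.integral_fst[OF i1] by (simp add: case_prod_unfold)
    also have "\<dots> \<le> \<epsilon>" by (rule s(2))
    finally show ?thesis using sumY[OF F(2,3)] by simp
  qed
  have tr_le': "(\<integral>z. (tr m z)\<^sup>2 \<partial>(M \<Otimes>\<^sub>M \<mu>)) \<le> 2 * C" for m
    by (rule field_le_epsilon) (rule tr_le)
  have "(\<integral>\<^sup>+z. ennreal ((t (snd z) (fst z))\<^sup>2) \<partial>(M \<Otimes>\<^sub>M \<mu>)) = (\<integral>\<^sup>+\<omega>. qn \<omega> \<partial>M)"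
    by (subst \<mu>.nn_integral_fst[symmetric]) (auto simp: qn_def[abs_def])
  also have "\<dots> = (\<integral>\<^sup>+\<omega>. liminf (\<lambda>m. if qn \<omega> \<le> of_nat m then qn \<omega> else 0) \<partial>M)"
  proof (intro nn_integral_cong_AE, use as in eventually_elim)
    case (elim \<omega>)
    have "qn \<omega> = ennreal (q \<omega>)" unfolding qn_def q_def by (rule nn_integral_square_integrable[OF elim])
    moreover obtain l where "q \<omega> \<le> real l" using real_arch_simple by blast
    ultimately have le: "qn \<omega> \<le> of_nat l" by (simp add: ennreal_of_nat_eq_real_of_nat ennreal_leI)
    have "(\<lambda>m. if qn \<omega> \<le> of_nat m then qn \<omega> else 0) \<longlonglongrightarrow> qn \<omega>"
    proof (rule tendsto_eventually, rule eventually_sequentiallyI[of l])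
      fix m assume "l \<le> m"
      then have "qn \<omega> \<le> of_nat m" using le by (meson of_nat_mono order_trans)
      then show "(if qn \<omega> \<le> of_nat m then qn \<omega> else 0) = qn \<omega>" by simp
    qed
    from lim_imp_Liminf[OF _ this] show ?case by simp
  qed
  also have "\<dots> \<le> liminf (\<lambda>m. \<integral>\<^sup>+\<omega>. (if qn \<omega> \<le> of_nat m then qn \<omega> else 0) \<partial>M)"
    by (intro nn_integral_liminf) measurable
  also have "\<dots> \<le> ennreal (2 * C)"
  proof (rule Liminf_le)
    have "(\<integral>\<^sup>+\<omega>. (if qn \<omega> \<le> of_nat m then qn \<omega> else 0) \<partial>M) \<le> ennreal (2 * C)" for m
      unfolding tr_nn[symmetric] nn_integral_square_integrable[OF trsq] by (rule ennreal_leI[OF tr_le'])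
    then show "\<forall>\<^sub>F m in sequentially. (\<integral>\<^sup>+\<omega>. (if qn \<omega> \<le> of_nat m then qn \<omega> else 0) \<partial>M) \<le> ennreal (2 * C)"
      by (intro always_eventually allI)
  qed simp
  finally show ?thesis by (rule square_integrable_if_nn_integral(1)[OF tm]) (simp add: C_def)
qed

section \<open>The representation theorem\<close>

lemma centered_gaussian_cong:
  assumes "\<And>\<omega>. \<omega> \<in> space M \<Longrightarrow> Y \<omega> = Z \<omega>" "centered_gaussian M Y"
  shows "centered_gaussian M Z"
proof -
  have m: "Y \<in> measurable M N \<longleftrightarrow> Z \<in> measurable M N" for N by (rule measurable_cong[OF assms(1)])
  have d: "distr M lborel Y = distr M lborel Z" by (rule distr_cong) (use assms(1) in auto)
  have ae: "(AE \<omega> in M. Y \<omega> = 0) \<longleftrightarrow> (AE \<omega> in M. Z \<omega> = 0)"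
    by (rule AE_cong) (simp add: assms(1))
  show ?thesis using assms(2) unfolding centered_gaussian_def distributed_def m d ae .
qed

lemma cnj_borel_measurable [measurable]: "cnj \<in> borel_measurable borel"
  by (intro borel_measurable_continuous_onI continuous_intros)

lemma square_integrable_Re_mult:
  assumes "square_integrable \<mu> (h :: 'x \<Rightarrow> complex)"
  shows "square_integrable \<mu> (\<lambda>x. Re (c * cnj (h x)))"
proof -
  have [measurable]: "h \<in> borel_measurable \<mu>" and i: "integrable \<mu> (\<lambda>x. (norm (h x))\<^sup>2)"
    using assms by (auto simp: square_integrable_def)
  have "integrable \<mu> (\<lambda>x. (norm c)\<^sup>2 * (norm (h x))\<^sup>2)" using i by simp
  then have "integrable \<mu> (\<lambda>x. (Re (c * cnj (h x)))\<^sup>2)"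
  proof (rule Bochner_Integration.integrable_bound)
    show "AE x in \<mu>. norm ((Re (c * cnj (h x)))\<^sup>2) \<le> norm ((norm c)\<^sup>2 * (norm (h x))\<^sup>2)"
    proof (rule AE_I2)
      fix x
      have "\<bar>Re (c * cnj (h x))\<bar>\<^sup>2 \<le> (norm (c * cnj (h x)))\<^sup>2"
        by (intro power_mono abs_Re_le_cmod) simp
      then show "norm ((Re (c * cnj (h x)))\<^sup>2) \<le> norm ((norm c)\<^sup>2 * (norm (h x))\<^sup>2)"
        by (simp only: power2_abs norm_mult complex_mod_cnj power_mult_distrib real_norm_def abs_power2 abs_mult)
    qed
  qed measurable
  then show ?thesis by (simp add: square_integrable_real)
qed

text \<open>A real linear functional of several complex pairings is a single pairing with a real
  test function; this is what reduces joint laws to one-dimensional Gaussian ones.\<close>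

lemma Re_sum_pairing:
  fixes h :: "nat \<Rightarrow> 'x \<Rightarrow> complex" and u :: "'x \<Rightarrow> real"
  assumes h: "\<And>i. i < m \<Longrightarrow> square_integrable \<mu> (h i)" and u: "square_integrable \<mu> u"
    and U: "U \<in> borel_measurable \<mu>" "AE x in \<mu>. U x = complex_of_real (u x)"
  shows "(\<Sum>i<m. Re (c i * (\<integral>x. U x * cnj (h i x) \<partial>\<mu>))) = (\<integral>x. (\<Sum>i<m. Re (c i * cnj (h i x))) * u x \<partial>\<mu>)"
proof -
  note [measurable] = U(1)
  have [measurable]: "u \<in> borel_measurable \<mu>" using u by blast
  have one: "Re (c i * (\<integral>x. U x * cnj (h i x) \<partial>\<mu>)) = (\<integral>x. Re (c i * cnj (h i x)) * u x \<partial>\<mu>)" if i: "i < m" for i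
  proof -
    have [measurable]: "h i \<in> borel_measurable \<mu>" using h[OF i] by blast
    have r: "integrable \<mu> (\<lambda>x. Re (a * cnj (h i x)) * u x)" for a
      by (rule square_integrable_mult_integrable[OF square_integrable_Re_mult[OF h[OF i]] u])
    have int: "integrable \<mu> (\<lambda>x. complex_of_real (u x) * cnj (h i x))"
    proof -
      \<comment> \<open>From z = Re z - i Re (i z): both real parts are integrable by the real
        case.\<close>
      have "integrable \<mu> (\<lambda>x. complex_of_real (Re (1 * cnj (h i x)) * u x) - \<i> * complex_of_real (Re (\<i> * cnj (h i x)) * u x))"
        using r by (intro Bochner_Integration.integrable_diff integrable_mult_right integrable_of_real)
      moreover have "complex_of_real (Re (1 * cnj (h i x)) * u x) - \<i> * complex_of_real (Re (\<i> * cnj (h i x)) * u x)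
          = complex_of_real (u x) * cnj (h i x)" for x
        by (simp add: complex_eq_iff)
      ultimately show ?thesis by simp
    qed
    have "(\<integral>x. U x * cnj (h i x) \<partial>\<mu>) = (\<integral>x. complex_of_real (u x) * cnj (h i x) \<partial>\<mu>)"
      by (rule integral_cong_AE) (use U(2) in \<open>auto elim: eventually_mono\<close>)
    then have "c i * (\<integral>x. U x * cnj (h i x) \<partial>\<mu>) = (\<integral>x. c i * (complex_of_real (u x) * cnj (h i x)) \<partial>\<mu>)"
      by simp
    also have "Re \<dots> = (\<integral>x. Re (c i * (complex_of_real (u x) * cnj (h i x))) \<partial>\<mu>)"
      by (rule integral_Re[symmetric]) (use int in simp)
    also have "\<dots> = (\<integral>x. Re (c i * cnj (h i x)) * u x \<partial>\<mu>)"
      by (intro Bochner_Integration.integral_cong refl) (simp add: algebra_simps)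
    finally show ?thesis .
  qed
  have "(\<Sum>i<m. Re (c i * (\<integral>x. U x * cnj (h i x) \<partial>\<mu>))) = (\<Sum>i<m. (\<integral>x. Re (c i * cnj (h i x)) * u x \<partial>\<mu>))"
    by (intro sum.cong refl one) simp
  also have "\<dots> = (\<integral>x. (\<Sum>i<m. Re (c i * cnj (h i x)) * u x) \<partial>\<mu>)"
    by (intro Bochner_Integration.integral_sum[symmetric] square_integrable_mult_integrable square_integrable_Re_mult h u) simp
  finally show ?thesis by (simp add: sum_distrib_right)
qed

lemma field_pairing_measurable:
  assumes "prob_space \<mu>" and T: "random_field M \<mu> T" and [measurable]: "h \<in> borel_measurable \<mu>"
  shows "field_pairing \<mu> T h \<in> borel_measurable M"
proof -
  interpret prob_space \<mu> by fact
  have [measurable]: "(\<lambda>(\<omega>, x). T x \<omega>) \<in> borel_measurable (M \<Otimes>\<^sub>M \<mu>)" using T by (simp add: random_field_def)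
  show ?thesis unfolding field_pairing_def by measurable
qed

lemma pairing_law_eqI:
  fixes \<mu> :: "'x measure"
  assumes "prob_space M" "prob_space N" "prob_space \<mu>"
    and T: "random_field M \<mu> T" and T': "random_field N \<mu> T'"
    and h: "\<And>i. i < m \<Longrightarrow> square_integrable \<mu> (h i)"
    and eq: "\<And>c. (\<integral>\<omega>. iexp (\<Sum>i<m. Re (c i * field_pairing \<mu> T (h i) \<omega>)) \<partial>M) =
      (\<integral>\<omega>. iexp (\<Sum>i<m. Re (c i * field_pairing \<mu> T' (h i) \<omega>)) \<partial>N)"
  shows "pairing_law M \<mu> T m h = pairing_law N \<mu> T' m h"
proof -
  \<comment> \<open>Extending the family by 0 gives measurable pairings at every index, as
    \<open>cramer_wold_complex\<close> requires.\<close>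
  define H where "H i = (if i < m then h i else (\<lambda>_. 0))" for i
  have Hm: "H i \<in> borel_measurable \<mu>" for i using h[of i] by (auto simp: H_def)
  have law: "pairing_law P \<mu> U m h = distr P (\<Pi>\<^sub>M i\<in>{..<m}. borel) (\<lambda>\<omega>. \<lambda>i\<in>{..<m}. field_pairing \<mu> U (H i) \<omega>)" for P :: "'c measure" and U
    unfolding pairing_law_def by (intro distr_cong refl restrict_ext) (simp add: H_def)
  have s: "(\<Sum>i<m. Re (c i * field_pairing \<mu> U (H i) \<omega>)) = (\<Sum>i<m. Re (c i * field_pairing \<mu> U (h i) \<omega>))"
    for c and U :: "'x \<Rightarrow> 'c \<Rightarrow> complex" and \<omega>
    by (intro sum.cong refl) (simp add: H_def)
  show ?thesis
    unfolding law
    by (rule cramer_wold_complex[OF assms(1,2)])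
       (simp_all only: s eq field_pairing_measurable[OF assms(3) T Hm] field_pairing_measurable[OF assms(3) T' Hm])
qed

theorem theorem0p0p3:
  fixes act :: "'g::{topological_group_add, t2_space} \<Rightarrow> 'x::t2_space \<Rightarrow> 'x"
    and x0 :: 'x and K :: "'g set" and \<nu> :: "'g measure" and \<mu> :: "'x measure"
    and M :: "'a measure" and T :: "'x \<Rightarrow> 'a \<Rightarrow> complex"
    and N :: "'w measure" and I :: "'i set"
    and e :: "'i \<Rightarrow> 'x \<Rightarrow> real" and X :: "'i \<Rightarrow> 'w \<Rightarrow> real"
    and S :: "('x \<Rightarrow> complex) \<Rightarrow> 'w \<Rightarrow> complex"
  assumes "compact (UNIV :: 'g set)"
    and "continuous_action act" and "transitive_action act"
    and "K = isotropy_group act x0"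
    and "normalized_haar \<nu>" and "\<mu> = invariant_measure \<nu> act x0"
    and "prob_space M" and "random_field M \<mu> T" and "as_square_integrable M \<mu> T"
    and "isotropic act M \<mu> T" and "centered_real_gaussian_field M \<mu> T"
    and "white_noise N \<mu> I e X S"
  shows "\<exists>f. square_integrable \<mu> f \<and> (\<forall>x. f x \<in> \<real>) \<and> left_invariant act K f \<and>
           (\<exists>T'. noise_field_version act x0 N \<mu> S f T') \<and>
           (\<forall>T'. noise_field_version act x0 N \<mu> S f T' \<longrightarrow>
              as_square_integrable N \<mu> T' \<and> same_law \<mu> M T N T')"
proof -
  interpret compact_homogeneous_space act x0 \<nu> \<mu>
    by standard (use assms in auto)
  interpret M: prob_space M by fact
  interpret N: prob_space N using assms(12) by (simp add: white_noise_def)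
  interpret MP: pair_prob_space M \<mu> ..
  interpret PN: pair_prob_space \<mu> N ..
  have ob: "real_orthonormal_basis \<mu> I e" using assms(12) by (simp add: white_noise_def)
  have Tm[measurable]: "(\<lambda>(\<omega>, x). T x \<omega>) \<in> borel_measurable (M \<Otimes>\<^sub>M \<mu>)"
    using assms(8) by (simp add: random_field_def)
  have Tsec: "(\<lambda>x. T x \<omega>) \<in> borel_measurable \<mu>" if "\<omega> \<in> space M" for \<omega>
    using measurable_Pair2[OF Tm that] by simp
  define t where "t x \<omega> = Re (T x \<omega>)" for x \<omega>
  have T_eq: "T x \<omega> = complex_of_real (t x \<omega>)" if "\<omega> \<in> space M" for x \<omega>
    using assms(11) that by (auto simp: centered_real_gaussian_field_def t_def complex_is_Real_iff complex_eq_iff)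
  have tm[measurable]: "(\<lambda>(\<omega>, x). t x \<omega>) \<in> borel_measurable (M \<Otimes>\<^sub>M \<mu>)"
    unfolding t_def by measurable
  have tas: "AE \<omega> in M. square_integrable \<mu> (\<lambda>x. t x \<omega>)"
    using assms(9)[unfolded as_square_integrable_def] AE_space
  proof eventually_elim
    case (elim \<omega>)
    have "(\<lambda>x. t x \<omega>) \<in> borel_measurable \<mu>" unfolding t_def using Tsec[OF elim(2)] by measurable
    then show ?case using elim by (simp add: square_integrable_def T_eq)
  qed
  have cplx: "square_integrable \<mu> (\<lambda>x. complex_of_real (h x))" if "square_integrable \<mu> h" for h
  proof -
    have [measurable]: "h \<in> borel_measurable \<mu>" using that by blast
    have "(\<lambda>x. complex_of_real (h x)) \<in> borel_measurable \<mu>" by measurable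
    then show ?thesis using that by (simp add: square_integrable_def)
  qed
  have pair_real: "field_pairing \<mu> T (\<lambda>x. complex_of_real (h x)) \<omega> = complex_of_real (\<integral>x. t x \<omega> * h x \<partial>\<mu>)"
    if "\<omega> \<in> space M" for h \<omega>
    unfolding field_pairing_def using T_eq[OF that] by (simp flip: of_real_mult)
  have gauss: "centered_gaussian M (\<lambda>\<omega>. \<integral>x. t x \<omega> * h x \<partial>\<mu>)" if h: "square_integrable \<mu> h" for h
  proof (rule centered_gaussian_cong)
    show "centered_gaussian M (\<lambda>\<omega>. Re (field_pairing \<mu> T (\<lambda>x. complex_of_real (h x)) \<omega>))"
      using assms(11) cplx[OF h] by (simp add: centered_real_gaussian_field_def)
  qed (simp add: pair_real)
  have iso: "(\<integral>\<omega>. (\<integral>x. t x \<omega> * h (act (- g) x) \<partial>\<mu>)\<^sup>2 \<partial>M) = (\<integral>\<omega>. (\<integral>x. t x \<omega> * h x \<partial>\<mu>)\<^sup>2 \<partial>M)"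
    if h: "square_integrable \<mu> h" for g h
  proof -
    \<comment> \<open>The second moment is a functional of the law of a single pairing, so isotropy
      with m = 1 transfers it.\<close>
    have law: "(\<integral>\<omega>. (\<integral>x. t x \<omega> * u x \<partial>\<mu>)\<^sup>2 \<partial>M) =
        (\<integral>v. (Re (v 0))\<^sup>2 \<partial>pairing_law M \<mu> T 1 (\<lambda>_ x. complex_of_real (u x)))"
      if u: "square_integrable \<mu> u" for u
    proof -
      have [measurable]: "field_pairing \<mu> T (\<lambda>x. complex_of_real (u x)) \<in> borel_measurable M"
        by (rule field_pairing_measurable[OF \<mu>.prob_space_axioms assms(8) square_integrable_measurable[OF cplx[OF u]]])
      have [measurable]: "(\<lambda>v. v 0) \<in> measurable (\<Pi>\<^sub>M i\<in>{..<1::nat}. borel :: complex measure) borel"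
        by (rule measurable_component_singleton) simp
      have "(\<integral>v. (Re (v 0))\<^sup>2 \<partial>pairing_law M \<mu> T 1 (\<lambda>_ x. complex_of_real (u x))) =
          (\<integral>\<omega>. (Re (field_pairing \<mu> T (\<lambda>x. complex_of_real (u x)) \<omega>))\<^sup>2 \<partial>M)"
        unfolding pairing_law_def by (subst integral_distr) (auto intro!: measurable_restrict)
      also have "\<dots> = (\<integral>\<omega>. (\<integral>x. t x \<omega> * u x \<partial>\<mu>)\<^sup>2 \<partial>M)"
        by (intro Bochner_Integration.integral_cong refl) (simp add: pair_real)
      finally show ?thesis by simp
    qed
    have "pairing_law M \<mu> T 1 (\<lambda>_ x. complex_of_real (h x)) =
        pairing_law M \<mu> T 1 (\<lambda>_. translate act g (\<lambda>x. complex_of_real (h x)))"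
      by (rule assms(10)[unfolded isotropic_def, rule_format]) (simp_all add: cplx[OF h])
    then show ?thesis
      using law[OF h] law[OF square_integrable_translate[OF h, of "- g"]] by (simp add: translate_def)
  qed
  have tsq: "square_integrable (M \<Otimes>\<^sub>M \<mu>) (\<lambda>z. t (snd z) (fst z))"
    by (rule gaussian_field_second_moment[OF assms(7) \<mu>.prob_space_axioms ob tm tas gauss])
  obtain w where w: "w \<in> borel_measurable (M \<Otimes>\<^sub>M baire)" and tw: "AE z in M \<Otimes>\<^sub>M \<mu>. t (snd z) (fst z) = w z"
    using field_baire_version[OF assms(7) tsq] by blast
  have wm[measurable]: "w \<in> borel_measurable (M \<Otimes>\<^sub>M \<mu>)"
  proof -
    have "(\<lambda>z. (fst z, snd z)) \<in> measurable (M \<Otimes>\<^sub>M \<mu>) (M \<Otimes>\<^sub>M baire)" by measurable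
    from measurable_compose[OF this w] show ?thesis by simp
  qed
  have w2: "integrable (M \<Otimes>\<^sub>M \<mu>) (\<lambda>z. (w z)\<^sup>2)"
    by (rule Bochner_Integration.integrable_cong_AE_imp[of _ "\<lambda>z. (t (snd z) (fst z))\<^sup>2"])
       (use tsq tw in \<open>auto simp: square_integrable_real elim: eventually_mono\<close>)
  have tw': "AE \<omega> in M. AE x in \<mu>. t x \<omega> = w (\<omega>, x)"
    using MP.AE_pair[OF tw] by simp
  have w_pair: "(\<integral>\<omega>. (\<integral>y. w (\<omega>, y) * h y \<partial>\<mu>)\<^sup>2 \<partial>M) = (\<integral>\<omega>. (\<integral>y. t y \<omega> * h y \<partial>\<mu>)\<^sup>2 \<partial>M)"
    if h: "square_integrable \<mu> h" for h
  proof (rule integral_cong_AE)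
    have [measurable]: "h \<in> borel_measurable \<mu>" using h by blast
    have "(\<lambda>(\<omega>, y). w (\<omega>, y)) \<in> borel_measurable (M \<Otimes>\<^sub>M \<mu>)" using wm by simp
    then show "(\<lambda>\<omega>. (\<integral>y. w (\<omega>, y) * h y \<partial>\<mu>)\<^sup>2) \<in> borel_measurable M" by measurable
    show "(\<lambda>\<omega>. (\<integral>y. t y \<omega> * h y \<partial>\<mu>)\<^sup>2) \<in> borel_measurable M" by measurable
    show "AE \<omega> in M. (\<integral>y. w (\<omega>, y) * h y \<partial>\<mu>)\<^sup>2 = (\<integral>y. t y \<omega> * h y \<partial>\<mu>)\<^sup>2"
      using tw' AE_space
    proof eventually_elim
      case (elim \<omega>)
      have [measurable]: "(\<lambda>y. w (\<omega>, y)) \<in> borel_measurable \<mu>" "(\<lambda>y. t y \<omega>) \<in> borel_measurable \<mu>"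
        using measurable_Pair2[OF wm elim(2)] measurable_Pair2[OF tm elim(2)] by auto
      have "(\<integral>y. w (\<omega>, y) * h y \<partial>\<mu>) = (\<integral>y. t y \<omega> * h y \<partial>\<mu>)"
        by (rule integral_cong_AE) (use elim(1) in \<open>auto elim: eventually_mono\<close>)
      then show ?case by simp
    qed
  qed
  have w_iso: "(\<integral>\<omega>. (\<integral>y. w (\<omega>, y) * h (act (- g) y) \<partial>\<mu>)\<^sup>2 \<partial>M) = (\<integral>\<omega>. (\<integral>y. w (\<omega>, y) * h y \<partial>\<mu>)\<^sup>2 \<partial>M)"
    if "square_integrable \<mu> h" for g h
    unfolding w_pair[OF that] w_pair[OF square_integrable_translate[OF that]] by (rule iso[OF that])
  obtain k where k: "(\<lambda>(x, y). k x y) \<in> borel_measurable (\<mu> \<Otimes>\<^sub>M \<mu>)"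
    "\<And>g x y. k (act g x) (act g y) = k x y" "\<And>x. square_integrable \<mu> (k x)"
    "\<And>h. square_integrable \<mu> h \<Longrightarrow>
      (\<integral>y. (\<integral>x. h x * k x y \<partial>\<mu>)\<^sup>2 \<partial>\<mu>) = (\<integral>\<omega>. (\<integral>y. w (\<omega>, y) * h y \<partial>\<mu>)\<^sup>2 \<partial>M)"
    using invariant_root_of_field[OF assms(7) w w2 w_iso] by blast
  define \<sigma> where "\<sigma> \<phi> \<omega> = Re (S (\<lambda>x. complex_of_real (\<phi> x)) \<omega>)" for \<phi> \<omega>
  note \<sigma> = white_noise_real_part[OF assms(12), folded \<sigma>_def]
  obtain t' where t'm[measurable]: "(\<lambda>(\<omega>, x). t' x \<omega>) \<in> borel_measurable (N \<Otimes>\<^sub>M \<mu>)"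
    and t'_eq: "\<And>x. AE \<omega> in N. t' x \<omega> = \<sigma> (k x) \<omega>"
    using measurable_version[OF k(1-3) \<sigma>(1,3)] by blast
  have vp: "AE \<omega> in N. square_integrable \<mu> (\<lambda>x. t' x \<omega>)"
    "square_integrable \<mu> (\<lambda>y. \<integral>x. h x * k x y \<partial>\<mu>)"
    "AE \<omega> in N. (\<integral>x. h x * t' x \<omega> \<partial>\<mu>) = \<sigma> (\<lambda>y. \<integral>x. h x * k x y \<partial>\<mu>) \<omega>"
    if h: "square_integrable \<mu> h" for h
    by (rule version_pairing[OF N.prob_space_axioms k(1-3) \<sigma>(1,3) t'm t'_eq h]; assumption)+
  \<comment> \<open>The row of the kernel at the base point; by invariance its translate by g is the
    row at g x0, whatever g is chosen.\<close>
  define f where "f y = complex_of_real (k x0 y)" for y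
  have f_translate: "translate act g f = (\<lambda>y. complex_of_real (k x y))" if "act g x0 = x" for g x
    using k(2)[of g x0] that by (auto simp: translate_def f_def fun_eq_iff) (metis act_minus_cancel(1))
  have S_f: "AE \<omega> in N. complex_of_real (t' x \<omega>) = S (translate act g f) \<omega>" if "act g x0 = x" for g x
    unfolding f_translate[OF that] using \<sigma>(2)[OF k(3), of x] t'_eq[of x] by eventually_elim simp
  have "\<exists>T'. noise_field_version act x0 N \<mu> S f T'"
  proof (intro exI[of _ "\<lambda>x \<omega>. complex_of_real (t' x \<omega>)"])
    have "(\<lambda>(\<omega>, x). complex_of_real (t' x \<omega>)) \<in> borel_measurable (N \<Otimes>\<^sub>M \<mu>)" by measurable
    then show "noise_field_version act x0 N \<mu> S f (\<lambda>x \<omega>. complex_of_real (t' x \<omega>))"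
      unfolding noise_field_version_def random_field_def using S_f by blast
  qed
  moreover have "as_square_integrable N \<mu> T' \<and> same_law \<mu> M T N T'"
    if T': "noise_field_version act x0 N \<mu> S f T'" for T'
  proof -
    have T'r: "random_field N \<mu> T'" using T' by (simp add: noise_field_version_def)
    then have T'm[measurable]: "(\<lambda>(\<omega>, x). T' x \<omega>) \<in> borel_measurable (N \<Otimes>\<^sub>M \<mu>)" by (simp add: random_field_def)
    have "AE \<omega> in N. T' x \<omega> = complex_of_real (t' x \<omega>)" for x
    proof -
      obtain g where g: "act g x0 = x" using exists_group_element by blast
      have "AE \<omega> in N. T' x \<omega> = S (translate act g f) \<omega>" using T' g unfolding noise_field_version_def by blast
      with S_f[OF g] show ?thesis by eventually_elim simp
    qed
    \<comment> \<open>The exceptional event may depend on x. Joint measurability and Fubini's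
      theorem turn it into a null set of points for almost every \<omega>.\<close>
    then have "AE x in \<mu>. AE \<omega> in N. T' x \<omega> = complex_of_real (t' x \<omega>)" by simp
    moreover have "{z \<in> space (\<mu> \<Otimes>\<^sub>M N). T' (fst z) (snd z) = complex_of_real (t' (fst z) (snd z))} \<in> sets (\<mu> \<Otimes>\<^sub>M N)"
      by measurable
    ultimately have T't': "AE \<omega> in N. AE x in \<mu>. T' x \<omega> = complex_of_real (t' x \<omega>)"
      using PN.AE_commute[of "\<lambda>x \<omega>. T' x \<omega> = complex_of_real (t' x \<omega>)"] by simp
    have T'sec: "(\<lambda>x. T' x \<omega>) \<in> borel_measurable \<mu>" if "\<omega> \<in> space N" for \<omega>
      using measurable_Pair2[OF T'm that] by simp
    have "AE \<omega> in N. square_integrable \<mu> (\<lambda>x. T' x \<omega>)"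
      using T't' vp(1)[OF k(3)] AE_space
    proof eventually_elim
      case (elim \<omega>)
      have [measurable]: "(\<lambda>x. T' x \<omega>) \<in> borel_measurable \<mu>" by (rule T'sec[OF elim(3)])
      have t'2: "integrable \<mu> (\<lambda>x. (t' x \<omega>)\<^sup>2)" using elim(2) by (simp add: square_integrable_real)
      have "AE x in \<mu>. (t' x \<omega>)\<^sup>2 = (norm (T' x \<omega>))\<^sup>2" using elim(1) by eventually_elim simp
      then have "integrable \<mu> (\<lambda>x. (norm (T' x \<omega>))\<^sup>2)"
        by (rule Bochner_Integration.integrable_cong_AE_imp[OF t'2, rotated]) measurable
      then show ?case by (simp add: square_integrable_def)
    qed
    moreover have "same_law \<mu> M T N T'"
      unfolding same_law_def
    proof (intro allI impI)
      fix m and h :: "nat \<Rightarrow> 'x \<Rightarrow> complex" assume "\<forall>i<m. square_integrable \<mu> (h i)"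
      then have h: "\<And>i. i < m \<Longrightarrow> square_integrable \<mu> (h i)" by simp
      show "pairing_law M \<mu> T m h = pairing_law N \<mu> T' m h"
      proof (rule pairing_law_eqI[OF assms(7) N.prob_space_axioms \<mu>.prob_space_axioms assms(8) T'r h])
        fix c :: "nat \<Rightarrow> complex"
        \<comment> \<open>The single real test function to which \<open>Re_sum_pairing\<close>
          reduces the combination with coefficients \<open>c\<close>.\<close>
        define H where "H x = (\<Sum>i<m. Re (c i * cnj (h i x)))" for x
        have H: "square_integrable \<mu> H"
          unfolding H_def[abs_def] by (intro square_integrable_sum square_integrable_Re_mult h) simp
        have Hm[measurable]: "H \<in> borel_measurable \<mu>" using H by blast
        have fpm1: "field_pairing \<mu> T (h i) \<in> borel_measurable M" if "i < m" for i
          by (rule field_pairing_measurable[OF \<mu>.prob_space_axioms assms(8) square_integrable_measurable[OF h[OF that]]])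
        have fpm2: "field_pairing \<mu> T' (h i) \<in> borel_measurable N" if "i < m" for i
          by (rule field_pairing_measurable[OF \<mu>.prob_space_axioms T'r square_integrable_measurable[OF h[OF that]]])
        have HM: "(\<lambda>\<omega>. \<integral>x. t x \<omega> * H x \<partial>\<mu>) \<in> borel_measurable M" by measurable
        have "AE \<omega> in M. iexp (\<Sum>i<m. Re (c i * field_pairing \<mu> T (h i) \<omega>)) = iexp (\<integral>x. t x \<omega> * H x \<partial>\<mu>)"
          using tas AE_space
        proof eventually_elim
          case (elim \<omega>)
          have "AE x in \<mu>. T x \<omega> = complex_of_real (t x \<omega>)" using T_eq[OF elim(2)] by simp
          from Re_sum_pairing[of m \<mu> h, OF h elim(1) Tsec[OF elim(2)] this, of c]
          have "(\<Sum>i<m. Re (c i * field_pairing \<mu> T (h i) \<omega>)) = (\<integral>x. t x \<omega> * H x \<partial>\<mu>)"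
            unfolding field_pairing_def H_def by (simp only: mult.commute)
          then show ?case by (simp only:)
        qed
        then have "(\<integral>\<omega>. iexp (\<Sum>i<m. Re (c i * field_pairing \<mu> T (h i) \<omega>)) \<partial>M) =
            (\<integral>\<omega>. iexp (\<integral>x. t x \<omega> * H x \<partial>\<mu>) \<partial>M)"
          by (rule integral_cong_AE[rotated 2]) (use fpm1 HM in auto)
        also have "\<dots> = exp (- complex_of_real (\<integral>\<omega>. (\<integral>x. t x \<omega> * H x \<partial>\<mu>)\<^sup>2 \<partial>M) / 2)"
          by (rule M.centered_gaussian_facts(4)[OF gauss[OF H]])
        \<comment> \<open>The covariance identity behind the construction of \<open>k\<close>: both
          centered Gaussian variables have the same variance, hence the same characteristic
          function.\<close>
        also have "(\<integral>\<omega>. (\<integral>x. t x \<omega> * H x \<partial>\<mu>)\<^sup>2 \<partial>M) = (\<integral>y. (\<integral>x. H x * k x y \<partial>\<mu>)\<^sup>2 \<partial>\<mu>)"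
          unfolding k(4)[OF H] w_pair[OF H] ..
        also have "exp (- complex_of_real (\<integral>y. (\<integral>x. H x * k x y \<partial>\<mu>)\<^sup>2 \<partial>\<mu>) / 2) =
            (\<integral>\<omega>. iexp (\<sigma> (\<lambda>y. \<integral>x. H x * k x y \<partial>\<mu>) \<omega>) \<partial>N)"
          by (rule \<sigma>(4)[OF vp(2)[OF H], symmetric])
        also have "\<dots> = (\<integral>\<omega>. iexp (\<Sum>i<m. Re (c i * field_pairing \<mu> T' (h i) \<omega>)) \<partial>N)"
        proof -
          have "AE \<omega> in N. iexp (\<sigma> (\<lambda>y. \<integral>x. H x * k x y \<partial>\<mu>) \<omega>) = iexp (\<Sum>i<m. Re (c i * field_pairing \<mu> T' (h i) \<omega>))"
            using T't' vp(1)[OF H] vp(3)[OF H] AE_space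
          proof eventually_elim
            case (elim \<omega>)
            from Re_sum_pairing[of m \<mu> h, OF h elim(2) T'sec[OF elim(4)] elim(1), of c] elim(3)
            have "(\<Sum>i<m. Re (c i * field_pairing \<mu> T' (h i) \<omega>)) = \<sigma> (\<lambda>y. \<integral>x. H x * k x y \<partial>\<mu>) \<omega>"
              unfolding field_pairing_def H_def by (simp only:)
            then show ?case by (simp only:)
          qed
          then show ?thesis
            by (rule integral_cong_AE[rotated 2])
               (use fpm2 square_integrable_measurable[OF \<sigma>(1)[OF vp(2)[OF H]]] in auto)
        qed
        finally show "(\<integral>\<omega>. iexp (\<Sum>i<m. Re (c i * field_pairing \<mu> T (h i) \<omega>)) \<partial>M) =
            (\<integral>\<omega>. iexp (\<Sum>i<m. Re (c i * field_pairing \<mu> T' (h i) \<omega>)) \<partial>N)" .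
      qed
    qed
    ultimately show ?thesis by (simp add: as_square_integrable_def)
  qed
  moreover have "left_invariant act K f"
    unfolding left_invariant_def
  proof (intro ballI allI)
    fix g y assume "g \<in> K"
    then have "act g x0 = x0" by (simp add: assms(4) isotropy_group_def)
    \<comment> \<open>An element of the isotropy group fixes the first argument of \<open>k\<close>,
      so invariance acts on the second alone.\<close>
    then show "f (act g y) = f y" using k(2)[of g x0 y] by (simp add: f_def)
  qed
  moreover have "square_integrable \<mu> f" unfolding f_def[abs_def] by (rule cplx[OF k(3)])
  moreover have "\<forall>x. f x \<in> \<real>" by (simp add: f_def)
  ultimately show ?thesis by blast
qed

end
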